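(* Let $R$ be a semiperfect, right ss-injective ring such that $S_r$ is essential in $R_R$. Then $R$ is a right minfull ring and the following statements hold: (1) Every simple right ideal of $R$ is essential in a direct summand of $R_R$. (2) $\mathrm{soc}(eR)$ is simple and essential in $eR$ for every local idempotent $e\in R$. Moreover, $R$ is right finitely cogenerated. (3) For every semisimple right ideal $I$ of $R$ there exists $e=e^2\in R$ such that $I\subseteq^{ess} rl(I)\subseteq^{ess} eR$. (4) $S_r\subseteq S_\ell\subseteq rl(S_r)$. (5) If $I$ is a semisimple right ideal of $R$ and $aR$ is a simple right ideal of $R$ with $I\cap aR=0$, then $rl(I\oplus aR)=rl(I)\oplus rl(aR)$. (6) $rl\left(\bigoplus_{i=1}^{n}a_iR\right)=\bigoplus_{i=1}^{n} rl(a_iR)$ whenever $\bigoplus_{i=1}^{n}a_iR$ is a direct sum of simple right ideals. (7) The following statements are equivalent: (a) $S_r=rl(S_r)$. (b) $K=rl(K)$ for every semisimple right ideal $K$ of $R$. (c) $kR=rl(kR)$ for every simple right ideal $kR$ of $R$. (d) $S_r=S_\ell$. (e) $\mathrm{soc}(Re)$ is simple for every local idempotent $e\in R$. (f) $\mathrm{soc}(Re)=S_re$ for every local idempotent $e\in R$. (g) $R$ is left mininjective. (h) $L=lr(L)$ for every semisimple left ideal $L$ of $R$. (i) $R$ is a left minfull ring. (j) $S_r\cap J=rl(S_r\cap J)$. (k) $K=rl(K)$ for every semisimple small right ideal $K$ of $R$. (l) $L=lr(L)$ for every semisimple small left ideal $L$ of $R$. (8) If $R$ satisfies any of the conditions in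 (7), then $r(S_\ell\cap J)$ is essential in $R_R$.
   Context: Rings are associative with identity. $S_r=\mathrm{soc}(R_R)$ and $S_\ell=\mathrm{soc}({}_RR)$ are the right and left socles of $R$; $J$ is the Jacobson radical. For $X\subseteq R$, $r(X)=\{a\in R: Xa=0\}$ and $l(X)=\{a\in R: aX=0\}$, and $rl(X)=r(l(X))$, $lr(X)=l(r(X))$. $A\subseteq^{ess}B$ means $A$ is an essential submodule of $B$ (as right $R$-modules). A submodule $K$ of a module $N$ is small if $K+L\neq N$ for every proper submodule $L$ of $N$; a small right (left) ideal is one that is small in $R_R$ (in ${}_RR$). $R$ is right ss-injective if for every semisimple small right ideal $K$ of $R$, every right $R$-homomorphism $K\to R_R$ extends to $R_R$. $R$ is right mininjective if for every simple right ideal $I$, every right $R$-homomorphism $I\to R_R$ extends to $R_R$; left mininjective is defined symmetrically. $R$ is right minfull if it is semiperfect, right mininjective and $\mathrm{soc}(eR)\neq0$ for each local idempotent $e\in R$; left minfull is defined symmetrically (with $\mathrm{soc}(Re)$). An idempotent $e$ is local if $eRe$ is a local ring. $R$ is right finitely cogenerated if $R_R$ is a finitely cogenerated module, i.e. $\mathrm{soc}(R_R)$ is finitely generated and essential in $R_R$. *)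

theory Defs
  imports "HOL-Algebra.QuotRing"
begin

text \<open>
  Rings are rings with identity in the sense of the locale \<^locale>\<open>ring\<close>, not necessarily
  commutative; the zero ring is allowed. The submodules of a right ideal \<open>N\<close>, viewed as a right
  \<open>R\<close>-module, are the right ideals of \<open>R\<close> contained in \<open>N\<close>, so module-theoretic notions are
  stated for right ideals. The principal right ideal \<open>aR\<close> is \<open>a <# carrier R\<close> and the principal
  left ideal \<open>Ra\<close> is \<open>carrier R #> a\<close>.

  Left-sided notions are the right-sided ones of the opposite ring.
\<close>

definition opp :: "('a, 'm) ring_scheme \<Rightarrow> ('a, 'm) ring_scheme" where
  "opp R = R\<lparr>mult := \<lambda>x y. y \<otimes>\<^bsub>R\<^esub> x\<rparr>"

definition right_ideal :: "('a, 'm) ring_scheme \<Rightarrow> 'a set \<Rightarrow> bool" where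
  "right_ideal R I \<longleftrightarrow>
     additive_subgroup I R \<and> (\<forall>a\<in>I. \<forall>x\<in>carrier R. a \<otimes>\<^bsub>R\<^esub> x \<in> I)"

definition right_span :: "('a, 'm) ring_scheme \<Rightarrow> 'a set \<Rightarrow> 'a set" where
  "right_span R A = \<Inter>{I. right_ideal R I \<and> A \<subseteq> I}"

definition simple_right_ideal :: "('a, 'm) ring_scheme \<Rightarrow> 'a set \<Rightarrow> bool" where
  "simple_right_ideal R S \<longleftrightarrow> right_ideal R S \<and> S \<noteq> {\<zero>\<^bsub>R\<^esub>} \<and>
     (\<forall>L. right_ideal R L \<and> L \<subseteq> S \<longrightarrow> L = {\<zero>\<^bsub>R\<^esub>} \<or> L = S)"

definition maximal_right_ideal :: "('a, 'm) ring_scheme \<Rightarrow> 'a set \<Rightarrow> bool" where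
  "maximal_right_ideal R M \<longleftrightarrow> right_ideal R M \<and> M \<noteq> carrier R \<and>
     (\<forall>L. right_ideal R L \<and> M \<subseteq> L \<longrightarrow> L = M \<or> L = carrier R)"

text \<open>The socle of a right ideal \<open>N\<close> is the sum of its simple submodules.\<close>

definition right_socle :: "('a, 'm) ring_scheme \<Rightarrow> 'a set \<Rightarrow> 'a set" where
  "right_socle R N = right_span R (\<Union>{S. simple_right_ideal R S \<and> S \<subseteq> N})"

abbreviation left_socle :: "('a, 'm) ring_scheme \<Rightarrow> 'a set \<Rightarrow> 'a set" where
  "left_socle R N \<equiv> right_socle (opp R) N"

definition semisimple_right_ideal :: "('a, 'm) ring_scheme \<Rightarrow> 'a set \<Rightarrow> bool" where
  "semisimple_right_ideal R K \<longleftrightarrow> right_ideal R K \<and> right_socle R K = K"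

abbreviation semisimple_left_ideal :: "('a, 'm) ring_scheme \<Rightarrow> 'a set \<Rightarrow> bool" where
  "semisimple_left_ideal R L \<equiv> semisimple_right_ideal (opp R) L"

definition essential_in :: "('a, 'm) ring_scheme \<Rightarrow> 'a set \<Rightarrow> 'a set \<Rightarrow> bool" where
  "essential_in R A B \<longleftrightarrow> right_ideal R A \<and> right_ideal R B \<and> A \<subseteq> B \<and>
     (\<forall>C. right_ideal R C \<and> C \<subseteq> B \<and> C \<noteq> {\<zero>\<^bsub>R\<^esub>} \<longrightarrow> A \<inter> C \<noteq> {\<zero>\<^bsub>R\<^esub>})"

definition small_right_ideal :: "('a, 'm) ring_scheme \<Rightarrow> 'a set \<Rightarrow> bool" where
  "small_right_ideal R K \<longleftrightarrow> right_ideal R K \<and>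
     (\<forall>L. right_ideal R L \<and> L \<noteq> carrier R \<longrightarrow> K <+>\<^bsub>R\<^esub> L \<noteq> carrier R)"

abbreviation small_left_ideal :: "('a, 'm) ring_scheme \<Rightarrow> 'a set \<Rightarrow> bool" where
  "small_left_ideal R L \<equiv> small_right_ideal (opp R) L"

definition r_ann :: "('a, 'm) ring_scheme \<Rightarrow> 'a set \<Rightarrow> 'a set" where
  "r_ann R A = {a \<in> carrier R. \<forall>x\<in>A. x \<otimes>\<^bsub>R\<^esub> a = \<zero>\<^bsub>R\<^esub>}"

definition l_ann :: "('a, 'm) ring_scheme \<Rightarrow> 'a set \<Rightarrow> 'a set" where
  "l_ann R A = {a \<in> carrier R. \<forall>x\<in>A. a \<otimes>\<^bsub>R\<^esub> x = \<zero>\<^bsub>R\<^esub>}"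

abbreviation rl_ann :: "('a, 'm) ring_scheme \<Rightarrow> 'a set \<Rightarrow> 'a set" where
  "rl_ann R A \<equiv> r_ann R (l_ann R A)"

abbreviation lr_ann :: "('a, 'm) ring_scheme \<Rightarrow> 'a set \<Rightarrow> 'a set" where
  "lr_ann R A \<equiv> l_ann R (r_ann R A)"

text \<open>\<open>direct_sum2 R A B C\<close> says that \<open>C\<close> is the internal direct sum of \<open>A\<close> and \<open>B\<close>;
  \<open>direct_sum R I A C\<close> says the same for a finite family \<open>A\<close> indexed by \<open>I\<close>.\<close>

definition direct_sum2 ::
    "('a, 'm) ring_scheme \<Rightarrow> 'a set \<Rightarrow> 'a set \<Rightarrow> 'a set \<Rightarrow> bool" where
  "direct_sum2 R A B C \<longleftrightarrow> A \<inter> B = {\<zero>\<^bsub>R\<^esub>} \<and> C = A <+>\<^bsub>R\<^esub> B"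

definition direct_sum ::
    "('a, 'm) ring_scheme \<Rightarrow> 'i set \<Rightarrow> ('i \<Rightarrow> 'a set) \<Rightarrow> 'a set \<Rightarrow> bool" where
  "direct_sum R I A C \<longleftrightarrow>
     (\<forall>f \<in> Pi I A. finsum R f I = \<zero>\<^bsub>R\<^esub> \<longrightarrow> (\<forall>i\<in>I. f i = \<zero>\<^bsub>R\<^esub>)) \<and>
     C = (\<lambda>f. finsum R f I) ` Pi I A"

definition right_direct_summand :: "('a, 'm) ring_scheme \<Rightarrow> 'a set \<Rightarrow> bool" where
  "right_direct_summand R D \<longleftrightarrow> right_ideal R D \<and>
     (\<exists>D'. right_ideal R D' \<and> direct_sum2 R D D' (carrier R))"

definition right_hom :: "('a, 'm) ring_scheme \<Rightarrow> 'a set \<Rightarrow> ('a \<Rightarrow> 'a) set" where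
  "right_hom R K = {f \<in> K \<rightarrow> carrier R.
     (\<forall>x\<in>K. \<forall>y\<in>K. f (x \<oplus>\<^bsub>R\<^esub> y) = f x \<oplus>\<^bsub>R\<^esub> f y) \<and>
     (\<forall>x\<in>K. \<forall>r\<in>carrier R. f (x \<otimes>\<^bsub>R\<^esub> r) = f x \<otimes>\<^bsub>R\<^esub> r)}"

text \<open>Every homomorphism from the right ideal \<open>K\<close> to \<open>R\<close> extends to \<open>R\<close>.\<close>

definition homs_extend :: "('a, 'm) ring_scheme \<Rightarrow> 'a set \<Rightarrow> bool" where
  "homs_extend R K \<longleftrightarrow>
     (\<forall>f \<in> right_hom R K. \<exists>g \<in> right_hom R (carrier R). \<forall>x\<in>K. g x = f x)"

definition right_ss_injective :: "('a, 'm) ring_scheme \<Rightarrow> bool" where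
  "right_ss_injective R \<longleftrightarrow>
     (\<forall>K. semisimple_right_ideal R K \<and> small_right_ideal R K \<longrightarrow> homs_extend R K)"

definition right_mininjective :: "('a, 'm) ring_scheme \<Rightarrow> bool" where
  "right_mininjective R \<longleftrightarrow> (\<forall>I. simple_right_ideal R I \<longrightarrow> homs_extend R I)"

abbreviation left_mininjective :: "('a, 'm) ring_scheme \<Rightarrow> bool" where
  "left_mininjective R \<equiv> right_mininjective (opp R)"

text \<open>The intersection with the carrier covers the zero ring, which has no maximal right ideal.\<close>

definition jacobson :: "('a, 'm) ring_scheme \<Rightarrow> 'a set" where
  "jacobson R = carrier R \<inter> \<Inter>{M. maximal_right_ideal R M}"

definition idempotent_elem :: "('a, 'm) ring_scheme \<Rightarrow> 'a \<Rightarrow> bool" where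
  "idempotent_elem R e \<longleftrightarrow> e \<in> carrier R \<and> e \<otimes>\<^bsub>R\<^esub> e = e"

definition corner_ring :: "('a, 'm) ring_scheme \<Rightarrow> 'a \<Rightarrow> ('a, 'm) ring_scheme" where
  "corner_ring R e =
     R\<lparr>carrier := {e \<otimes>\<^bsub>R\<^esub> x \<otimes>\<^bsub>R\<^esub> e | x. x \<in> carrier R}, one := e\<rparr>"

definition local_ring :: "('a, 'm) ring_scheme \<Rightarrow> bool" where
  "local_ring R \<longleftrightarrow> (\<exists>!M. maximal_right_ideal R M)"

definition local_idempotent :: "('a, 'm) ring_scheme \<Rightarrow> 'a \<Rightarrow> bool" where
  "local_idempotent R e \<longleftrightarrow> idempotent_elem R e \<and> local_ring (corner_ring R e)"

definition semisimple_ring :: "('a, 'm) ring_scheme \<Rightarrow> bool" where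
  "semisimple_ring R \<longleftrightarrow> semisimple_right_ideal R (carrier R)"

text \<open>\<open>R\<close> is semiperfect if \<open>R/J\<close> is semisimple and idempotents lift modulo \<open>J\<close>.\<close>

definition semiperfect :: "('a, 'm) ring_scheme \<Rightarrow> bool" where
  "semiperfect R \<longleftrightarrow> semisimple_ring (R Quot jacobson R) \<and>
     (\<forall>a\<in>carrier R. a \<otimes>\<^bsub>R\<^esub> a \<ominus>\<^bsub>R\<^esub> a \<in> jacobson R \<longrightarrow>
        (\<exists>e. idempotent_elem R e \<and> e \<ominus>\<^bsub>R\<^esub> a \<in> jacobson R))"

definition right_minfull :: "('a, 'm) ring_scheme \<Rightarrow> bool" where
  "right_minfull R \<longleftrightarrow> semiperfect R \<and> right_mininjective R \<and>
     (\<forall>e. local_idempotent R e \<longrightarrow> right_socle R (e <#\<^bsub>R\<^esub> carrier R) \<noteq> {\<zero>\<^bsub>R\<^esub>})"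

definition left_minfull :: "('a, 'm) ring_scheme \<Rightarrow> bool" where
  "left_minfull R \<longleftrightarrow> semiperfect R \<and> left_mininjective R \<and>
     (\<forall>e. local_idempotent R e \<longrightarrow> left_socle R (carrier R #>\<^bsub>R\<^esub> e) \<noteq> {\<zero>\<^bsub>R\<^esub>})"

definition right_finitely_cogenerated :: "('a, 'm) ring_scheme \<Rightarrow> bool" where
  "right_finitely_cogenerated R \<longleftrightarrow>
     (\<exists>A. finite A \<and> A \<subseteq> carrier R \<and> right_span R A = right_socle R (carrier R)) \<and>
     essential_in R (right_socle R (carrier R)) (carrier R)"

abbreviation S_r :: "('a, 'm) ring_scheme \<Rightarrow> 'a set" where
  "S_r R \<equiv> right_socle R (carrier R)"

abbreviation S_l :: "('a, 'm) ring_scheme \<Rightarrow> 'a set" where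
  "S_l R \<equiv> left_socle R (carrier R)"

end

theory Submission
  imports Defs
begin

text \<open>
  Write \<open>J\<close> for the Jacobson radical, \<open>S\<close> for the right socle, \<open>r\<close> and \<open>l\<close> for annihilators. Four
  observations carry the proof.

  First, in a semiperfect ring every right ideal \<open>K\<close> contains an idempotent \<open>g\<close> with
  \<open>(\<one> - g) K \<subseteq> J\<close> (\<open>right_ideal_idempotent\<close>), and every right ideal outside \<open>J\<close> contains a local
  idempotent. Consequently a right ideal that contains all local idempotents is the whole ring
  (\<open>right_ideal_all_local_idempotents\<close>). This takes the place of a decomposition of \<open>\<one>\<close> into
  orthogonal local idempotents: to prove a statement about \<open>S\<close> or \<open>r(J)\<close>, it is enough to check it
  after multiplication by one local idempotent \<open>e\<close>, where \<open>eRe\<close> has only trivial idempotents.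

  Second, ss-injectivity extends homomorphisms from all semisimple right ideals \<open>K\<close>, small or not,
  because the part \<open>gR\<close> is a direct summand and the rest lies in \<open>J\<close>
  (\<open>semisimple_hom_left_mult\<close>). So every projection of a semisimple right ideal onto a summand is
  left multiplication by an element of \<open>R\<close>. These multipliers give mininjectivity, the uniqueness of
  simple submodules of \<open>eR\<close>, and the decomposition of \<open>rl\<close> of a direct sum. As \<open>S\<close> is
  essential, \<open>l(S) = J\<close> (\<open>l_ann_S\<close>): a multiplier that is idempotent on \<open>S\<close> is idempotent modulo
  \<open>J\<close>, and since \<open>J S = 0\<close> an idempotent lift acts on \<open>S\<close> in the same way. That places each
  semisimple \<open>I\<close> and \<open>rl(I)\<close> as essential submodules of some \<open>eR\<close>. Moreover \<open>r(J) = S\<^sub>l\<close>, hence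
  \<open>rl(S) = S\<^sub>l\<close>.

  Third, every simple right module embeds in \<open>R\<close>, in the form \<open>r(S) = J\<close> (\<open>r_ann_S\<close>). It follows from
  a monotone injective operator on the ideals above \<open>J\<close> and the ascending chain condition in \<open>R/J\<close>.
  As \<open>r(s e)\<close> depends only on the local idempotent \<open>e\<close> whenever \<open>s \<in> S\<close> and \<open>s e \<noteq> \<zero>\<close>, each \<open>Se\<close>
  is a simple left ideal.

  Fourth, all conditions in the list are equivalent to \<open>S = S\<^sub>l\<close>. If \<open>S = S\<^sub>l\<close>, then
  \<open>rl(K) \<subseteq> rl(S) = S\<close> is a semisimple essential extension of a semisimple \<open>K\<close>, so it equals \<open>K\<close>; for
  the converse it is enough to know \<open>rl\<close> on the simple right ideals \<open>eS\<close>, or on \<open>S \<inter> J\<close>. The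
  conditions on left socles follow from \<open>soc(Re) = S\<^sub>l e\<close> and the simplicity of \<open>Se\<close>. For left
  ideals one uses that, in a right mininjective ring, adding \<open>Rk\<close> with \<open>kR\<close> simple to \<open>L\<close> preserves
  \<open>L = lr(L)\<close> (\<open>mininjective_lr_ann_add\<close>). The conditions on small ideals suffice because a simple
  left ideal outside \<open>J = r(S)\<close> lies in \<open>S\<close> anyway.
\<close>

(* A <+> B is the sum of subsets of a ring, not the disjoint sum of sets. *)
no_notation Sum_Type.Plus (infixr "<+>" 65)

section \<open>Right ideals, sums and the opposite ring\<close>

lemma opp_simps [simp]:
  "carrier (opp R) = carrier R" "\<zero>\<^bsub>opp R\<^esub> = \<zero>\<^bsub>R\<^esub>" "\<one>\<^bsub>opp R\<^esub> = \<one>\<^bsub>R\<^esub>"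
  "x \<oplus>\<^bsub>opp R\<^esub> y = x \<oplus>\<^bsub>R\<^esub> y" "x \<otimes>\<^bsub>opp R\<^esub> y = y \<otimes>\<^bsub>R\<^esub> x" "opp (opp R) = R"
  "A <+>\<^bsub>opp R\<^esub> B = A <+>\<^bsub>R\<^esub> B" by (simp_all add: opp_def set_add_def')

lemma opp_ring: "ring R \<Longrightarrow> ring (opp R)"
proof -
  assume "ring R"
  then interpret ring R .
  show ?thesis
  proof (rule ringI)
    show "abelian_group (opp R)"
      using add.Units_l_inv_ex by (intro abelian_groupI) (auto simp: a_ac)
    show "monoid (opp R)" by (intro monoidI) (auto simp: m_assoc)
  qed (auto simp: l_distr r_distr)
qed

lemma opp_l_coset: "a <#\<^bsub>opp R\<^esub> A = A #>\<^bsub>R\<^esub> a" by (auto simp: l_coset_def r_coset_def)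

lemma opp_r_coset: "A #>\<^bsub>opp R\<^esub> a = a <#\<^bsub>R\<^esub> A" by (auto simp: l_coset_def r_coset_def)

lemma opp_r_ann [simp]: "r_ann (opp R) A = l_ann R A" by (auto simp: r_ann_def l_ann_def)

lemma opp_l_ann [simp]: "l_ann (opp R) A = r_ann R A" by (auto simp: r_ann_def l_ann_def)

lemma mem_principal: "y \<in> x <#\<^bsub>R\<^esub> A \<longleftrightarrow> (\<exists>r\<in>A. y = x \<otimes>\<^bsub>R\<^esub> r)" by (auto simp: l_coset_def)

lemma mem_principal_left: "y \<in> A #>\<^bsub>R\<^esub> x \<longleftrightarrow> (\<exists>r\<in>A. y = r \<otimes>\<^bsub>R\<^esub> x)" by (auto simp: r_coset_def)

lemma mem_set_add: "y \<in> A <+>\<^bsub>R\<^esub> B \<longleftrightarrow> (\<exists>a\<in>A. \<exists>b\<in>B. y = a \<oplus>\<^bsub>R\<^esub> b)" by (auto simp: set_add_def')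

context ring
begin

lemma right_idealI:
  assumes "I \<subseteq> carrier R" "\<zero> \<in> I" "\<And>x y. x \<in> I \<Longrightarrow> y \<in> I \<Longrightarrow> x \<oplus> y \<in> I"
    "\<And>x r. x \<in> I \<Longrightarrow> r \<in> carrier R \<Longrightarrow> x \<otimes> r \<in> I"
  shows "right_ideal R I" unfolding right_ideal_def
proof (intro conjI ballI)
  show "additive_subgroup I R"
  proof (intro additive_subgroup.intro add.subgroupI)
    fix x assume "x \<in> I"
    moreover from this assms(1) have "\<ominus> x = x \<otimes> (\<ominus> \<one>)" using r_minus[of x \<one>] by auto
    ultimately show "\<ominus> x \<in> I" using assms(4) by simp
  qed (use assms in auto)
qed (use assms in auto)

lemma right_idealD:
  assumes "right_ideal R I"
  shows "x \<in> I \<Longrightarrow> x \<in> carrier R" "\<zero> \<in> I" "x \<in> I \<Longrightarrow> y \<in> I \<Longrightarrow> x \<oplus> y \<in> I"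
    "x \<in> I \<Longrightarrow> r \<in> carrier R \<Longrightarrow> x \<otimes> r \<in> I" "x \<in> I \<Longrightarrow> \<ominus> x \<in> I"
    "x \<in> I \<Longrightarrow> y \<in> I \<Longrightarrow> x \<ominus> y \<in> I"
proof -
  interpret additive_subgroup I R using assms by (simp add: right_ideal_def)
  show "x \<in> I \<Longrightarrow> x \<in> carrier R" "\<zero> \<in> I" "x \<in> I \<Longrightarrow> y \<in> I \<Longrightarrow> x \<oplus> y \<in> I"
    "x \<in> I \<Longrightarrow> \<ominus> x \<in> I" "x \<in> I \<Longrightarrow> y \<in> I \<Longrightarrow> x \<ominus> y \<in> I" by (auto simp: a_minus_def)
  show "x \<in> I \<Longrightarrow> r \<in> carrier R \<Longrightarrow> x \<otimes> r \<in> I" using assms by (simp add: right_ideal_def)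
qed

lemma right_ideal_subset: "right_ideal R I \<Longrightarrow> I \<subseteq> carrier R" using right_idealD(1) by blast

lemma right_ideal_zero [simp]: "right_ideal R {\<zero>}" by (rule right_idealI) auto

lemma right_ideal_carrier [simp]: "right_ideal R (carrier R)" by (rule right_idealI) auto

lemma right_ideal_eq_carrierI: "right_ideal R I \<Longrightarrow> \<one> \<in> I \<Longrightarrow> I = carrier R"
  using right_idealD(4)[of I \<one>] right_ideal_subset[of I] by auto

lemma right_ideal_principal:
  assumes "x \<in> carrier R"
  shows "right_ideal R (x <# carrier R)"
proof (rule right_idealI)
  show "\<zero> \<in> x <# carrier R" using assms by (auto simp: mem_principal intro!: bexI[of _ \<zero>])
next
  fix y z assume "y \<in> x <# carrier R" "z \<in> x <# carrier R"
  then obtain r s where "r \<in> carrier R" "s \<in> carrier R" "y = x \<otimes> r" "z = x \<otimes> s"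
    by (auto simp: mem_principal)
  then show "y \<oplus> z \<in> x <# carrier R"
    using assms by (auto simp: mem_principal r_distr intro!: bexI[of _ "r \<oplus> s"])
next
  fix y s assume "y \<in> x <# carrier R" and s: "s \<in> carrier R"
  then obtain r where "r \<in> carrier R" "y = x \<otimes> r" by (auto simp: mem_principal)
  then show "y \<otimes> s \<in> x <# carrier R"
    using assms s by (auto simp: mem_principal m_assoc intro!: bexI[of _ "r \<otimes> s"])
qed (use assms in \<open>auto simp: mem_principal\<close>)

lemma principal_self: "x \<in> carrier R \<Longrightarrow> x \<in> x <# carrier R"
  by (auto simp: mem_principal intro!: bexI[of _ \<one>])

lemma principal_subset: "right_ideal R I \<Longrightarrow> x \<in> I \<Longrightarrow> x <# carrier R \<subseteq> I"
  using right_idealD(4) by (auto simp: mem_principal)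

lemma right_ideal_Int: "right_ideal R A \<Longrightarrow> right_ideal R B \<Longrightarrow> right_ideal R (A \<inter> B)"
  by (rule right_idealI) (auto intro: right_idealD(1-4))

lemma right_ideal_set_add:
  assumes A: "right_ideal R A" and B: "right_ideal R B"
  shows "right_ideal R (A <+> B)"
proof (rule right_idealI)
  show "A <+> B \<subseteq> carrier R"
    using right_idealD(1)[OF A] right_idealD(1)[OF B] by (auto simp: mem_set_add)
  show "\<zero> \<in> A <+> B"
    using right_idealD(2)[OF A] right_idealD(2)[OF B] by (auto simp: mem_set_add intro!: bexI[of _ \<zero>])
next
  fix x y assume "x \<in> A <+> B" "y \<in> A <+> B"
  then obtain a b c d where *: "a \<in> A" "b \<in> B" "x = a \<oplus> b" "c \<in> A" "d \<in> B" "y = c \<oplus> d"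
    by (auto simp: mem_set_add)
  moreover have "a \<in> carrier R" "b \<in> carrier R" "c \<in> carrier R" "d \<in> carrier R"
    using * right_idealD(1)[OF A] right_idealD(1)[OF B] by auto
  ultimately have "x \<oplus> y = (a \<oplus> c) \<oplus> (b \<oplus> d)" by (simp add: a_ac)
  then show "x \<oplus> y \<in> A <+> B"
    using * right_idealD(3)[OF A] right_idealD(3)[OF B] unfolding mem_set_add by blast
next
  fix x r assume "x \<in> A <+> B" and r: "r \<in> carrier R"
  then obtain a b where *: "a \<in> A" "b \<in> B" "x = a \<oplus> b" by (auto simp: mem_set_add)
  then have "x \<otimes> r = a \<otimes> r \<oplus> b \<otimes> r"
    using r right_idealD(1)[OF A] right_idealD(1)[OF B] by (simp add: l_distr)
  then show "x \<otimes> r \<in> A <+> B"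
    using * r right_idealD(4)[OF A] right_idealD(4)[OF B] unfolding mem_set_add by blast
qed

lemma set_add_mono:
  assumes "right_ideal R A" "right_ideal R B"
  shows "A \<subseteq> A <+> B" "B \<subseteq> A <+> B"
proof -
  show "A \<subseteq> A <+> B"
  proof
    fix a assume "a \<in> A"
    moreover have "a = a \<oplus> \<zero>" using right_idealD(1)[OF assms(1) \<open>a \<in> A\<close>] by simp
    ultimately show "a \<in> A <+> B"
      using right_idealD(2)[OF assms(2)] unfolding mem_set_add by blast
  qed
  show "B \<subseteq> A <+> B"
  proof
    fix b assume "b \<in> B"
    moreover have "b = \<zero> \<oplus> b" using right_idealD(1)[OF assms(2) \<open>b \<in> B\<close>] by simp
    ultimately show "b \<in> A <+> B"
      using right_idealD(2)[OF assms(1)] unfolding mem_set_add by blast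
  qed
qed

lemma set_add_least: "right_ideal R C \<Longrightarrow> A \<subseteq> C \<Longrightarrow> B \<subseteq> C \<Longrightarrow> A <+> B \<subseteq> C"
  using right_idealD(3)[of C] by (fastforce simp: mem_set_add)

lemma right_ideal_Union_chain:
  assumes "\<C> \<noteq> {}" "\<And>I. I \<in> \<C> \<Longrightarrow> right_ideal R I"
    and chain: "\<And>I K. I \<in> \<C> \<Longrightarrow> K \<in> \<C> \<Longrightarrow> I \<subseteq> K \<or> K \<subseteq> I"
  shows "right_ideal R (\<Union>\<C>)"
proof (rule right_idealI)
  show "\<Union>\<C> \<subseteq> carrier R" using assms(2) right_ideal_subset by blast
  show "\<zero> \<in> \<Union>\<C>" using assms(1,2) right_idealD(2) by blast
next
  fix x y assume "x \<in> \<Union>\<C>" "y \<in> \<Union>\<C>"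
  then obtain I K where "I \<in> \<C>" "x \<in> I" "K \<in> \<C>" "y \<in> K" by blast
  with chain[of I K] show "x \<oplus> y \<in> \<Union>\<C>" using assms(2) right_idealD(3) by (metis UnionI subsetD)
next
  fix x r assume "x \<in> \<Union>\<C>" "r \<in> carrier R"
  then show "x \<otimes> r \<in> \<Union>\<C>" using assms(2) right_idealD(4) by blast
qed

text \<open>All uses of Zorn's lemma below (maximal right ideals, complements, simple submodules) look
  for a right ideal that is maximal among those avoiding a given set.\<close>

lemma right_ideal_maximal_avoiding:
  assumes "right_ideal R B" "B \<subseteq> N" "B \<inter> X = {}"
  obtains M where "right_ideal R M" "B \<subseteq> M" "M \<subseteq> N" "M \<inter> X = {}"
    "\<And>L. right_ideal R L \<Longrightarrow> M \<subseteq> L \<Longrightarrow> L \<subseteq> N \<Longrightarrow> L \<inter> X = {} \<Longrightarrow> L = M"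
proof -
  let ?\<A> = "{M. right_ideal R M \<and> B \<subseteq> M \<and> M \<subseteq> N \<and> M \<inter> X = {}}"
  have "\<exists>M\<in>?\<A>. \<forall>L\<in>?\<A>. M \<subseteq> L \<longrightarrow> L = M"
  proof (rule subset_Zorn_nonempty)
    show "?\<A> \<noteq> {}" using assms by blast
  next
    fix \<C> assume \<C>: "\<C> \<noteq> {}" "subset.chain ?\<A> \<C>"
    then have *: "\<And>I. I \<in> \<C> \<Longrightarrow> I \<in> ?\<A>" by (auto simp: subset.chain_def)
    have chain: "I \<subseteq> K \<or> K \<subseteq> I" if "I \<in> \<C>" "K \<in> \<C>" for I K
      using subset.chain_total[OF \<C>(2) that] by auto
    have "right_ideal R (\<Union>\<C>)" by (rule right_ideal_Union_chain) (use * chain \<C>(1) in auto)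
    then show "\<Union>\<C> \<in> ?\<A>" using * \<C>(1) by blast
  qed
  then show ?thesis using that assms(2) by (auto intro: order_trans)
qed

subsection \<open>Spans\<close>

lemma right_ideal_span:
  assumes "A \<subseteq> carrier R"
  shows "right_ideal R (right_span R A)"
proof (rule right_idealI)
  show "right_span R A \<subseteq> carrier R" using assms by (auto simp: right_span_def)
qed (auto simp: right_span_def right_idealD(2-4))

lemma span_superset: "A \<subseteq> right_span R A" by (auto simp: right_span_def)

lemma span_least: "right_ideal R I \<Longrightarrow> A \<subseteq> I \<Longrightarrow> right_span R A \<subseteq> I" by (auto simp: right_span_def)

lemma span_mono: "A \<subseteq> B \<Longrightarrow> right_span R A \<subseteq> right_span R B" by (auto simp: right_span_def)

lemma span_Union_induct [consumes 1, case_names ideal zero add]: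
  assumes "x \<in> right_span R (\<Union>\<S>)" and \<S>: "\<And>S. S \<in> \<S> \<Longrightarrow> right_ideal R S"
    and zero: "P \<zero>"
    and add: "\<And>y s S. S \<in> \<S> \<Longrightarrow> s \<in> S \<Longrightarrow> y \<in> carrier R \<Longrightarrow> P y \<Longrightarrow> P (y \<oplus> s)"
  shows "P x"
proof -
  let ?Q = "{x \<in> carrier R. \<forall>r\<in>carrier R. \<forall>y\<in>carrier R. P y \<longrightarrow> P (y \<oplus> x \<otimes> r)}"
  have "right_ideal R ?Q"
  proof (rule right_idealI)
    fix x z assume xz: "x \<in> ?Q" "z \<in> ?Q"
    have "P (y \<oplus> (x \<oplus> z) \<otimes> r)" if "r \<in> carrier R" "y \<in> carrier R" "P y" for r y
    proof -
      have "P (y \<oplus> x \<otimes> r)" using xz(1) that by simp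
      then have "P ((y \<oplus> x \<otimes> r) \<oplus> z \<otimes> r)" using xz that by simp
      moreover have "(y \<oplus> x \<otimes> r) \<oplus> z \<otimes> r = y \<oplus> (x \<oplus> z) \<otimes> r"
        using xz that by (simp add: l_distr a_assoc)
      ultimately show ?thesis by simp
    qed
    then show "x \<oplus> z \<in> ?Q" using xz by simp
  qed (auto simp: m_assoc)
  moreover have "\<Union>\<S> \<subseteq> ?Q" using \<S> add right_idealD(1,4) by fastforce
  ultimately have "x \<in> ?Q" using assms(1) span_least by blast
  then have "x \<in> carrier R" "P (\<zero> \<oplus> x \<otimes> \<one>)" using zero zero_closed one_closed by blast+
  then show ?thesis by simp
qed

lemma right_ideal_finsum_closed:
  assumes "right_ideal R I" "finite A" "\<And>i. i \<in> A \<Longrightarrow> f i \<in> I"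
  shows "finsum R f A \<in> I" using assms(2,3)
proof (induction A rule: finite_induct)
  case (insert i A)
  then have "f \<in> A \<rightarrow> carrier R" "f i \<in> carrier R" using assms(1) right_idealD(1) by auto
  then show ?case using insert assms(1) right_idealD(3) by simp
qed (use assms(1) right_idealD(2) in auto)

lemma right_ideal_r_ann:
  assumes "A \<subseteq> carrier R"
  shows "right_ideal R (r_ann R A)"
  by (rule right_idealI) (use assms in \<open>auto simp: r_ann_def r_distr subset_iff m_assoc[symmetric]\<close>)

lemma right_ideal_rl_ann: "right_ideal R (rl_ann R A)"
  by (rule right_ideal_r_ann) (auto simp: l_ann_def)

lemma rl_ann_superset: "A \<subseteq> carrier R \<Longrightarrow> A \<subseteq> rl_ann R A" by (auto simp: r_ann_def l_ann_def)

lemma rl_ann_mono: "A \<subseteq> B \<Longrightarrow> rl_ann R A \<subseteq> rl_ann R B" by (auto simp: r_ann_def l_ann_def)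

lemma l_ann_principal:
  assumes x: "x \<in> carrier R"
  shows "l_ann R (x <# carrier R) = l_ann R {x}"
proof
  show "l_ann R (x <# carrier R) \<subseteq> l_ann R {x}"
    using principal_self[OF x] by (auto simp: l_ann_def)
  show "l_ann R {x} \<subseteq> l_ann R (x <# carrier R)"
  proof
    fix y assume "y \<in> l_ann R {x}"
    then have y: "y \<in> carrier R" "y \<otimes> x = \<zero>" by (auto simp: l_ann_def)
    have "y \<otimes> (x \<otimes> r) = \<zero>" if "r \<in> carrier R" for r using y x that m_assoc[of y x r] by simp
    then show "y \<in> l_ann R (x <# carrier R)" using y by (auto simp: l_ann_def mem_principal)
  qed
qed

lemma zero_mult_imp_zero_if_unit:
  assumes "u \<in> Units R" "x \<in> carrier R" "u \<otimes> x = \<zero>"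
  shows "x = \<zero>" using assms Units_l_cancel[of u x \<zero>] by auto

section \<open>Semisimple right ideals\<close>

lemma simple_right_idealI:
  assumes "right_ideal R S" "S \<noteq> {\<zero>}"
    and "\<And>L. right_ideal R L \<Longrightarrow> L \<subseteq> S \<Longrightarrow> L \<noteq> {\<zero>} \<Longrightarrow> L = S"
  shows "simple_right_ideal R S" using assms unfolding simple_right_ideal_def by blast

lemma simple_principal:
  assumes "simple_right_ideal R S" "x \<in> S" "x \<noteq> \<zero>"
  shows "x <# carrier R = S"
proof -
  have S: "right_ideal R S" using assms by (simp add: simple_right_ideal_def)
  then have x: "x \<in> carrier R" using assms right_idealD by blast
  then have "right_ideal R (x <# carrier R)" "x <# carrier R \<subseteq> S" "x <# carrier R \<noteq> {\<zero>}"
    using right_ideal_principal principal_subset[OF S assms(2)] principal_self[OF x] assms(3) by auto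
  then show ?thesis using assms(1) by (auto simp: simple_right_ideal_def)
qed

lemma simpleI:
  assumes "right_ideal R S" "x \<in> S" "x \<noteq> \<zero>"
    and "\<And>y. y \<in> S \<Longrightarrow> y \<noteq> \<zero> \<Longrightarrow> \<exists>r\<in>carrier R. x = y \<otimes> r"
    and "\<And>y. y \<in> S \<Longrightarrow> \<exists>r\<in>carrier R. y = x \<otimes> r"
  shows "simple_right_ideal R S" unfolding simple_right_ideal_def
proof (intro conjI allI impI)
  fix L assume L: "right_ideal R L \<and> L \<subseteq> S"
  show "L = {\<zero>} \<or> L = S"
  proof (cases "L = {\<zero>}")
    case False
    then obtain y where y: "y \<in> L" "y \<noteq> \<zero>" using L right_idealD(2) by blast
    then have "x \<in> L" using assms(4)[of y] L right_idealD(4)[of L] by blast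
    then have "S \<subseteq> L" using assms(5) L right_idealD(4)[of L] by blast
    then show ?thesis using L by blast
  qed simp
qed (use assms in auto)

lemma simple_principalI:
  assumes "x \<in> carrier R" "x \<noteq> \<zero>"
    and "\<And>r. r \<in> carrier R \<Longrightarrow> x \<otimes> r \<noteq> \<zero> \<Longrightarrow> \<exists>t\<in>carrier R. x \<otimes> r \<otimes> t = x"
  shows "simple_right_ideal R (x <# carrier R)"
proof (rule simpleI[of _ x])
  fix y assume "y \<in> x <# carrier R" "y \<noteq> \<zero>"
  then show "\<exists>r\<in>carrier R. x = y \<otimes> r" using assms(3) by (metis mem_principal)
next
  show "\<exists>r\<in>carrier R. y = x \<otimes> r" if "y \<in> x <# carrier R" for y
    using that by (simp add: mem_principal)
qed (use assms in \<open>auto simp: right_ideal_principal principal_self\<close>)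

lemma simple_sub_Int:
  assumes "simple_right_ideal R S" "right_ideal R A" "\<not> S \<subseteq> A"
  shows "A \<inter> S = {\<zero>}"
proof -
  have "right_ideal R (A \<inter> S)" using assms right_ideal_Int by (simp add: simple_right_ideal_def)
  then show ?thesis using assms by (auto simp: simple_right_ideal_def)
qed

lemma right_ideal_socle: "right_ideal R N \<Longrightarrow> right_ideal R (right_socle R N)"
  unfolding right_socle_def by (rule right_ideal_span) (use right_ideal_subset[of N] in auto)

lemma socle_subset: "right_ideal R N \<Longrightarrow> right_socle R N \<subseteq> N"
  unfolding right_socle_def by (rule span_least) auto

lemma simple_subset_socle: "simple_right_ideal R S \<Longrightarrow> S \<subseteq> N \<Longrightarrow> S \<subseteq> right_socle R N"
  unfolding right_socle_def by (rule order_trans[OF Union_upper span_superset]) simp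

lemma socle_mono: "A \<subseteq> B \<Longrightarrow> right_socle R A \<subseteq> right_socle R B"
  unfolding right_socle_def by (rule span_mono) auto

lemma socle_induct [consumes 1, case_names zero add]:
  assumes "x \<in> right_socle R N" "P \<zero>"
    and "\<And>y s S. simple_right_ideal R S \<Longrightarrow> S \<subseteq> N \<Longrightarrow> s \<in> S \<Longrightarrow> y \<in> carrier R \<Longrightarrow> P y \<Longrightarrow> P (y \<oplus> s)"
  shows "P x" using assms(1) unfolding right_socle_def
  by (rule span_Union_induct) (use assms(2,3) in \<open>auto simp: simple_right_ideal_def\<close>)

text \<open>A maximal right ideal meeting \<open>A\<close> trivially inside a semisimple \<open>N\<close> is a complement: any simple
  right ideal outside the sum could be added to it.\<close>

lemma semisimple_complement:
  assumes N: "semisimple_right_ideal R N" and A: "right_ideal R A" "A \<subseteq> N"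
  obtains B where "right_ideal R B" "B \<subseteq> N" "A \<inter> B = {\<zero>}" "A <+>\<^bsub>R\<^esub> B = N"
proof -
  have N': "right_ideal R N" "right_socle R N = N"
    using N by (auto simp: semisimple_right_ideal_def)
  obtain B where B: "right_ideal R B" "B \<subseteq> N" "B \<inter> (A - {\<zero>}) = {}"
    "\<And>L. right_ideal R L \<Longrightarrow> B \<subseteq> L \<Longrightarrow> L \<subseteq> N \<Longrightarrow> L \<inter> (A - {\<zero>}) = {} \<Longrightarrow> L = B"
    by (rule right_ideal_maximal_avoiding[of "{\<zero>}" N "A - {\<zero>}"])
       (use right_idealD(2)[OF N'(1)] in auto)
  have AB: "right_ideal R (A <+> B)" using A B by (simp add: right_ideal_set_add)
  have "S \<subseteq> A <+> B" if S: "simple_right_ideal R S" "S \<subseteq> N" for S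
  proof (rule ccontr)
    assume "\<not> S \<subseteq> A <+> B"
    then have 0: "(A <+> B) \<inter> S = {\<zero>}" using S AB simple_sub_Int by blast
    have S': "right_ideal R S" using S by (simp add: simple_right_ideal_def)
    have "(B <+> S) \<inter> (A - {\<zero>}) = {}"
    proof (rule ccontr)
      assume "(B <+> S) \<inter> (A - {\<zero>}) \<noteq> {}"
      then obtain x where "x \<in> B <+> S" "x \<in> A" "x \<noteq> \<zero>" by blast
      then obtain b s where bs: "b \<in> B" "s \<in> S" "b \<oplus> s \<in> A" "b \<oplus> s \<noteq> \<zero>"
        unfolding mem_set_add by blast
      have carr: "b \<in> carrier R" "s \<in> carrier R" using bs B S' right_idealD(1) by blast+
      have "s = (b \<oplus> s) \<oplus> (\<ominus> b)" using carr by algebra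
      moreover have "\<ominus> b \<in> B" using bs B right_idealD(5) by blast
      ultimately have "s \<in> A <+> B" using bs(3) by (auto simp: mem_set_add)
      then have "s = \<zero>" using 0 bs by blast
      then have "b \<oplus> s \<in> B" using bs carr by simp
      then show False using bs B(3) by blast
    qed
    then have "B <+> S = B" using B(4)[of "B <+> S"] B(1,2) S(2) S' N'(1)
      by (simp add: right_ideal_set_add set_add_mono set_add_least)
    then have "S \<subseteq> B" using set_add_mono[OF B(1) S'] by blast
    then show False using \<open>\<not> S \<subseteq> A <+> B\<close> set_add_mono[OF A(1) B(1)] by blast
  qed
  then have "right_socle R N \<subseteq> A <+> B"
    unfolding right_socle_def using AB by (intro span_least) auto
  then have "A <+> B = N" using N' A B set_add_least[of N A B] by blast
  then show ?thesis using that[of B] A B right_idealD(2) by blast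
qed

text \<open>Modularity turns complements in \<open>N\<close> into complements in any right ideal between.\<close>

lemma modular_complement:
  assumes "right_ideal R A" "right_ideal R B" "right_ideal R C" "A \<subseteq> C" "C \<subseteq> A <+> B"
  shows "C = A <+> (C \<inter> B)"
proof
  show "A <+> (C \<inter> B) \<subseteq> C" using assms set_add_least by auto
  show "C \<subseteq> A <+> (C \<inter> B)"
  proof
    fix x assume x: "x \<in> C"
    then obtain a b where ab: "a \<in> A" "b \<in> B" "x = a \<oplus> b"
      using assms by (auto simp: mem_set_add subset_iff)
    then have carr: "a \<in> carrier R" "b \<in> carrier R" using assms right_idealD(1) by blast+
    then have "b = x \<ominus> a" using ab by algebra
    then have "b \<in> C" using assms ab x right_idealD(6)[of C x a] by blast
    then show "x \<in> A <+> (C \<inter> B)" using ab by (auto simp: mem_set_add)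
  qed
qed

text \<open>Given \<open>x \<noteq> \<zero>\<close> in \<open>A\<close>, take \<open>M\<close> maximal in \<open>A\<close> without \<open>x\<close>. Every right ideal of \<open>A\<close> strictly
  above \<open>M\<close> contains \<open>x\<close>, so a complement of \<open>M\<close> inside \<open>M + xR\<close> is simple.\<close>

lemma semisimple_contains_simple:
  assumes N: "semisimple_right_ideal R N" and A: "right_ideal R A" "A \<subseteq> N" "A \<noteq> {\<zero>}"
  obtains S where "simple_right_ideal R S" "S \<subseteq> A"
proof -
  obtain x where x: "x \<in> A" "x \<noteq> \<zero>" using A right_idealD(2) by blast
  then have xc: "x \<in> carrier R" using A right_idealD(1) by blast
  obtain M where M: "right_ideal R M" "M \<subseteq> A" "M \<inter> {x} = {}"
    "\<And>L. right_ideal R L \<Longrightarrow> M \<subseteq> L \<Longrightarrow> L \<subseteq> A \<Longrightarrow> L \<inter> {x} = {} \<Longrightarrow> L = M"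
    by (rule right_ideal_maximal_avoiding[of "{\<zero>}" A "{x}"])
       (use A x right_idealD(2) in auto)
  let ?X = "M <+> (x <# carrier R)"
  have xR: "right_ideal R (x <# carrier R)" "x <# carrier R \<subseteq> A"
    using xc A x by (auto simp: right_ideal_principal principal_subset)
  have X: "right_ideal R ?X" "?X \<subseteq> A" "M \<subseteq> ?X" "x \<in> ?X"
    using M xR A xc by (auto simp: right_ideal_set_add set_add_least set_add_mono principal_self
        intro: subsetD[OF set_add_mono(2)])
  obtain M' where M': "right_ideal R M'" "M' \<subseteq> N" "M \<inter> M' = {\<zero>}" "M <+> M' = N"
    using semisimple_complement[OF N M(1)] M(2) A by blast
  let ?S = "?X \<inter> M'"
  have S: "right_ideal R ?S" using X M' by (simp add: right_ideal_Int)
  have XS: "?X = M <+> ?S"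
    by (rule modular_complement) (use M(1) M'(1) X in \<open>auto simp: M'(4) A(2)[THEN subsetD]\<close>)
  have nz: "?S \<noteq> {\<zero>}"
  proof
    assume 0: "?S = {\<zero>}"
    have "?X = M <+> {\<zero>}" using XS unfolding 0 .
    then have "?X \<subseteq> M" using set_add_least[of M M "{\<zero>}"] M(1) right_idealD(2) by simp
    then show False using M(3) X(4) by blast
  qed
  have sub: "L = ?S" if L: "right_ideal R L" "L \<subseteq> ?S" "L \<noteq> {\<zero>}" for L
  proof -
    have MpL: "right_ideal R (M <+> L)" "M \<subseteq> M <+> L" "L \<subseteq> M <+> L" "M <+> L \<subseteq> A"
      using M(1,2) L X(2) set_add_least[OF A(1), of M L]
      by (auto simp: right_ideal_set_add intro: subsetD[OF set_add_mono(1)] subsetD[OF set_add_mono(2)])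
    have "\<not> L \<subseteq> M" using L M' right_idealD(2)[OF L(1)] by blast
    then have "x \<in> M <+> L" using M(4)[OF MpL(1,2,4)] MpL(3) by blast
    then have "?X \<subseteq> M <+> L" using MpL principal_subset by (intro set_add_least) auto
    show ?thesis
    proof
      show "?S \<subseteq> L"
      proof
        fix s assume s: "s \<in> ?S"
        then have "s \<in> M <+> L" using \<open>?X \<subseteq> M <+> L\<close> by blast
        then obtain m l where ml: "m \<in> M" "l \<in> L" "s = m \<oplus> l" unfolding mem_set_add by blast
        have carr: "m \<in> carrier R" "l \<in> carrier R" using ml M L right_idealD(1) by blast+
        have "m = s \<ominus> l" using ml carr by algebra
        then have "m \<in> M'" using s ml L M' right_idealD(6)[of M' s l] by blast
        then have "m = \<zero>" using ml M' by blast
        then show "s \<in> L" using ml carr by simp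
      qed
    qed (use L in auto)
  qed
  have "simple_right_ideal R ?S" by (rule simple_right_idealI[OF S nz sub])
  moreover have "?S \<subseteq> A" using X(2) by blast
  ultimately show ?thesis by (rule that)
qed

lemma semisimple_sub:
  assumes N: "semisimple_right_ideal R N" and A: "right_ideal R A" "A \<subseteq> N"
  shows "semisimple_right_ideal R A"
proof -
  let ?T = "right_socle R A"
  have T: "right_ideal R ?T" "?T \<subseteq> A" using A by (auto simp: right_ideal_socle socle_subset)
  obtain C where C: "right_ideal R C" "C \<subseteq> N" "?T \<inter> C = {\<zero>}" "?T <+> C = N"
    using semisimple_complement[OF N T(1)] T A by blast
  have "A \<inter> C = {\<zero>}"
  proof (rule ccontr)
    assume "A \<inter> C \<noteq> {\<zero>}"
    then obtain S where S: "simple_right_ideal R S" "S \<subseteq> A \<inter> C"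
      using semisimple_contains_simple[OF N, of "A \<inter> C"] A C right_ideal_Int by blast
    then have "S \<subseteq> ?T" using simple_subset_socle by blast
    then show False using S C(3) right_idealD(2) by (auto simp: simple_right_ideal_def)
  qed
  then have "A = ?T <+> {\<zero>}" using modular_complement[of ?T C A] T C A by auto
  then have "A \<subseteq> ?T" using set_add_least[of ?T ?T "{\<zero>}"] T by (auto simp: right_idealD(2))
  then show ?thesis using T A by (auto simp: semisimple_right_ideal_def)
qed

lemma semisimple_S_r: "semisimple_right_ideal R (S_r R)"
proof -
  have S: "right_ideal R (S_r R)" by (simp add: right_ideal_socle)
  have "S_r R \<subseteq> right_socle R (S_r R)" unfolding right_socle_def[of R "carrier R"]
    by (rule span_least, unfold right_socle_def[of R "carrier R", symmetric])
       (use S right_ideal_socle simple_subset_socle[of _ "S_r R"] simple_subset_socle[of _ "carrier R"] in auto)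
  then show ?thesis using S socle_subset[OF S] by (auto simp: semisimple_right_ideal_def)
qed

lemma semisimple_iff: "semisimple_right_ideal R K \<longleftrightarrow> right_ideal R K \<and> K \<subseteq> S_r R"
  using semisimple_sub[OF semisimple_S_r] socle_mono[of K "carrier R"] right_ideal_subset[of K]
  by (auto simp: semisimple_right_ideal_def)

lemma socle_eq: "right_ideal R N \<Longrightarrow> right_socle R N = N \<inter> S_r R"
proof
  assume N: "right_ideal R N"
  then show "right_socle R N \<subseteq> N \<inter> S_r R"
    using socle_subset socle_mono[of N "carrier R"] right_ideal_subset by blast
  have "semisimple_right_ideal R (N \<inter> S_r R)"
    using N by (simp add: semisimple_iff right_ideal_Int right_ideal_socle)
  then have "N \<inter> S_r R = right_socle R (N \<inter> S_r R)" by (simp add: semisimple_right_ideal_def)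
  then show "N \<inter> S_r R \<subseteq> right_socle R N" using socle_mono[of "N \<inter> S_r R" N] by auto
qed

lemma right_ideal_S_r: "right_ideal R (S_r R)" by (simp add: right_ideal_socle)

lemma simple_subset_S_r: "simple_right_ideal R S \<Longrightarrow> S \<subseteq> S_r R"
  using simple_subset_socle[of S "carrier R"] right_ideal_subset by (auto simp: simple_right_ideal_def)

lemma S_r_contains_simple:
  assumes "right_ideal R A" "A \<subseteq> S_r R" "A \<noteq> {\<zero>}"
  obtains S where "simple_right_ideal R S" "S \<subseteq> A"
  using semisimple_contains_simple[OF semisimple_S_r assms] by blast

lemma simple_mult_left:
  assumes simple: "simple_right_ideal R (k <# carrier R)"
    and k: "k \<in> carrier R" and r: "r \<in> carrier R" and rk: "r \<otimes> k \<noteq> \<zero>"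
  shows "simple_right_ideal R ((r \<otimes> k) <# carrier R)"
proof (rule simple_principalI)
  fix x assume x: "x \<in> carrier R" "r \<otimes> k \<otimes> x \<noteq> \<zero>"
  then have "k \<otimes> x \<noteq> \<zero>" using r k by (auto simp: m_assoc)
  moreover have "k \<otimes> x \<in> k <# carrier R" using x by (auto simp: mem_principal)
  ultimately have "k \<in> (k \<otimes> x) <# carrier R"
    using simple_principal[OF simple] principal_self[OF k] by blast
  then obtain t where t: "t \<in> carrier R" "k = k \<otimes> x \<otimes> t" by (auto simp: mem_principal)
  then have "r \<otimes> k \<otimes> x \<otimes> t = r \<otimes> k" using r k x(1) by (metis m_assoc m_closed)
  then show "\<exists>t\<in>carrier R. r \<otimes> k \<otimes> x \<otimes> t = r \<otimes> k" using t(1) by blast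
qed (use r k rk in auto)

lemma S_r_mult_left:
  assumes r: "r \<in> carrier R" and "s \<in> S_r R"
  shows "r \<otimes> s \<in> S_r R" using assms(2)
proof (induction rule: socle_induct)
  case zero
  then show ?case using r right_ideal_S_r right_idealD(2) by simp
next
  case (add y s S)
  have s: "s \<in> carrier R" using add by blast
  have "r \<otimes> s \<in> S_r R"
  proof (cases "r \<otimes> s = \<zero>")
    case True
    then show ?thesis using right_ideal_S_r right_idealD(2) by simp
  next
    case False
    then have "s \<noteq> \<zero>" using r by auto
    then have "simple_right_ideal R (s <# carrier R)"
      using simple_principal[OF add(1,3)] add(1) by simp
    then show ?thesis
      using simple_subset_S_r[OF simple_mult_left[OF _ s r False]] principal_self[of "r \<otimes> s"] r s
      by blast
  qed
  then show ?case using add r s right_idealD(3)[OF right_ideal_S_r] by (simp add: r_distr)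
qed

text \<open>In a finitely generated semisimple right ideal, every right ideal is reached from \<open>{\<zero>}\<close> by
  adding finitely many simple ones: it is finitely generated, by the components of the generators,
  and each generator is a finite sum of elements of simple right ideals.\<close>

lemma fg_semisimple_induct [consumes 4, case_names zero add]:
  assumes N: "semisimple_right_ideal R N" and fin: "finite A" "A \<subseteq> N" "N \<subseteq> right_span R A"
    and K: "right_ideal R K" "K \<subseteq> N"
    and zero: "P {\<zero>}"
    and add: "\<And>M S. right_ideal R M \<Longrightarrow> M \<subseteq> K \<Longrightarrow> P M \<Longrightarrow> simple_right_ideal R S \<Longrightarrow> S \<subseteq> K \<Longrightarrow>
      \<not> S \<subseteq> M \<Longrightarrow> P (M <+> S)"
  shows "P K"
proof -
  define Q where "Q M \<longleftrightarrow> right_ideal R M \<and> M \<subseteq> K \<and> P M" for M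
  have QS: "\<exists>M'. Q M' \<and> M \<subseteq> M' \<and> S \<subseteq> M'" if "Q M" "simple_right_ideal R S" "S \<subseteq> K" for M S
  proof (cases "S \<subseteq> M")
    case False
    have "right_ideal R S" using that by (simp add: simple_right_ideal_def)
    then have "Q (M <+> S)" "M \<subseteq> M <+> S" "S \<subseteq> M <+> S"
      using that False add[of M S] set_add_least[OF K(1), of M S]
      by (simp_all add: Q_def right_ideal_set_add set_add_mono)
    then show ?thesis by blast
  qed (use that in auto)
  have QK: "\<exists>M'. Q M' \<and> M \<subseteq> M' \<and> x \<in> M'" if M: "Q M" and x: "x \<in> K" for M x
  proof -
    have "x \<in> right_socle R K"
      using semisimple_sub[OF N K] x by (simp add: semisimple_right_ideal_def)
    then show ?thesis
    proof (induction rule: socle_induct)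
      case zero
      then show ?case using M by (auto simp: Q_def right_idealD(2))
    next
      case (add y s S)
      then obtain M' where "Q M'" "M \<subseteq> M'" "y \<in> M'" by blast
      moreover from this add QS obtain M'' where "Q M''" "M' \<subseteq> M''" "S \<subseteq> M''" by blast
      ultimately have "y \<in> M''" "s \<in> M''" "M \<subseteq> M''" "right_ideal R M''"
        using add by (auto simp: Q_def)
      then show ?case using \<open>Q M''\<close> right_idealD(3)[of M'' y s] by blast
    qed
  qed
  obtain B where B: "right_ideal R B" "B \<subseteq> N" "K \<inter> B = {\<zero>}" "K <+> B = N"
    using semisimple_complement[OF N K] .
  have "\<exists>M. Q M \<and> A' \<subseteq> M <+> B" if "finite A'" "A' \<subseteq> N" for A' using that
  proof (induction A' rule: finite_induct)
    case empty
    then show ?case using zero K by (auto simp: Q_def right_idealD(2) intro!: exI[of _ "{\<zero>}"])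
  next
    case (insert a A')
    then obtain M where M: "Q M" "A' \<subseteq> M <+> B" by blast
    obtain k b where kb: "k \<in> K" "b \<in> B" "a = k \<oplus> b" using insert B(4) by (auto simp: mem_set_add)
    obtain M' where M': "Q M'" "M \<subseteq> M'" "k \<in> M'" using QK[OF M(1) kb(1)] by blast
    then have "M <+> B \<subseteq> M' <+> B" "a \<in> M' <+> B"
      using kb unfolding subset_iff mem_set_add by blast+
    then show ?case using M M' by blast
  qed
  then obtain M where M: "Q M" "A \<subseteq> M <+> B" using fin by blast
  then have "N \<subseteq> M <+> B"
    using span_least[of "M <+> B" A] B fin(3) by (auto simp: Q_def right_ideal_set_add)
  then have "K = M <+> (K \<inter> B)" using modular_complement[of M B K] M B K by (auto simp: Q_def)
  then have "K \<subseteq> M"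
    unfolding B using M set_add_least[of M M "{\<zero>}"] by (auto simp: Q_def right_idealD(2))
  then show ?thesis using M by (auto simp: Q_def)
qed

end

section \<open>The Jacobson radical\<close>

context ring
begin

lemma mult_one_minus:
  "u \<in> carrier R \<Longrightarrow> x \<in> carrier R \<Longrightarrow> (\<one> \<ominus> u) \<otimes> x = x \<ominus> u \<otimes> x"
  "u \<in> carrier R \<Longrightarrow> x \<in> carrier R \<Longrightarrow> x \<otimes> (\<one> \<ominus> u) = x \<ominus> x \<otimes> u"
  by (simp_all add: a_minus_def l_distr r_distr l_minus r_minus)

lemma minus_self: "x \<in> carrier R \<Longrightarrow> x \<ominus> x = \<zero>" by (simp add: a_minus_def r_neg)

lemma minus_eq_zero_iff:
  assumes "x \<in> carrier R" "y \<in> carrier R"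
  shows "x \<ominus> y = \<zero> \<longleftrightarrow> x = y"
proof
  assume "x \<ominus> y = \<zero>"
  moreover have "x = (x \<ominus> y) \<oplus> y" using assms by algebra
  ultimately show "x = y" using assms by simp
qed (use assms minus_self in simp)

lemma maximal_right_ideal_above:
  assumes "right_ideal R B" "B \<noteq> carrier R"
  obtains M where "maximal_right_ideal R M" "B \<subseteq> M"
proof -
  have "B \<inter> {\<one>} = {}" using assms right_ideal_eq_carrierI by blast
  then obtain M where M: "right_ideal R M" "B \<subseteq> M" "M \<inter> {\<one>} = {}"
    "\<And>L. right_ideal R L \<Longrightarrow> M \<subseteq> L \<Longrightarrow> L \<subseteq> carrier R \<Longrightarrow> L \<inter> {\<one>} = {} \<Longrightarrow> L = M"
    by (rule right_ideal_maximal_avoiding[OF assms(1) right_ideal_subset[OF assms(1)]]) blast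
  have "L = M \<or> L = carrier R" if "right_ideal R L" "M \<subseteq> L" for L
    using M(4)[OF that right_ideal_subset[OF that(1)]] right_ideal_eq_carrierI[OF that(1)] by blast
  moreover have "M \<noteq> carrier R" using M(3) one_closed by blast
  ultimately have "maximal_right_ideal R M" using M(1) unfolding maximal_right_ideal_def by blast
  then show ?thesis using that M(2) by blast
qed

lemma right_ideal_jacobson: "right_ideal R (jacobson R)"
proof (rule right_idealI)
  fix x y assume "x \<in> jacobson R" "y \<in> jacobson R"
  then show "x \<oplus> y \<in> jacobson R"
    using right_idealD(3) by (auto simp: jacobson_def maximal_right_ideal_def)
next
  fix x r assume "x \<in> jacobson R" "r \<in> carrier R"
  then show "x \<otimes> r \<in> jacobson R"
    using right_idealD(4) by (auto simp: jacobson_def maximal_right_ideal_def)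
qed (auto simp: jacobson_def maximal_right_ideal_def right_idealD(2))

lemma jacobson_carrier: "j \<in> jacobson R \<Longrightarrow> j \<in> carrier R" by (simp add: jacobson_def)

lemma jacobson_right_inverse:
  assumes j: "j \<in> jacobson R"
  obtains y where "y \<in> carrier R" "(\<one> \<ominus> j) \<otimes> y = \<one>"
proof -
  have jc: "j \<in> carrier R" using j by (rule jacobson_carrier)
  have "(\<one> \<ominus> j) <# carrier R = carrier R"
  proof (rule ccontr)
    assume "(\<one> \<ominus> j) <# carrier R \<noteq> carrier R"
    then obtain M where M: "maximal_right_ideal R M" "(\<one> \<ominus> j) <# carrier R \<subseteq> M"
      using maximal_right_ideal_above[of "(\<one> \<ominus> j) <# carrier R"] jc right_ideal_principal by auto
    then have M': "right_ideal R M" "M \<noteq> carrier R" "j \<in> M"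
      using j by (auto simp: maximal_right_ideal_def jacobson_def)
    have "\<one> \<ominus> j \<in> M" using M(2) principal_self[of "\<one> \<ominus> j"] jc by auto
    then have "(\<one> \<ominus> j) \<oplus> j \<in> M" using M' right_idealD(3) by blast
    moreover have "(\<one> \<ominus> j) \<oplus> j = \<one>" using jc by algebra
    ultimately show False using M' right_ideal_eq_carrierI by simp
  qed
  then show ?thesis using that one_closed by (metis mem_principal)
qed

text \<open>The right inverse of \<open>\<one> \<ominus> j\<close> is again of the form \<open>\<one> \<ominus> j'\<close>, so it has a right inverse too.\<close>

lemma jacobson_unit:
  assumes j: "j \<in> jacobson R"
  shows "\<one> \<ominus> j \<in> Units R"
proof -
  have jc: "j \<in> carrier R" using j by (rule jacobson_carrier)
  obtain y where y: "y \<in> carrier R" "(\<one> \<ominus> j) \<otimes> y = \<one>" using jacobson_right_inverse[OF j] .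
  have "\<ominus> (j \<otimes> y) \<in> jacobson R" using right_idealD(4,5)[OF right_ideal_jacobson] j y by blast
  then obtain z where z: "z \<in> carrier R" "(\<one> \<ominus> (\<ominus> (j \<otimes> y))) \<otimes> z = \<one>"
    using jacobson_right_inverse by blast
  have "\<one> \<ominus> (\<ominus> (j \<otimes> y)) = (\<one> \<ominus> j) \<otimes> y \<oplus> j \<otimes> y" using y jc by (simp add: a_minus_def)
  also have "\<dots> = y" using y(1) jc by algebra
  finally have yz: "y \<otimes> z = \<one>" using z by simp
  have "z = ((\<one> \<ominus> j) \<otimes> y) \<otimes> z" using y z by simp
  also have "\<dots> = (\<one> \<ominus> j) \<otimes> (y \<otimes> z)" using y(1) z(1) jc by (simp add: m_assoc)
  finally have "z = \<one> \<ominus> j" using yz jc by simp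
  then show ?thesis using y yz jc by (auto simp: Units_def)
qed

text \<open>If \<open>\<one> \<ominus> j r\<close> is invertible with inverse \<open>v\<close>, then \<open>\<one> \<oplus> r v j\<close> inverts \<open>\<one> \<ominus> r j\<close>. Hence no
  maximal right ideal can miss \<open>r j\<close>.\<close>

lemma jacobson_left_mult:
  assumes r: "r \<in> carrier R" and j: "j \<in> jacobson R"
  shows "r \<otimes> j \<in> jacobson R"
proof -
  have jc: "j \<in> carrier R" using j by (rule jacobson_carrier)
  have "r \<otimes> j \<in> M" if M: "maximal_right_ideal R M" for M
  proof (rule ccontr)
    assume nM: "r \<otimes> j \<notin> M"
    have M': "right_ideal R M" "M \<noteq> carrier R" using M by (auto simp: maximal_right_ideal_def)
    let ?L = "M <+> ((r \<otimes> j) <# carrier R)"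
    have rjR: "right_ideal R ((r \<otimes> j) <# carrier R)" using r jc right_ideal_principal by simp
    have "right_ideal R ?L" "M \<subseteq> ?L" "r \<otimes> j \<in> ?L"
      using M' rjR set_add_mono[OF M'(1) rjR] r jc principal_self[of "r \<otimes> j"]
      by (auto simp: right_ideal_set_add)
    then have "?L = carrier R" using M nM unfolding maximal_right_ideal_def by blast
    then have "\<one> \<in> ?L" by simp
    then obtain m t where mt: "m \<in> M" "t \<in> carrier R" "\<one> = m \<oplus> r \<otimes> j \<otimes> t"
      by (auto simp: mem_set_add mem_principal)
    have mc: "m \<in> carrier R" using mt M' right_idealD(1) by blast
    let ?j = "j \<otimes> t"
    have "?j \<otimes> r \<in> jacobson R" using j mt r right_idealD(4)[OF right_ideal_jacobson] by simp
    then have "\<one> \<ominus> ?j \<otimes> r \<in> Units R" by (rule jacobson_unit)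
    then obtain v where v: "v \<in> carrier R" "(\<one> \<ominus> ?j \<otimes> r) \<otimes> v = \<one>" by (auto simp: Units_def)
    have m: "m = \<one> \<ominus> r \<otimes> ?j"
    proof -
      have "\<one> \<ominus> r \<otimes> ?j = (m \<oplus> r \<otimes> j \<otimes> t) \<ominus> r \<otimes> ?j" using mt(3) by simp
      also have "\<dots> = m" using mc r jc mt(2) by algebra
      finally show ?thesis by simp
    qed
    have "m \<otimes> (\<one> \<oplus> r \<otimes> v \<otimes> ?j) = m \<oplus> m \<otimes> (r \<otimes> v \<otimes> ?j)"
      using mc r v(1) jc mt(2) by (simp add: r_distr)
    also have "\<dots> = \<one> \<ominus> r \<otimes> ?j \<oplus> r \<otimes> ((\<one> \<ominus> ?j \<otimes> r) \<otimes> v) \<otimes> ?j"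
      unfolding m using r v(1) jc mt(2) by algebra
    also have "\<dots> = \<one>" unfolding v(2) using r jc mt(2) by algebra
    finally have "\<one> \<in> M"
      using mt(1) M'(1) right_idealD(4)[of M m "\<one> \<oplus> r \<otimes> v \<otimes> ?j"] r v jc mt(2) by simp
    then show False using M' right_ideal_eq_carrierI by blast
  qed
  then show ?thesis using r jc by (auto simp: jacobson_def)
qed

lemma jacobson_right_mult: "j \<in> jacobson R \<Longrightarrow> r \<in> carrier R \<Longrightarrow> j \<otimes> r \<in> jacobson R"
  using right_ideal_jacobson right_idealD(4) by blast

lemmas jacobson_add = right_idealD(3)[OF right_ideal_jacobson]
  and jacobson_minus = right_idealD(6)[OF right_ideal_jacobson]
  and jacobson_zero = right_idealD(2)[OF right_ideal_jacobson]
  and jacobson_neg = right_idealD(5)[OF right_ideal_jacobson]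

lemma jacobson_minus_cancel:
  assumes "x \<ominus> y \<in> jacobson R" "y \<in> jacobson R" "x \<in> carrier R"
  shows "x \<in> jacobson R"
proof -
  have "x = (x \<ominus> y) \<oplus> y" using assms(3) jacobson_carrier[OF assms(2)] by algebra
  then show ?thesis using jacobson_add[OF assms(1,2)] by simp
qed

lemma ideal_jacobson: "ideal (jacobson R) R"
proof (rule idealI)
  show "subgroup (jacobson R) (add_monoid R)"
    using right_ideal_jacobson by (simp add: right_ideal_def additive_subgroup_def)
qed (auto simp: jacobson_left_mult jacobson_right_mult ring_axioms)

lemma jacobson_fixes_zero:
  assumes "j \<in> jacobson R" "x \<in> carrier R" "x = j \<otimes> x"
  shows "x = \<zero>"
proof -
  have jc: "j \<in> carrier R" using assms by (simp add: jacobson_carrier)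
  have "(\<one> \<ominus> j) \<otimes> x = x \<ominus> j \<otimes> x" using assms(2) jc by algebra
  also have "\<dots> = \<zero>" using assms(2) unfolding assms(3)[symmetric] by (simp add: a_minus_def r_neg)
  finally show ?thesis
    using zero_mult_imp_zero_if_unit[OF jacobson_unit[OF assms(1)] assms(2)] by blast
qed

lemma jacobson_fixes_zero_right:
  assumes "j \<in> jacobson R" "x \<in> carrier R" "x = x \<otimes> j"
  shows "x = \<zero>"
proof -
  have jc: "j \<in> carrier R" using assms by (simp add: jacobson_carrier)
  obtain v where v: "v \<in> carrier R" "(\<one> \<ominus> j) \<otimes> v = \<one>"
    using jacobson_unit[OF assms(1)] by (auto simp: Units_def)
  have "x = x \<otimes> ((\<one> \<ominus> j) \<otimes> v)" using v assms(2) by simp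
  also have "\<dots> = (x \<ominus> x \<otimes> j) \<otimes> v" using assms(2) jc v(1) by algebra
  also have "\<dots> = \<zero>"
    using assms(2) v unfolding assms(3)[symmetric] by (simp add: a_minus_def r_neg)
  finally show ?thesis .
qed

lemma jacobson_idempotent_zero:
  "idempotent_elem R e \<Longrightarrow> e \<in> jacobson R \<Longrightarrow> e = \<zero>"
  using jacobson_fixes_zero[of e e] by (auto simp: idempotent_elem_def)

text \<open>If \<open>K + L = R\<close>, then \<open>\<one> = k + l\<close> and the unit \<open>l = \<one> \<ominus> k\<close> lies in \<open>L\<close>.\<close>

lemma small_if_one_minus_right_invertible:
  assumes K: "right_ideal R K"
    and inv: "\<And>k. k \<in> K \<Longrightarrow> \<exists>v\<in>carrier R. (\<one> \<ominus> k) \<otimes> v = \<one>"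
  shows "small_right_ideal R K" unfolding small_right_ideal_def
proof (intro conjI allI impI notI)
  fix L assume L: "right_ideal R L \<and> L \<noteq> carrier R" and "K <+> L = carrier R"
  then have "\<one> \<in> K <+> L" by simp
  then obtain k l where kl: "k \<in> K" "l \<in> L" "\<one> = k \<oplus> l" unfolding mem_set_add by blast
  have carr: "k \<in> carrier R" "l \<in> carrier R" using kl L K right_idealD(1) by blast+
  have "l = k \<oplus> l \<ominus> k" using carr by algebra
  then have "l = \<one> \<ominus> k" using kl by simp
  then obtain v where "v \<in> carrier R" "l \<otimes> v = \<one>" using inv[OF kl(1)] by auto
  then have "\<one> \<in> L" using L kl right_idealD(4) by metis
  then show False using L right_ideal_eq_carrierI by blast
qed (use K in auto)

lemma small_if_subset_jacobson:
  assumes "right_ideal R K" "K \<subseteq> jacobson R"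
  shows "small_right_ideal R K"
proof (rule small_if_one_minus_right_invertible[OF assms(1)])
  fix k assume "k \<in> K"
  then show "\<exists>v\<in>carrier R. (\<one> \<ominus> k) \<otimes> v = \<one>"
    using jacobson_unit[of k] assms(2) by (auto simp: Units_def)
qed

lemma small_left_if_subset_jacobson:
  assumes "right_ideal (opp R) K" "K \<subseteq> jacobson R"
  shows "small_left_ideal R K"
proof (rule ring.small_if_one_minus_right_invertible[OF opp_ring[OF ring_axioms] assms(1)])
  fix k assume "k \<in> K"
  then have "\<one> \<ominus> k \<in> Units R" using jacobson_unit[of k] assms(2) by blast
  moreover have "\<one> \<ominus>\<^bsub>opp R\<^esub> k = \<one> \<ominus> k" by (simp add: a_minus_def a_inv_def opp_def)
  ultimately show "\<exists>v\<in>carrier (opp R). (\<one>\<^bsub>opp R\<^esub> \<ominus>\<^bsub>opp R\<^esub> k) \<otimes>\<^bsub>opp R\<^esub> v = \<one>\<^bsub>opp R\<^esub>"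
    by (auto simp: Units_def)
qed

text \<open>Nakayama for a simple right ideal: a nonzero \<open>s j\<close> generates it, giving \<open>s = s j t\<close>.\<close>

lemma S_r_mult_zero:
  assumes "s \<in> S_r R" and j: "j \<in> carrier R"
    and fix_zero: "\<And>x t. x \<in> carrier R \<Longrightarrow> t \<in> carrier R \<Longrightarrow> x = x \<otimes> (j \<otimes> t) \<Longrightarrow> x = \<zero>"
  shows "s \<otimes> j = \<zero>" using assms(1)
proof (induction rule: socle_induct)
  case (add y s S)
  have S: "right_ideal R S" using add by (simp add: simple_right_ideal_def)
  have s: "s \<in> carrier R" using add by auto
  have "s \<otimes> j = \<zero>"
  proof (rule ccontr)
    assume "s \<otimes> j \<noteq> \<zero>"
    then have "s \<in> (s \<otimes> j) <# carrier R"
      using simple_principal[OF add(1), of "s \<otimes> j"] right_idealD(4)[OF S add(3) j] add(3) by simp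
    then obtain t where t: "t \<in> carrier R" "s = s \<otimes> j \<otimes> t" by (auto simp: mem_principal)
    then have "s = s \<otimes> (j \<otimes> t)" using j s by (simp add: m_assoc)
    then show False using fix_zero[OF s t(1)] \<open>s \<otimes> j \<noteq> \<zero>\<close> j by simp
  qed
  then show ?case using add j s by (simp add: l_distr)
qed (use j in simp)

lemma S_r_mult_jacobson: "s \<in> S_r R \<Longrightarrow> j \<in> jacobson R \<Longrightarrow> s \<otimes> j = \<zero>"
  by (rule S_r_mult_zero) (auto intro: jacobson_carrier jacobson_fixes_zero_right jacobson_right_mult)

lemma jacobson_mult_S_l:
  assumes j: "j \<in> jacobson R" and s: "s \<in> S_l R"
  shows "j \<otimes> s = \<zero>"
proof -
  have "s \<otimes>\<^bsub>opp R\<^esub> j = \<zero>\<^bsub>opp R\<^esub>"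
  proof (rule ring.S_r_mult_zero[OF opp_ring[OF ring_axioms]])
    fix x t assume "x \<in> carrier (opp R)" "t \<in> carrier (opp R)"
      "x = x \<otimes>\<^bsub>opp R\<^esub> (j \<otimes>\<^bsub>opp R\<^esub> t)"
    then show "x = \<zero>\<^bsub>opp R\<^esub>"
      using jacobson_fixes_zero[OF jacobson_left_mult[OF _ j, of t]] by simp
  qed (use s j jacobson_carrier in auto)
  then show ?thesis by simp
qed

section \<open>Mininjective rings\<close>

text \<open>The homomorphisms needed below are given by rules such as \<open>k x \<mapsto> m x\<close> or \<open>a + b \<mapsto> a\<close> on
  representatives. By additivity such a rule is well defined once it sends \<open>\<zero>\<close> to \<open>\<zero>\<close>.\<close>

lemma right_hom_of_relation:
  assumes carr: "\<And>x y. G x y \<Longrightarrow> x \<in> carrier R \<and> y \<in> carrier R"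
    and add: "\<And>x y x' y'. G x y \<Longrightarrow> G x' y' \<Longrightarrow> G (x \<oplus> x') (y \<oplus> y')"
    and mult: "\<And>x y r. G x y \<Longrightarrow> r \<in> carrier R \<Longrightarrow> G (x \<otimes> r) (y \<otimes> r)"
    and zero: "\<And>y. G \<zero> y \<longleftrightarrow> y = \<zero>"
  obtains f where "right_ideal R {x. \<exists>y. G x y}" "f \<in> right_hom R {x. \<exists>y. G x y}"
    "\<And>x y. G x y \<Longrightarrow> f x = y"
proof -
  have uniq: "y = y'" if "G x y" "G x y'" for x y y'
  proof -
    have c: "x \<in> carrier R" "y \<in> carrier R" "y' \<in> carrier R" using carr that by auto
    have "G (x \<oplus> x \<otimes> (\<ominus> \<one>)) (y \<oplus> y' \<otimes> (\<ominus> \<one>))" using add mult that by simp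
    then have "G \<zero> (y \<ominus> y')" using c by (simp add: r_minus r_neg a_minus_def)
    then show ?thesis using zero c minus_eq_zero_iff by blast
  qed
  define f where "f x = (THE y. G x y)" for x
  have f: "f x = y" if "G x y" for x y unfolding f_def using that uniq by blast
  have "f \<in> right_hom R {x. \<exists>y. G x y}" unfolding right_hom_def
  proof (intro CollectI conjI ballI)
    show "f \<in> {x. \<exists>y. G x y} \<rightarrow> carrier R" using f carr by auto
    show "f (x \<oplus> x') = f x \<oplus> f x'" if "x \<in> {x. \<exists>y. G x y}" "x' \<in> {x. \<exists>y. G x y}" for x x'
      using that f add by auto
    show "f (x \<otimes> r) = f x \<otimes> r" if "x \<in> {x. \<exists>y. G x y}" "r \<in> carrier R" for x r
      using that f mult by auto
  qed
  moreover have "right_ideal R {x. \<exists>y. G x y}"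
    using carr add mult zero by (intro right_idealI) blast+
  ultimately show ?thesis using that f by blast
qed

lemma right_hom_carrier:
  assumes "h \<in> right_hom R (carrier R)"
  shows "h \<one> \<in> carrier R" "x \<in> carrier R \<Longrightarrow> h x = h \<one> \<otimes> x"
proof -
  show "h \<one> \<in> carrier R" using assms by (auto simp: right_hom_def)
  assume x: "x \<in> carrier R"
  have "h (\<one> \<otimes> x) = h \<one> \<otimes> x" using assms x one_closed unfolding right_hom_def by blast
  then show "h x = h \<one> \<otimes> x" using x by simp
qed

text \<open>Since \<open>r(k) \<subseteq> r(m)\<close>, the rule \<open>k x \<mapsto> m x\<close> defines a homomorphism \<open>kR \<rightarrow> R\<close>, and its extension to
  \<open>R\<close> is left multiplication by the image of \<open>\<one>\<close>.\<close>

lemma mininjective_factor: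
  assumes "right_mininjective R" "simple_right_ideal R (k <# carrier R)"
    and k: "k \<in> carrier R" and m: "m \<in> carrier R"
    and ann: "\<And>x. x \<in> carrier R \<Longrightarrow> k \<otimes> x = \<zero> \<Longrightarrow> m \<otimes> x = \<zero>"
  obtains c where "c \<in> carrier R" "m = c \<otimes> k"
proof -
  define G where "G u v \<longleftrightarrow> (\<exists>x\<in>carrier R. u = k \<otimes> x \<and> v = m \<otimes> x)" for u v
  obtain f where f: "f \<in> right_hom R {u. \<exists>v. G u v}" "\<And>u v. G u v \<Longrightarrow> f u = v"
  proof (rule right_hom_of_relation[of G])
    fix u v u' v' assume "G u v" "G u' v'"
    then obtain x x' where "x \<in> carrier R" "x' \<in> carrier R" "u = k \<otimes> x" "v = m \<otimes> x"
      "u' = k \<otimes> x'" "v' = m \<otimes> x'" by (auto simp: G_def)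
    then show "G (u \<oplus> u') (v \<oplus> v')"
      using k m unfolding G_def by (intro bexI[of _ "x \<oplus> x'"]) (auto simp: r_distr)
  next
    fix u v r assume "G u v" "r \<in> carrier R"
    moreover from this obtain x where "x \<in> carrier R" "u = k \<otimes> x" "v = m \<otimes> x"
      by (auto simp: G_def)
    ultimately show "G (u \<otimes> r) (v \<otimes> r)"
      using k m unfolding G_def by (intro bexI[of _ "x \<otimes> r"]) (auto simp: m_assoc)
  next
    show "G \<zero> v \<longleftrightarrow> v = \<zero>" for v using ann k m unfolding G_def by (auto intro!: bexI[of _ \<zero>])
  qed (use k m in \<open>auto simp: G_def\<close>)
  have "{u. \<exists>v. G u v} = k <# carrier R"
    unfolding G_def set_eq_iff mem_Collect_eq mem_principal by blast
  then have "f \<in> right_hom R (k <# carrier R)" using f(1) by simp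
  then obtain g where g: "g \<in> right_hom R (carrier R)" "\<And>x. x \<in> k <# carrier R \<Longrightarrow> g x = f x"
    using assms(1,2) unfolding right_mininjective_def homs_extend_def by blast
  have "G k m" using k m unfolding G_def by (intro bexI[of _ \<one>]) auto
  then have "g k = m" using g(2)[OF principal_self[OF k]] f(2) by simp
  then show ?thesis
    using that right_hom_carrier(1)[OF g(1)] right_hom_carrier(2)[OF g(1) k] by simp
qed

text \<open>Each nonzero \<open>r k\<close> has the same right annihilator as \<open>k\<close>, so \<open>k\<close> is a left multiple of it.\<close>

lemma mininjective_simple_left:
  assumes min: "right_mininjective R" and simple: "simple_right_ideal R (k <# carrier R)"
    and k: "k \<in> carrier R"
  shows "simple_right_ideal (opp R) (carrier R #> k)"
proof -
  interpret opp: ring "opp R" using opp_ring ring_axioms by blast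
  have kS: "k \<in> S_r R" using simple_subset_S_r[OF simple] principal_self[OF k] by blast
  have k0: "k \<noteq> \<zero>"
  proof
    assume "k = \<zero>"
    then have "k <# carrier R = {\<zero>}" using zero_closed by (auto simp: l_coset_def)
    then show False using simple by (simp add: simple_right_ideal_def)
  qed
  have "\<exists>t\<in>carrier R. t \<otimes> (r \<otimes> k) = k" if r: "r \<in> carrier R" and rk: "r \<otimes> k \<noteq> \<zero>" for r
  proof -
    have ann: "k \<otimes> x = \<zero>" if x: "x \<in> carrier R" "(r \<otimes> k) \<otimes> x = \<zero>" for x
    proof (rule ccontr)
      assume "k \<otimes> x \<noteq> \<zero>"
      moreover have "k \<otimes> x \<in> k <# carrier R" using x by (auto simp: mem_principal)
      ultimately have "k \<in> (k \<otimes> x) <# carrier R"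
        using simple_principal[OF simple] principal_self[OF k] by blast
      then obtain t where t: "t \<in> carrier R" "k = k \<otimes> x \<otimes> t" by (auto simp: mem_principal)
      then have "r \<otimes> k = (r \<otimes> k) \<otimes> x \<otimes> t" using r k x(1) by (metis m_assoc m_closed)
      then show False using x t rk by simp
    qed
    have "simple_right_ideal R ((r \<otimes> k) <# carrier R)" using simple_mult_left[OF simple k r rk] .
    then obtain c where c: "c \<in> carrier R" "k = c \<otimes> (r \<otimes> k)"
      using mininjective_factor[OF min, of "r \<otimes> k" k] r k ann by auto
    then show ?thesis using c(2)[symmetric] by blast
  qed
  then have "simple_right_ideal (opp R) (k <#\<^bsub>opp R\<^esub> carrier (opp R))"
    by (intro opp.simple_principalI) (use k k0 in auto)
  then show ?thesis by (simp add: opp_l_coset)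
qed

lemma mininjective_S_r_subset_S_l:
  assumes min: "right_mininjective R"
  shows "S_r R \<subseteq> S_l R"
proof
  interpret opp: ring "opp R" using opp_ring ring_axioms by blast
  fix x assume "x \<in> S_r R"
  then show "x \<in> S_l R"
  proof (induction rule: socle_induct)
    case zero
    then show ?case using opp.right_idealD(2)[OF opp.right_ideal_S_r] by simp
  next
    case (add y s S)
    have s: "s \<in> carrier R" using add by auto
    have "s \<in> S_l R"
    proof (cases "s = \<zero>")
      case True
      then show ?thesis using opp.right_idealD(2)[OF opp.right_ideal_S_r] by simp
    next
      case False
      then have "simple_right_ideal R (s <# carrier R)"
        using simple_principal[OF add(1,3)] add(1) by simp
      then have "carrier R #> s \<subseteq> S_l R"
        using mininjective_simple_left[OF min] s opp.simple_subset_S_r by simp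
      moreover have "s \<in> carrier R #> s"
        using s by (auto simp: mem_principal_left intro!: bexI[of _ \<one>])
      ultimately show ?thesis by blast
    qed
    then show ?case using add opp.right_idealD(3)[OF opp.right_ideal_S_r] by simp
  qed
qed

text \<open>Let \<open>L = lr(L)\<close> and let \<open>Rk\<close> be a left ideal outside \<open>L\<close> with \<open>kR\<close> simple. Some element of
  \<open>r(L)\<close> does not kill \<open>k\<close>; as \<open>kR\<close> is simple, \<open>\<one> = u + v\<close> with \<open>L u = 0\<close> and \<open>k v = 0\<close>. Then
  \<open>x = x u + x v\<close> decomposes an element of \<open>lr(L + Rk)\<close> into an element of \<open>lr(k)\<close>, which is \<open>Rk\<close> by
  mininjectivity, and an element of \<open>lr(L)\<close>.\<close>

lemma mininjective_lr_ann_add: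
  assumes min: "right_mininjective R" and simple: "simple_right_ideal R (k <# carrier R)"
    and k: "k \<in> carrier R"
    and L: "right_ideal (opp R) L" "L = lr_ann R L" "k \<notin> L"
  shows "lr_ann R (L <+> (carrier R #> k)) \<subseteq> L <+> (carrier R #> k)"
proof
  interpret opp: ring "opp R" using opp_ring ring_axioms by blast
  have Lc: "L \<subseteq> carrier R" using opp.right_ideal_subset[OF L(1)] by simp
  fix x assume x: "x \<in> lr_ann R (L <+> (carrier R #> k))"
  then have xc: "x \<in> carrier R" by (simp add: l_ann_def)
  have xk: "x \<otimes> y = \<zero>" if "y \<in> carrier R" "\<And>l. l \<in> L \<Longrightarrow> l \<otimes> y = \<zero>" "k \<otimes> y = \<zero>" for y
  proof -
    have "z \<otimes> y = \<zero>" if z: "z \<in> L <+> (carrier R #> k)" for z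
    proof -
      obtain l m where "l \<in> L" "m \<in> carrier R #> k" "z = l \<oplus> m"
        using z unfolding mem_set_add by blast
      moreover from this obtain r where "r \<in> carrier R" "m = r \<otimes> k"
        unfolding mem_principal_left by blast
      ultimately have "l \<in> L" "r \<in> carrier R" "z = l \<oplus> r \<otimes> k" by auto
      then show ?thesis using Lc k \<open>y \<in> carrier R\<close> \<open>\<And>l. l \<in> L \<Longrightarrow> l \<otimes> y = \<zero>\<close> \<open>k \<otimes> y = \<zero>\<close>
        by (auto simp: l_distr m_assoc subset_iff)
    qed
    then show ?thesis using x that(1) by (auto simp: l_ann_def r_ann_def)
  qed
  obtain w where w: "w \<in> carrier R" "\<And>l. l \<in> L \<Longrightarrow> l \<otimes> w = \<zero>" "k \<otimes> w \<noteq> \<zero>"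
  proof -
    have "k \<notin> lr_ann R L" using L(2,3) by simp
    then show ?thesis using that k by (auto simp: l_ann_def r_ann_def)
  qed
  have "k \<otimes> w \<in> k <# carrier R" using w by (auto simp: mem_principal)
  then have "k \<in> (k \<otimes> w) <# carrier R"
    using simple_principal[OF simple] w principal_self[OF k] by blast
  then obtain t where t: "t \<in> carrier R" "k = k \<otimes> w \<otimes> t" by (auto simp: mem_principal)
  define u where "u = w \<otimes> t"
  define v where "v = \<one> \<ominus> u"
  have uc: "u \<in> carrier R" "v \<in> carrier R" using w t by (auto simp: u_def v_def)
  have ku: "k \<otimes> u = k" using w t k by (simp add: u_def m_assoc)
  have Lu: "l \<otimes> u = \<zero>" if "l \<in> L" for l using w t that Lc by (auto simp: u_def m_assoc[symmetric])
  have Lv: "l \<otimes> v = l" if "l \<in> L" for l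
  proof -
    have "l \<in> carrier R" using that Lc by blast
    then have "l \<otimes> v = l \<ominus> l \<otimes> u" using uc(1) by (simp add: v_def mult_one_minus)
    then show ?thesis using Lu[OF that] \<open>l \<in> carrier R\<close> by (simp add: a_minus_def)
  qed
  have kv: "k \<otimes> v = \<zero>" using k uc(1) by (simp add: v_def mult_one_minus ku minus_self)
  have "x \<otimes> u \<in> carrier R #> k"
  proof -
    have "(x \<otimes> u) \<otimes> y = \<zero>" if y: "y \<in> carrier R" "k \<otimes> y = \<zero>" for y
    proof -
      have "x \<otimes> (u \<otimes> y) = \<zero>"
      proof (rule xk)
        show "l \<otimes> (u \<otimes> y) = \<zero>" if "l \<in> L" for l
          using Lu[OF that] y uc that Lc by (auto simp: m_assoc[symmetric])
        show "k \<otimes> (u \<otimes> y) = \<zero>" using k uc y ku by (simp add: m_assoc[symmetric])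
      qed (use y uc in simp)
      then show ?thesis using xc uc y by (simp add: m_assoc)
    qed
    then show ?thesis using mininjective_factor[OF min simple k, of "x \<otimes> u"] xc uc
      unfolding mem_principal_left by blast
  qed
  moreover have "x \<otimes> v \<in> L"
  proof -
    have "(x \<otimes> v) \<otimes> y = \<zero>" if y: "y \<in> r_ann R L" for y
    proof -
      have yc: "y \<in> carrier R" and Ly: "\<And>l. l \<in> L \<Longrightarrow> l \<otimes> y = \<zero>" using y by (auto simp: r_ann_def)
      have "x \<otimes> (v \<otimes> y) = \<zero>"
      proof (rule xk)
        show "l \<otimes> (v \<otimes> y) = \<zero>" if "l \<in> L" for l
          using Lv[OF that] Ly[OF that] yc uc that Lc by (auto simp: m_assoc[symmetric])
        show "k \<otimes> (v \<otimes> y) = \<zero>" using k uc yc kv by (simp add: m_assoc[symmetric])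
      qed (use yc uc in simp)
      then show ?thesis using xc uc yc by (simp add: m_assoc)
    qed
    then have "x \<otimes> v \<in> lr_ann R L" using xc uc by (auto simp: l_ann_def)
    then show ?thesis using L(2) by simp
  qed
  moreover have "x = x \<otimes> v \<oplus> x \<otimes> u" using xc uc(1) by (simp add: v_def mult_one_minus) algebra
  ultimately show "x \<in> L <+> (carrier R #> k)" unfolding mem_set_add by blast
qed

section \<open>Local rings and local idempotents\<close>

text \<open>If \<open>e\<close> is a nontrivial idempotent, then \<open>eR\<close> and \<open>(\<one> \<ominus> e)R\<close> are proper and lie in the unique
  maximal right ideal, which would contain \<open>\<one>\<close>.\<close>

lemma local_ring_idempotent:
  assumes loc: "local_ring R" and e: "idempotent_elem R e"
  shows "e = \<zero> \<or> e = \<one>"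
proof (rule ccontr)
  assume *: "\<not> (e = \<zero> \<or> e = \<one>)"
  have ec: "e \<in> carrier R" and ee: "e \<otimes> e = e" using e by (auto simp: idempotent_elem_def)
  obtain M where M: "maximal_right_ideal R M" "\<And>M'. maximal_right_ideal R M' \<Longrightarrow> M' = M"
    using loc unfolding local_ring_def by blast
  have proper: "f \<in> M" if f: "f \<in> carrier R" "f \<otimes> f = f" "f \<noteq> \<one>" for f
  proof -
    have "f <# carrier R \<noteq> carrier R"
    proof
      assume "f <# carrier R = carrier R"
      then obtain x where x: "x \<in> carrier R" "\<one> = f \<otimes> x" using one_closed by (metis mem_principal)
      then have "f = f \<otimes> (f \<otimes> x)" using f by (metis r_one)
      also have "\<dots> = f \<otimes> x" using f x(1) by (simp add: m_assoc[symmetric])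
      finally show False using f x by simp
    qed
    then obtain M' where "maximal_right_ideal R M'" "f <# carrier R \<subseteq> M'"
      using maximal_right_ideal_above right_ideal_principal f by metis
    then show ?thesis using M principal_self f by blast
  qed
  have "(\<one> \<ominus> e) \<otimes> (\<one> \<ominus> e) = \<one> \<ominus> e \<ominus> e \<oplus> e \<otimes> e"
    using ec by (simp add: a_minus_def l_distr r_distr l_minus r_minus minus_add a_ac)
  also have "\<dots> = \<one> \<ominus> e" unfolding ee using ec by algebra
  finally have "(\<one> \<ominus> e) \<otimes> (\<one> \<ominus> e) = \<one> \<ominus> e" .
  moreover have "\<one> \<ominus> e \<noteq> \<one>"
  proof
    assume "\<one> \<ominus> e = \<one>"
    moreover have "e = \<one> \<ominus> (\<one> \<ominus> e)" using ec by algebra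
    ultimately show False using * by (simp add: a_minus_def r_neg)
  qed
  ultimately have "\<one> \<ominus> e \<in> M" using ec by (intro proper) simp_all
  moreover have "e \<in> M" using ec ee * by (intro proper) simp_all
  moreover have M': "right_ideal R M" "M \<noteq> carrier R"
    using M(1) by (auto simp: maximal_right_ideal_def)
  ultimately have "(\<one> \<ominus> e) \<oplus> e \<in> M" using right_idealD(3)[OF M'(1), of "\<one> \<ominus> e" e] by simp
  moreover have "(\<one> \<ominus> e) \<oplus> e = \<one>" using ec by algebra
  ultimately show False using M' right_ideal_eq_carrierI by simp
qed

end

lemma corner_simps [simp]:
  "carrier (corner_ring R e) = {e \<otimes>\<^bsub>R\<^esub> x \<otimes>\<^bsub>R\<^esub> e | x. x \<in> carrier R}"
  "\<zero>\<^bsub>corner_ring R e\<^esub> = \<zero>\<^bsub>R\<^esub>" "\<one>\<^bsub>corner_ring R e\<^esub> = e"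
  "x \<oplus>\<^bsub>corner_ring R e\<^esub> y = x \<oplus>\<^bsub>R\<^esub> y" "x \<otimes>\<^bsub>corner_ring R e\<^esub> y = x \<otimes>\<^bsub>R\<^esub> y"
  by (simp_all add: corner_ring_def)

context ring
begin

lemma idempotentD:
  assumes "idempotent_elem R e"
  shows "e \<in> carrier R" "e \<otimes> e = e" "x \<in> carrier R \<Longrightarrow> e \<otimes> (e \<otimes> x) = e \<otimes> x"
    "x \<in> carrier R \<Longrightarrow> (x \<otimes> e) \<otimes> e = x \<otimes> e"
proof -
  show e: "e \<in> carrier R" "e \<otimes> e = e" using assms by (auto simp: idempotent_elem_def)
  show "x \<in> carrier R \<Longrightarrow> e \<otimes> (e \<otimes> x) = e \<otimes> x" using e by (simp add: m_assoc[symmetric])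
  show "x \<in> carrier R \<Longrightarrow> (x \<otimes> e) \<otimes> e = x \<otimes> e" using e by (simp add: m_assoc)
qed

lemma corner_carrier:
  assumes "idempotent_elem R e"
  shows "x \<in> carrier (corner_ring R e) \<longleftrightarrow> x \<in> carrier R \<and> e \<otimes> x = x \<and> x \<otimes> e = x"
proof
  assume "x \<in> carrier (corner_ring R e)"
  then show "x \<in> carrier R \<and> e \<otimes> x = x \<and> x \<otimes> e = x"
    using idempotentD[OF assms] by (auto simp: m_assoc)
next
  assume "x \<in> carrier R \<and> e \<otimes> x = x \<and> x \<otimes> e = x"
  then have "x \<in> carrier R" "x = e \<otimes> x \<otimes> e" by auto
  then show "x \<in> carrier (corner_ring R e)" by auto
qed

lemma corner_ring_ring:
  assumes e: "idempotent_elem R e"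
  shows "ring (corner_ring R e)"
proof -
  note c = corner_carrier[OF e] and e' = idempotentD[OF e]
  show ?thesis
  proof (rule ringI)
    show "abelian_group (corner_ring R e)"
    proof (rule abelian_groupI)
      fix x assume "x \<in> carrier (corner_ring R e)"
      then have x: "x \<in> carrier R" "e \<otimes> x = x" "x \<otimes> e = x" using c by auto
      then have "\<ominus> x \<in> carrier (corner_ring R e)"
        unfolding c using e' by (simp add: l_minus r_minus)
      then show "\<exists>y\<in>carrier (corner_ring R e).
          y \<oplus>\<^bsub>corner_ring R e\<^esub> x = \<zero>\<^bsub>corner_ring R e\<^esub>"
        using x l_neg by (auto simp del: corner_simps(1))
    next
      fix x y assume "x \<in> carrier (corner_ring R e)" "y \<in> carrier (corner_ring R e)"
      then show "x \<oplus>\<^bsub>corner_ring R e\<^esub> y \<in> carrier (corner_ring R e)"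
        unfolding c using e' by (simp add: l_distr r_distr)
    next
      show "\<zero>\<^bsub>corner_ring R e\<^esub> \<in> carrier (corner_ring R e)" unfolding c using e' by simp
    qed (use c in \<open>simp_all add: a_ac del: corner_simps(1)\<close>)
    show "monoid (corner_ring R e)"
    proof (rule monoidI)
      fix x y assume "x \<in> carrier (corner_ring R e)" "y \<in> carrier (corner_ring R e)"
      then have "x \<in> carrier R" "y \<in> carrier R" "e \<otimes> x = x" "y \<otimes> e = y" unfolding c by auto
      then have "x \<otimes> y \<in> carrier R" "e \<otimes> (x \<otimes> y) = x \<otimes> y" "(x \<otimes> y) \<otimes> e = x \<otimes> y"
        using e' m_assoc[of e x y] m_assoc[of x y e] by simp_all
      then show "x \<otimes>\<^bsub>corner_ring R e\<^esub> y \<in> carrier (corner_ring R e)" unfolding c by simp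
    next
      show "\<one>\<^bsub>corner_ring R e\<^esub> \<in> carrier (corner_ring R e)" unfolding c using e' by simp
    qed (use c in \<open>simp_all add: m_assoc del: corner_simps(1)\<close>)
  qed (use c in \<open>simp_all add: l_distr r_distr del: corner_simps(1)\<close>)
qed

lemma local_idempotent_corner:
  assumes e: "local_idempotent R e" and f: "idempotent_elem R f" "e \<otimes> f = f" "f \<otimes> e = f"
  shows "f = \<zero> \<or> f = e"
proof -
  have e': "idempotent_elem R e" "local_ring (corner_ring R e)"
    using e by (auto simp: local_idempotent_def)
  interpret corner: ring "corner_ring R e" using corner_ring_ring[OF e'(1)] .
  have "idempotent_elem (corner_ring R e) f"
    using f corner_carrier[OF e'(1)] unfolding idempotent_elem_def by simp
  then show ?thesis using corner.local_ring_idempotent[OF e'(2)] by simp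
qed

text \<open>The corner ring of \<open>\<zero>\<close> is the zero ring, which has no maximal right ideal.\<close>

lemma local_idempotent_nonzero:
  assumes "local_idempotent R e"
  shows "e \<noteq> \<zero>"
proof
  assume e0: "e = \<zero>"
  have e: "idempotent_elem R e" "local_ring (corner_ring R e)"
    using assms by (auto simp: local_idempotent_def)
  interpret corner: ring "corner_ring R e" using corner_ring_ring[OF e(1)] .
  obtain M where M: "maximal_right_ideal (corner_ring R e) M"
    using e unfolding local_ring_def by blast
  then have M': "right_ideal (corner_ring R e) M" "M \<noteq> carrier (corner_ring R e)"
    by (auto simp: maximal_right_ideal_def)
  then have "\<one>\<^bsub>corner_ring R e\<^esub> \<in> M"
    using corner.right_idealD(2) e0 by (simp del: corner_simps(1))
  then show False using M' corner.right_ideal_eq_carrierI by blast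
qed

end

section \<open>Semiperfect rings\<close>

locale semiperfect_ring = ring +
  assumes semiperfect: "semiperfect R"
begin

abbreviation "J \<equiv> jacobson R"
abbreviation "Q \<equiv> R Quot J"
abbreviation "\<pi> x \<equiv> J +> x"

lemma idempotent_lift:
  assumes "a \<in> carrier R" "a \<otimes> a \<ominus> a \<in> J"
  obtains e where "idempotent_elem R e" "e \<ominus> a \<in> J"
  using semiperfect assms unfolding semiperfect_def by blast

lemma quotient_facts:
  shows "ring (Q)"
    and "semisimple_right_ideal (Q) (carrier (Q))"
    and "X \<in> carrier (Q) \<Longrightarrow> \<exists>x\<in>carrier R. X = \<pi> x"
    and "x \<in> carrier R \<Longrightarrow> y \<in> carrier R \<Longrightarrow> \<pi> (x \<otimes> y) = \<pi> x \<otimes>\<^bsub>Q\<^esub> \<pi> y"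
    and "x \<in> carrier R \<Longrightarrow> y \<in> carrier R \<Longrightarrow> \<pi> (x \<oplus> y) = \<pi> x \<oplus>\<^bsub>Q\<^esub> \<pi> y"
    and "\<pi> \<one> = \<one>\<^bsub>Q\<^esub>" "\<pi> \<zero> = \<zero>\<^bsub>Q\<^esub>"
    and "x \<in> carrier R \<Longrightarrow> \<pi> x \<in> carrier (Q)"
    and "x \<in> carrier R \<Longrightarrow> \<pi> x = \<zero>\<^bsub>Q\<^esub> \<longleftrightarrow> x \<in> J"
    and "x \<in> carrier R \<Longrightarrow> y \<in> carrier R \<Longrightarrow> \<pi> x = \<pi> y \<longleftrightarrow> x \<ominus> y \<in> J"
proof -
  have zero_Quot: "\<zero>\<^bsub>Q\<^esub> = J" by (simp add: FactRing_def)
  interpret J: ideal J R by (rule ideal_jacobson)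
  interpret Q: ring "Q" by (rule J.quotient_is_ring)
  interpret hom: ring_hom_ring R "Q" "(+>) J" by (rule J.rcos_ring_hom_ring)
  show "ring (Q)" by (rule J.quotient_is_ring)
  show "semisimple_right_ideal (Q) (carrier (Q))"
    using semiperfect by (simp add: semiperfect_def semisimple_ring_def)
  show "X \<in> carrier (Q) \<Longrightarrow> \<exists>x\<in>carrier R. X = \<pi> x"
    unfolding FactRing_def A_RCOSETS_def' partial_object.simps by blast
  show "x \<in> carrier R \<Longrightarrow> y \<in> carrier R \<Longrightarrow> \<pi> (x \<otimes> y) = \<pi> x \<otimes>\<^bsub>Q\<^esub> \<pi> y"
    "x \<in> carrier R \<Longrightarrow> y \<in> carrier R \<Longrightarrow> \<pi> (x \<oplus> y) = \<pi> x \<oplus>\<^bsub>Q\<^esub> \<pi> y"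
    "\<pi> \<one> = \<one>\<^bsub>Q\<^esub>" "\<pi> \<zero> = \<zero>\<^bsub>Q\<^esub>"
    "x \<in> carrier R \<Longrightarrow> \<pi> x \<in> carrier (Q)" by simp_all
  show zero: "\<pi> x = \<zero>\<^bsub>Q\<^esub> \<longleftrightarrow> x \<in> J" if "x \<in> carrier R" for x
    using that J.a_rcos_const[of x] J.rcos_const_imp_mem[of x] unfolding zero_Quot by blast
  show "\<pi> x = \<pi> y \<longleftrightarrow> x \<ominus> y \<in> J" if "x \<in> carrier R" "y \<in> carrier R"
  proof -
    have "\<pi> (x \<ominus> y) = \<pi> x \<ominus>\<^bsub>Q\<^esub> \<pi> y" using that unfolding a_minus_def by simp
    then show ?thesis
      using zero[of "x \<ominus> y"] that Q.minus_eq_zero_iff[of "\<pi> x" "\<pi> y"] hom.hom_closed by simp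
  qed
qed

lemma quotient_right_ideal:
  assumes K: "right_ideal R K"
  shows "right_ideal (Q) (\<pi> ` K)"
proof -
  interpret Q: ring "Q" by (rule quotient_facts)
  note Kc = right_idealD(1)[OF K]
  show ?thesis
  proof (rule Q.right_idealI)
    show "\<pi> ` K \<subseteq> carrier (Q)" using Kc quotient_facts(8) by blast
    show "\<zero>\<^bsub>Q\<^esub> \<in> \<pi> ` K" using quotient_facts(7) right_idealD(2)[OF K] by (metis imageI)
  next
    fix X Y assume "X \<in> \<pi> ` K" "Y \<in> \<pi> ` K"
    then obtain x y where "x \<in> K" "y \<in> K" "X = \<pi> x" "Y = \<pi> y" by blast
    then show "X \<oplus>\<^bsub>Q\<^esub> Y \<in> \<pi> ` K"
      using quotient_facts(5)[of x y] Kc right_idealD(3)[OF K] by (metis imageI)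
  next
    fix X Y assume "X \<in> \<pi> ` K" "Y \<in> carrier (Q)"
    then obtain x y where "x \<in> K" "y \<in> carrier R" "X = \<pi> x" "Y = \<pi> y"
      using quotient_facts(3) by blast
    then show "X \<otimes>\<^bsub>Q\<^esub> Y \<in> \<pi> ` K"
      using quotient_facts(4)[of x y] Kc right_idealD(4)[OF K] by (metis imageI)
  qed
qed

text \<open>Modulo \<open>J\<close> a right ideal has a complement; the component \<open>k\<close> of \<open>\<one>\<close> acts on it as a left
  identity.\<close>

lemma right_ideal_left_identity_mod:
  assumes K: "right_ideal R K"
  obtains k where "k \<in> K" "\<And>x. x \<in> K \<Longrightarrow> x \<ominus> k \<otimes> x \<in> J"
proof -
  interpret Q: ring "Q" by (rule quotient_facts)
  let ?K = "\<pi> ` K"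
  note Kc = right_idealD(1)[OF K]
  have K': "right_ideal (Q) ?K" using quotient_right_ideal[OF K] .
  obtain B where B: "right_ideal (Q) B" "?K \<inter> B = {\<zero>\<^bsub>Q\<^esub>}"
    "?K <+>\<^bsub>Q\<^esub> B = carrier (Q)"
    by (rule Q.semisimple_complement[OF quotient_facts(2) K' Q.right_ideal_subset[OF K']])
  have "\<one>\<^bsub>Q\<^esub> \<in> ?K <+>\<^bsub>Q\<^esub> B" using B by simp
  then obtain k b where k: "k \<in> K" "b \<in> B" "\<one>\<^bsub>Q\<^esub> = (\<pi> k) \<oplus>\<^bsub>Q\<^esub> b" unfolding mem_set_add by blast
  have "x \<ominus> k \<otimes> x \<in> J" if x: "x \<in> K" for x
  proof -
    let ?x = "\<pi> x" and ?k = "\<pi> k"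
    have c: "?x \<in> carrier (Q)" "?k \<in> carrier (Q)" "b \<in> carrier (Q)"
      using x k Kc quotient_facts(8) Q.right_idealD(1)[OF B(1)] by blast+
    have "?x = ?k \<otimes>\<^bsub>Q\<^esub> ?x \<oplus>\<^bsub>Q\<^esub> b \<otimes>\<^bsub>Q\<^esub> ?x"
      using c Q.l_one[OF c(1)] unfolding k(3) by (simp add: Q.l_distr)
    moreover have "b \<otimes>\<^bsub>Q\<^esub> ?x =
        (?k \<otimes>\<^bsub>Q\<^esub> ?x \<oplus>\<^bsub>Q\<^esub> b \<otimes>\<^bsub>Q\<^esub> ?x) \<ominus>\<^bsub>Q\<^esub> ?k \<otimes>\<^bsub>Q\<^esub> ?x" using c by algebra
    ultimately have "b \<otimes>\<^bsub>Q\<^esub> ?x = ?x \<ominus>\<^bsub>Q\<^esub> ?k \<otimes>\<^bsub>Q\<^esub> ?x" by simp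
    moreover have "?x \<in> ?K" "?k \<otimes>\<^bsub>Q\<^esub> ?x \<in> ?K" using x k c K' Q.right_idealD(4) by blast+
    ultimately have "b \<otimes>\<^bsub>Q\<^esub> ?x \<in> ?K" using Q.right_idealD(6)[OF K'] by simp
    moreover have "b \<otimes>\<^bsub>Q\<^esub> ?x \<in> B" using Q.right_idealD(4)[OF B(1) k(2) c(1)] .
    ultimately have "b \<otimes>\<^bsub>Q\<^esub> ?x = \<zero>\<^bsub>Q\<^esub>" using B by blast
    then have "?x = \<pi> (k \<otimes> x)" using \<open>?x = _\<close> c x k Kc quotient_facts(4)[of k x] by simp
    then show ?thesis using quotient_facts(10)[of x "k \<otimes> x"] x k Kc by simp
  qed
  then show ?thesis using that k by blast
qed

text \<open>The left identity \<open>k\<close> is idempotent modulo \<open>J\<close>. If \<open>e\<close> lifts it, then \<open>u = \<one> - (e - k)\<close> is a unit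
  with \<open>u e = k e\<close>, so the conjugate \<open>u e u\<^sup>-\<^sup>1\<close> is an idempotent inside \<open>K\<close> that is still
  congruent to \<open>k\<close>.\<close>

lemma right_ideal_idempotent:
  assumes K: "right_ideal R K"
  obtains g where "idempotent_elem R g" "g \<in> K" "\<And>x. x \<in> K \<Longrightarrow> x \<ominus> g \<otimes> x \<in> J"
proof -
  obtain k where k: "k \<in> K" "\<And>x. x \<in> K \<Longrightarrow> x \<ominus> k \<otimes> x \<in> J"
    using right_ideal_left_identity_mod[OF K] by blast
  note Kc = right_idealD(1)[OF K]
  have kc: "k \<in> carrier R" using k Kc by blast
  have "k \<otimes> k \<ominus> k = \<ominus> (k \<ominus> k \<otimes> k)" using kc by algebra
  then have "k \<otimes> k \<ominus> k \<in> J" using k jacobson_neg by simp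
  then obtain e where e: "idempotent_elem R e" and d: "e \<ominus> k \<in> J"
    using idempotent_lift[OF kc] by blast
  note ee = idempotentD[OF e]
  define u where "u = \<one> \<ominus> (e \<ominus> k)"
  have "u \<in> Units R" unfolding u_def by (rule jacobson_unit[OF d])
  then obtain v where u: "u \<in> carrier R" and v: "v \<in> carrier R" "u \<otimes> v = \<one>" "v \<otimes> u = \<one>"
    by (auto simp: Units_def)
  define g where "g = k \<otimes> e \<otimes> v"
  have gc: "g \<in> carrier R" using kc ee v by (simp add: g_def)
  have ue: "u \<otimes> e = k \<otimes> e"
  proof -
    have "u \<otimes> e = e \<ominus> e \<otimes> e \<oplus> k \<otimes> e" unfolding u_def using kc ee(1) by algebra
    also have "\<dots> = k \<otimes> e" using kc ee(1) by (simp add: ee(2) minus_self)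
    finally show ?thesis .
  qed
  have "g \<otimes> g = k \<otimes> e \<otimes> (v \<otimes> u) \<otimes> e \<otimes> v"
    unfolding g_def ue[symmetric] using u v(1) ee(1) by (simp add: m_assoc)
  also have "\<dots> = g" unfolding v(3) g_def using ee kc v(1) by (simp add: m_assoc)
  finally have g: "idempotent_elem R g" using gc by (simp add: idempotent_elem_def)
  moreover have "g \<in> K" unfolding g_def using k(1) kc ee v right_idealD(4)[OF K] by simp
  moreover have "x \<ominus> g \<otimes> x \<in> J" if x: "x \<in> K" for x
  proof -
    have xc: "x \<in> carrier R" using x Kc by blast
    have gu: "g \<ominus> g \<otimes> (e \<ominus> k) = k \<otimes> e"
    proof -
      have "g \<otimes> u = k \<otimes> e" unfolding g_def using kc ee v u by (simp add: m_assoc)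
      then show ?thesis unfolding u_def using gc kc ee(1) by (simp add: mult_one_minus)
    qed
    have "g \<ominus> k = (g \<ominus> g \<otimes> (e \<ominus> k)) \<oplus> g \<otimes> (e \<ominus> k) \<ominus> k" using gc kc ee(1) by algebra
    also have "\<dots> = k \<otimes> e \<oplus> g \<otimes> (e \<ominus> k) \<ominus> k" unfolding gu ..
    also have "\<dots> = (e \<ominus> k) \<ominus> (e \<ominus> k) \<otimes> e \<oplus> g \<otimes> (e \<ominus> k) \<oplus> (e \<otimes> e \<ominus> e)" using gc kc ee(1) by algebra
    also have "\<dots> = (e \<ominus> k) \<ominus> (e \<ominus> k) \<otimes> e \<oplus> g \<otimes> (e \<ominus> k)"
      using gc kc ee(1) by (simp add: ee(2) minus_self)
    finally have gk: "g \<ominus> k \<in> J"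
      using d gc ee(1) by (simp add: jacobson_add jacobson_minus jacobson_right_mult jacobson_left_mult)
    have "x \<ominus> g \<otimes> x = (x \<ominus> k \<otimes> x) \<ominus> (g \<ominus> k) \<otimes> x" using xc gc kc by algebra
    then show ?thesis using k(2)[OF x] gk xc by (simp add: jacobson_minus jacobson_right_mult)
  qed
  ultimately show ?thesis using that by blast
qed

text \<open>The element \<open>x\<close> is a representative of a generator of a simple right ideal of \<open>R/J\<close> inside the image
  of \<open>K\<close>.\<close>

lemma right_ideal_simple_mod:
  assumes K: "right_ideal R K" "\<not> K \<subseteq> J"
  obtains x where "x \<in> K" "x \<notin> J"
    "\<And>r. r \<in> carrier R \<Longrightarrow> x \<otimes> r \<notin> J \<Longrightarrow> \<exists>t\<in>carrier R. x \<otimes> r \<otimes> t \<ominus> x \<in> J"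
proof -
  interpret Q: ring "Q" by (rule quotient_facts)
  let ?K = "\<pi> ` K"
  note Kc = right_idealD(1)[OF K(1)]
  have K': "right_ideal (Q) ?K" using quotient_right_ideal[OF K(1)] .
  obtain y where "y \<in> K" "y \<notin> J" using K by blast
  then have "\<pi> y \<in> ?K" "\<pi> y \<noteq> \<zero>\<^bsub>Q\<^esub>" using quotient_facts(9)[of y] Kc by auto
  then have nz: "?K \<noteq> {\<zero>\<^bsub>Q\<^esub>}" by blast
  obtain S where S: "simple_right_ideal (Q) S" "S \<subseteq> ?K"
    by (rule Q.semisimple_contains_simple[OF quotient_facts(2) K' Q.right_ideal_subset[OF K'] nz])
  then have S': "right_ideal (Q) S" "S \<noteq> {\<zero>\<^bsub>Q\<^esub>}" by (auto simp: simple_right_ideal_def)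
  then obtain X where X: "X \<in> S" "X \<noteq> \<zero>\<^bsub>Q\<^esub>" using Q.right_idealD(2)[OF S'(1)] by blast
  then obtain x where x: "x \<in> K" "X = \<pi> x" using S by blast
  have xc: "x \<in> carrier R" using x Kc by blast
  have "x \<notin> J" using X x xc quotient_facts(9) by simp
  moreover have "\<exists>t\<in>carrier R. x \<otimes> r \<otimes> t \<ominus> x \<in> J" if r: "r \<in> carrier R" "x \<otimes> r \<notin> J" for r
  proof -
    have "\<pi> (x \<otimes> r) = X \<otimes>\<^bsub>Q\<^esub> (\<pi> r)" using quotient_facts(4) x xc r by simp
    then have "\<pi> (x \<otimes> r) \<in> S" using Q.right_idealD(4)[OF S'(1) X(1)] r quotient_facts(8) by simp
    moreover have "\<pi> (x \<otimes> r) \<noteq> \<zero>\<^bsub>Q\<^esub>" using r xc quotient_facts(9) by simp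
    ultimately have "X \<in> (\<pi> (x \<otimes> r)) <#\<^bsub>Q\<^esub> carrier (Q)"
      using Q.simple_principal[OF S(1)] X by simp
    then obtain t where t: "t \<in> carrier R" "X = (\<pi> (x \<otimes> r)) \<otimes>\<^bsub>Q\<^esub> (\<pi> t)"
      using quotient_facts(3) unfolding mem_principal by blast
    then have "\<pi> (x \<otimes> r \<otimes> t) = \<pi> x" using quotient_facts(4)[of "x \<otimes> r" t] x xc r by simp
    then show ?thesis using quotient_facts(10)[of "x \<otimes> r \<otimes> t" x] xc r t by auto
  qed
  ultimately show ?thesis using that x by blast
qed

lemma jacobson_minus_mult_cancel:
  assumes "x \<in> carrier R" "g \<in> J" "x \<ominus> g \<otimes> x \<in> J"
  shows "x \<in> J" using assms jacobson_minus_cancel[of x "g \<otimes> x"] jacobson_right_mult by blast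

text \<open>Take \<open>x \<in> K\<close> generating a simple right ideal of \<open>R/J\<close>, and an idempotent \<open>g \<in> xR\<close> generating
  \<open>xR\<close> modulo \<open>J\<close>. Every element of \<open>gRg\<close> outside \<open>J\<close> has a right inverse modulo \<open>J\<close>, hence a right
  inverse in \<open>gRg\<close>. So \<open>J \<inter> gRg\<close> contains every proper right ideal of \<open>gRg\<close>.\<close>

lemma right_ideal_contains_local_idempotent:
  assumes K: "right_ideal R K" "\<not> K \<subseteq> J"
  obtains g where "local_idempotent R g" "g \<in> K"
proof -
  obtain x where x: "x \<in> K" "x \<notin> J"
    "\<And>r. r \<in> carrier R \<Longrightarrow> x \<otimes> r \<notin> J \<Longrightarrow> \<exists>t\<in>carrier R. x \<otimes> r \<otimes> t \<ominus> x \<in> J"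
    using right_ideal_simple_mod[OF K] by blast
  have xc: "x \<in> carrier R" using x K right_idealD(1) by blast
  obtain g where g: "idempotent_elem R g" "g \<in> x <# carrier R"
    "\<And>y. y \<in> x <# carrier R \<Longrightarrow> y \<ominus> g \<otimes> y \<in> J"
    using right_ideal_idempotent[OF right_ideal_principal[OF xc]] by blast
  obtain r where r: "r \<in> carrier R" "g = x \<otimes> r" using g(2) by (auto simp: mem_principal)
  note g' = idempotentD[OF g(1)]
  have gK: "g \<in> K" using principal_subset[OF K(1) x(1)] g(2) by blast
  have gJ: "g \<notin> J"
    using jacobson_minus_mult_cancel[OF xc _ g(3)[OF principal_self[OF xc]]] x(2) by blast
  let ?C = "corner_ring R g"
  note C = corner_carrier[OF g(1)]
  interpret C: ring ?C using corner_ring_ring[OF g(1)] .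
  have inv: "\<exists>s\<in>carrier ?C. y \<otimes> s = g" if y: "y \<in> carrier ?C" "y \<notin> J" for y
  proof -
    have yc: "y \<in> carrier R" "g \<otimes> y = y" "y \<otimes> g = y" using y C by auto
    have "x \<otimes> (r \<otimes> y) = y" using yc(1,2) r xc by (simp add: m_assoc)
    then obtain t where t: "t \<in> carrier R" "y \<otimes> t \<ominus> x \<in> J" using x(3)[of "r \<otimes> y"] y r yc by auto
    define j where "j = (y \<otimes> t \<ominus> x) \<otimes> r \<otimes> g"
    have j: "j \<in> J" unfolding j_def using t r g' by (simp add: jacobson_right_mult)
    have jc: "j \<in> carrier R" using j jacobson_carrier by blast
    have "j = y \<otimes> (t \<otimes> r \<otimes> g) \<ominus> (x \<otimes> r) \<otimes> g"
      unfolding j_def using yc(1) t(1) xc r(1) g'(1) by algebra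
    then have j': "j = y \<otimes> (t \<otimes> r \<otimes> g) \<ominus> g" using r(2) g'(2) by simp
    (* y (t r g) = g + j, and the inverse of the unit \<one> + j corrects the error j. *)
    have "\<one> \<ominus> (\<ominus> j) \<in> Units R" using j jacobson_neg jacobson_unit by blast
    then obtain w where w: "w \<in> carrier R" "(\<one> \<oplus> j) \<otimes> w = \<one>"
      using jc by (auto simp: Units_def a_minus_def)
    have "g \<otimes> j = j"
      unfolding j' using g' yc t r by (simp add: a_minus_def r_distr r_minus m_assoc[symmetric])
    then have gj: "g \<otimes> (\<one> \<oplus> j) = y \<otimes> (t \<otimes> r \<otimes> g)"
      using g' jc yc t r unfolding j' by (simp add: r_distr) algebra
    have "y \<otimes> (g \<otimes> (t \<otimes> r \<otimes> g \<otimes> w) \<otimes> g) = (y \<otimes> g) \<otimes> (t \<otimes> r \<otimes> g) \<otimes> w \<otimes> g"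
      using yc(1) g'(1) t(1) r(1) w(1) by (simp add: m_assoc)
    also have "\<dots> = g \<otimes> (\<one> \<oplus> j) \<otimes> w \<otimes> g" unfolding yc(3) gj ..
    also have "\<dots> = g \<otimes> ((\<one> \<oplus> j) \<otimes> w) \<otimes> g" using g'(1) jc w(1) by (simp add: m_assoc)
    also have "\<dots> = g" unfolding w(2) using g' by simp
    finally show ?thesis
      using g'(1) t(1) r(1) w(1) by (intro bexI[of _ "g \<otimes> (t \<otimes> r \<otimes> g \<otimes> w) \<otimes> g"]) auto
  qed
  let ?M = "J \<inter> carrier ?C"
  have M: "right_ideal ?C ?M"
  proof (rule C.right_idealI)
    fix y z assume "y \<in> ?M" "z \<in> carrier ?C"
    then show "y \<otimes>\<^bsub>?C\<^esub> z \<in> ?M"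
      using C.m_closed[of y z] C by (simp add: jacobson_right_mult del: corner_simps(1))
  next
    fix y z assume "y \<in> ?M" "z \<in> ?M"
    then show "y \<oplus>\<^bsub>?C\<^esub> z \<in> ?M"
      using C.a_closed[of y z] by (simp add: jacobson_add del: corner_simps(1))
  next
    show "\<zero>\<^bsub>?C\<^esub> \<in> ?M" using C.zero_closed jacobson_zero by (simp del: corner_simps(1))
  qed simp
  have M_ne: "?M \<noteq> carrier ?C" using gJ C.one_closed by (auto simp del: corner_simps(1))
  have proper: "L \<subseteq> ?M" if L: "right_ideal ?C L" "L \<noteq> carrier ?C" for L
  proof
    fix y assume y: "y \<in> L"
    then have yC: "y \<in> carrier ?C" using L C.right_idealD(1) by blast
    have "y \<in> J"
    proof (rule ccontr)
      assume "y \<notin> J"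
      then obtain s where s: "s \<in> carrier ?C" "y \<otimes> s = g" using inv yC by blast
      then have "\<one>\<^bsub>?C\<^esub> \<in> L" using C.right_idealD(4)[OF L(1) y s(1)] by simp
      then show False using L C.right_ideal_eq_carrierI by blast
    qed
    then show "y \<in> ?M" using yC by blast
  qed
  have "local_ring ?C" unfolding local_ring_def
  proof (rule ex1I)
    show "maximal_right_ideal ?C ?M" unfolding maximal_right_ideal_def
    proof (intro conjI allI impI)
      fix L assume L: "right_ideal ?C L \<and> ?M \<subseteq> L"
      then show "L = ?M \<or> L = carrier ?C" using proper[of L] by blast
    qed (use M M_ne in auto)
  next
    fix M' assume M': "maximal_right_ideal ?C M'"
    then have "M' \<subseteq> ?M" using proper unfolding maximal_right_ideal_def by blast
    then show "M' = ?M" using M' M M_ne unfolding maximal_right_ideal_def by blast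
  qed
  then show ?thesis using that g(1) gK by (simp add: local_idempotent_def)
qed

text \<open>This replaces a decomposition of \<open>\<one>\<close> into orthogonal local idempotents: a property of elements
  that is closed under addition and right multiplication holds everywhere once it holds for all local
  idempotents.\<close>

lemma right_ideal_all_local_idempotents:
  assumes A: "right_ideal R A" and loc: "\<And>e. local_idempotent R e \<Longrightarrow> e \<in> A"
  shows "\<one> \<in> A"
proof -
  obtain g where g: "idempotent_elem R g" "g \<in> A" "\<And>x. x \<in> A \<Longrightarrow> x \<ominus> g \<otimes> x \<in> J"
    using right_ideal_idempotent[OF A] by blast
  note g' = idempotentD[OF g(1)]
  have "\<one> \<ominus> g \<in> J"
  proof (rule ccontr)
    assume n: "\<one> \<ominus> g \<notin> J"
    have c: "\<one> \<ominus> g \<in> carrier R" using g' by simp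
    have "\<not> (\<one> \<ominus> g) <# carrier R \<subseteq> J" using n principal_self[OF c] by blast
    then obtain e where e: "local_idempotent R e" "e \<in> (\<one> \<ominus> g) <# carrier R"
      using right_ideal_contains_local_idempotent[OF right_ideal_principal[OF c]] by blast
    obtain r where r: "r \<in> carrier R" "e = (\<one> \<ominus> g) \<otimes> r" using e(2) by (auto simp: mem_principal)
    have ei: "idempotent_elem R e" using e(1) by (simp add: local_idempotent_def)
    have "g \<otimes> e = g \<otimes> r \<ominus> g \<otimes> (g \<otimes> r)"
      unfolding r(2) using g'(1) r(1) by (simp add: mult_one_minus) algebra
    then have "g \<otimes> e = \<zero>" using g' r(1) by (simp add: minus_self)
    then have "e \<in> J" using g(3)[OF loc[OF e(1)]] idempotentD(1)[OF ei] by (simp add: a_minus_def)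
    then show False
      using jacobson_idempotent_zero[OF ei] local_idempotent_nonzero[OF e(1)] by blast
  qed
  moreover have "g = \<one> \<ominus> (\<one> \<ominus> g)" using g'(1) by algebra
  ultimately have "g \<in> Units R" using jacobson_unit by metis
  then obtain v where "v \<in> carrier R" "g \<otimes> v = \<one>" by (auto simp: Units_def)
  then show ?thesis using right_idealD(4)[OF A g(2)] by metis
qed

lemma local_idempotentD:
  assumes "local_idempotent R e"
  shows "idempotent_elem R e" "e \<in> carrier R" "e \<otimes> e = e" "e \<notin> J"
proof -
  show e: "idempotent_elem R e" using assms by (simp add: local_idempotent_def)
  then show "e \<in> carrier R" "e \<otimes> e = e" by (auto simp: idempotent_elem_def)
  show "e \<notin> J" using jacobson_idempotent_zero[OF e] local_idempotent_nonzero[OF assms] by blast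
qed

text \<open>The same fact in the form that \<open>\<one>\<close> is a finite sum of elements \<open>e r\<close> with \<open>e\<close> local.\<close>

lemma one_local_induct [case_names zero add]:
  assumes zero: "P \<zero>"
    and add: "\<And>y e r. y \<in> carrier R \<Longrightarrow> P y \<Longrightarrow> local_idempotent R e \<Longrightarrow> r \<in> carrier R \<Longrightarrow>
      P (y \<oplus> e \<otimes> r)"
  shows "P \<one>"
proof -
  let ?E = "(\<lambda>e. e <# carrier R) ` {e. local_idempotent R e}"
  have E: "right_ideal R I" if "I \<in> ?E" for I
    using that right_ideal_principal local_idempotentD(2) by blast
  have "\<one> \<in> right_span R (\<Union>?E)"
  proof (rule right_ideal_all_local_idempotents)
    show "right_ideal R (right_span R (\<Union>?E))"
      by (rule right_ideal_span, rule Union_least, rule right_ideal_subset, rule E)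
    fix e assume e: "local_idempotent R e"
    then have "e \<in> \<Union>?E" using principal_self[OF local_idempotentD(2)[OF e]] by blast
    then show "e \<in> right_span R (\<Union>?E)" by (rule subsetD[OF span_superset])
  qed
  then show ?thesis
  proof (induction rule: span_Union_induct)
    case (add y s I)
    then obtain e r where "local_idempotent R e" "r \<in> carrier R" "s = e \<otimes> r"
      by (auto simp: mem_principal)
    then show ?case using assms(2) add by blast
  qed (use E zero in auto)
qed

lemma mem_if_local:
  assumes T: "right_ideal R T" and s: "s \<in> carrier R"
    and loc: "\<And>e. local_idempotent R e \<Longrightarrow> s \<otimes> e \<in> T"
  shows "s \<in> T"
proof -
  let ?A = "{x \<in> carrier R. s \<otimes> x \<in> T}"
  have "right_ideal R ?A" by (rule right_idealI)
       (use s right_idealD(2-4)[OF T] in \<open>auto simp: r_distr m_assoc[symmetric]\<close>)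
  moreover have "e \<in> ?A" if "local_idempotent R e" for e
    using loc[OF that] local_idempotentD(2)[OF that] by simp
  ultimately have "\<one> \<in> ?A" using right_ideal_all_local_idempotents by blast
  then show ?thesis using s by simp
qed

lemma subset_if_local:
  assumes X: "right_ideal (opp R) X" and Y: "right_ideal R Y \<or> right_ideal (opp R) Y"
    and loc: "\<And>e x. local_idempotent R e \<Longrightarrow> x \<in> X \<Longrightarrow> e \<otimes> x \<in> Y"
  shows "X \<subseteq> Y"
proof -
  interpret opp: ring "opp R" using opp_ring ring_axioms by blast
  have Y': "\<zero> \<in> Y" "\<And>x y. x \<in> Y \<Longrightarrow> y \<in> Y \<Longrightarrow> x \<oplus> y \<in> Y"
    using Y right_idealD(2,3) opp.right_idealD(2,3) by auto
  have X': "\<And>x. x \<in> X \<Longrightarrow> x \<in> carrier R" "\<And>x r. x \<in> X \<Longrightarrow> r \<in> carrier R \<Longrightarrow> r \<otimes> x \<in> X"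
    using opp.right_idealD(1,4)[OF X] by auto
  let ?A = "{y \<in> carrier R. \<forall>x\<in>X. y \<otimes> x \<in> Y}"
  have "right_ideal R ?A" by (rule right_idealI) (use X' Y' in \<open>auto simp: l_distr m_assoc\<close>)
  moreover have "e \<in> ?A" if "local_idempotent R e" for e
    using loc[OF that] local_idempotentD(2)[OF that] by simp
  ultimately have "\<one> \<in> ?A" using right_ideal_all_local_idempotents by blast
  then show ?thesis using X'(1) by auto
qed

text \<open>An idempotent \<open>g \<in> exR\<close> gives the nonzero idempotent \<open>g e\<close> of \<open>eRe\<close>, which must be \<open>e\<close>.\<close>

lemma local_right_inverse:
  assumes e: "local_idempotent R e" and x: "x \<in> carrier R" "e \<otimes> x \<notin> J"
  obtains r where "r \<in> carrier R" "e \<otimes> x \<otimes> r = e"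
proof -
  note e' = local_idempotentD[OF e]
  have exc: "e \<otimes> x \<in> carrier R" using e' x by simp
  obtain g where g: "idempotent_elem R g" "g \<in> (e \<otimes> x) <# carrier R"
    "\<And>y. y \<in> (e \<otimes> x) <# carrier R \<Longrightarrow> y \<ominus> g \<otimes> y \<in> J"
    using right_ideal_idempotent[OF right_ideal_principal[OF exc]] by blast
  note g' = idempotentD[OF g(1)]
  obtain r where r: "r \<in> carrier R" "g = e \<otimes> x \<otimes> r" using g(2) by (auto simp: mem_principal)
  have gJ: "g \<notin> J"
    using jacobson_minus_mult_cancel[OF exc _ g(3)[OF principal_self[OF exc]]] x(2) by blast
  have eg: "e \<otimes> g = g" unfolding r(2) using e'(1) x(1) r(1) by (simp add: m_assoc idempotentD)
  have ge_g: "g \<otimes> e \<otimes> g = g" using eg g' e' by (simp add: m_assoc)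
  have "g \<otimes> e \<otimes> (g \<otimes> e) = (g \<otimes> e \<otimes> g) \<otimes> e" using g' e' by (simp add: m_assoc)
  then have "idempotent_elem R (g \<otimes> e)" using g' e' by (simp add: idempotent_elem_def ge_g)
  moreover have "e \<otimes> (g \<otimes> e) = g \<otimes> e" "(g \<otimes> e) \<otimes> e = g \<otimes> e"
    using eg g' e' by (simp_all add: m_assoc[symmetric]) (simp add: m_assoc)
  moreover have "g \<otimes> e \<noteq> \<zero>" using ge_g g' gJ jacobson_zero by auto
  ultimately have "g \<otimes> e = e" using local_idempotent_corner[OF e] by blast
  then have "e \<otimes> x \<otimes> (r \<otimes> e) = e" using r e' x by (simp add: m_assoc)
  moreover have "r \<otimes> e \<in> carrier R" using r(1) e'(2) by simp
  ultimately show ?thesis by (intro that)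
qed

text \<open>Let \<open>g = x e z\<close> be a nonzero idempotent of \<open>xeR\<close>. Then \<open>p = e z x e\<close> is not in \<open>J\<close>, so \<open>p q = e\<close>
  for some \<open>q \<in> eRe\<close>, and the nonzero idempotent \<open>q p\<close> of \<open>eRe\<close> is \<open>e\<close> as well.\<close>

lemma local_left_inverse:
  assumes e: "local_idempotent R e" and x: "x \<in> carrier R" "x \<otimes> e \<notin> J"
  obtains t where "t \<in> carrier R" "t \<otimes> (x \<otimes> e) = e"
proof -
  note e' = local_idempotentD[OF e]
  have xec: "x \<otimes> e \<in> carrier R" using e' x by simp
  obtain g where g: "idempotent_elem R g" "g \<in> (x \<otimes> e) <# carrier R"
    "\<And>y. y \<in> (x \<otimes> e) <# carrier R \<Longrightarrow> y \<ominus> g \<otimes> y \<in> J"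
    using right_ideal_idempotent[OF right_ideal_principal[OF xec]] by blast
  note g' = idempotentD[OF g(1)]
  obtain z where z: "z \<in> carrier R" "g = x \<otimes> e \<otimes> z" using g(2) by (auto simp: mem_principal)
  have gJ: "g \<notin> J"
    using jacobson_minus_mult_cancel[OF xec _ g(3)[OF principal_self[OF xec]]] x(2) by blast
  define p where "p = e \<otimes> z \<otimes> x \<otimes> e"
  have pc: "p \<in> carrier R" "e \<otimes> p = p" "p \<otimes> e = p"
    using e' z x by (simp_all add: p_def m_assoc idempotentD[OF e'(1)])
  have "g = x \<otimes> p \<otimes> z" using g'(2) e' z(1) x(1) unfolding z(2) p_def by (simp add: m_assoc)
  then have "e \<otimes> p \<notin> J" using gJ x z pc jacobson_left_mult jacobson_right_mult by auto
  then obtain r where r: "r \<in> carrier R" "p \<otimes> r = e"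
    using local_right_inverse[OF e pc(1)] pc by metis
  define q where "q = e \<otimes> r \<otimes> e"
  have q: "q \<in> carrier R" "e \<otimes> q = q" "q \<otimes> e = q"
    using e' r by (simp_all add: q_def m_assoc idempotentD[OF e'(1)])
  have "p \<otimes> q = (p \<otimes> e) \<otimes> r \<otimes> e" using pc(1) e' r(1) by (simp add: q_def m_assoc)
  then have pq: "p \<otimes> q = e" using pc r e' by simp
  have "(q \<otimes> p) \<otimes> (q \<otimes> p) = q \<otimes> (p \<otimes> q) \<otimes> p" using pc q by (simp add: m_assoc)
  then have "idempotent_elem R (q \<otimes> p)" using pc q pq by (simp add: idempotent_elem_def)
  moreover have "e \<otimes> (q \<otimes> p) = q \<otimes> p" using pc q e' by (simp add: m_assoc[symmetric])
  moreover have "(q \<otimes> p) \<otimes> e = q \<otimes> p" using pc q e' by (simp add: m_assoc)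
  moreover have "q \<otimes> p \<noteq> \<zero>"
  proof
    assume "q \<otimes> p = \<zero>"
    then have "p \<otimes> (q \<otimes> p) \<otimes> q = \<zero>" using pc q by simp
    moreover have "p \<otimes> (q \<otimes> p) \<otimes> q = (p \<otimes> q) \<otimes> (p \<otimes> q)" using pc q by (simp add: m_assoc)
    ultimately show False using pq e' jacobson_zero by simp
  qed
  ultimately have "q \<otimes> p = e" using local_idempotent_corner[OF e] by blast
  then have "(q \<otimes> e \<otimes> z) \<otimes> (x \<otimes> e) = e" using q(1) e' z(1) x(1) by (simp add: p_def m_assoc)
  moreover have "q \<otimes> e \<otimes> z \<in> carrier R" using q(1) e'(2) z(1) by simp
  ultimately show ?thesis by (intro that)
qed

text \<open>The ring \<open>R/J\<close> is semiprime: an idempotent \<open>g = z r\<close> equals \<open>z r z r\<close>.\<close>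

lemma jacobson_semiprime:
  assumes z: "z \<in> carrier R" and zRz: "\<And>r. r \<in> carrier R \<Longrightarrow> z \<otimes> r \<otimes> z \<in> J"
  shows "z \<in> J"
proof -
  obtain g where g: "idempotent_elem R g" "g \<in> z <# carrier R"
    "\<And>y. y \<in> z <# carrier R \<Longrightarrow> y \<ominus> g \<otimes> y \<in> J"
    using right_ideal_idempotent[OF right_ideal_principal[OF z]] by blast
  obtain r where r: "r \<in> carrier R" "g = z \<otimes> r" using g(2) by (auto simp: mem_principal)
  have "g = z \<otimes> r \<otimes> z \<otimes> r" using idempotentD(2)[OF g(1)] z r by (simp add: m_assoc)
  then have "g \<in> J" using zRz[OF r(1)] r(1) jacobson_right_mult by metis
  then show ?thesis
    using jacobson_minus_mult_cancel[OF z _ g(3)[OF principal_self[OF z]]] by blast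
qed

end

section \<open>Extending homomorphisms from semisimple right ideals\<close>

locale ss_injective_setting = semiperfect_ring +
  assumes ss_injective: "right_ss_injective R"
    and S_r_essential: "essential_in R (S_r R) (carrier R)"
begin

abbreviation "S \<equiv> S_r R"

text \<open>Left ideals of \<open>R\<close> are right ideals of the opposite ring, so every lemma on right ideals of a
  ring has a left-sided version with the prefix \<open>opp\<close>. The rewrites state it in terms of \<open>R\<close>.\<close>

sublocale opp: ring "opp R"
  rewrites "carrier (opp R) = carrier R" and "\<zero>\<^bsub>opp R\<^esub> = \<zero>" and "\<one>\<^bsub>opp R\<^esub> = \<one>"
    and "x \<oplus>\<^bsub>opp R\<^esub> y = x \<oplus> y" and "x \<otimes>\<^bsub>opp R\<^esub> y = y \<otimes> x" and "opp (opp R) = R"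
    and "A <+>\<^bsub>opp R\<^esub> B = A <+> B"
    and "r_ann (opp R) A = l_ann R A" and "l_ann (opp R) A = r_ann R A"
    and "a <#\<^bsub>opp R\<^esub> A = A #> a" and "A #>\<^bsub>opp R\<^esub> a = a <# A"
  by (simp_all add: opp_ring ring_axioms opp_l_coset opp_r_coset)

lemma S_carrier: "s \<in> S \<Longrightarrow> s \<in> carrier R" using right_ideal_S_r right_idealD(1) by blast

lemma S_meets:
  assumes "right_ideal R C" "C \<noteq> {\<zero>}"
  obtains x where "x \<in> C" "x \<in> S" "x \<noteq> \<zero>"
proof -
  have "S \<inter> C \<noteq> {\<zero>}"
    using S_r_essential assms right_ideal_subset[OF assms(1)] unfolding essential_in_def by blast
  moreover have "\<zero> \<in> S \<inter> C"
    using right_idealD(2)[OF right_ideal_S_r] right_idealD(2)[OF assms(1)] by blast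
  ultimately show ?thesis using that by blast
qed

text \<open>With an idempotent \<open>g \<in> K\<close> that generates \<open>K\<close> modulo \<open>J\<close>, \<open>K\<close> is the direct sum of \<open>gR\<close>
  and of \<open>{x \<in> K. g x = \<zero>} \<subseteq> J\<close>. On \<open>gR\<close> a homomorphism \<open>f\<close> is multiplication by \<open>f g\<close>; on the
  other part, which is small, it is a multiplication by ss-injectivity.\<close>

lemma semisimple_hom_left_mult:
  assumes K: "right_ideal R K" "K \<subseteq> S" and f: "f \<in> right_hom R K"
  obtains c where "c \<in> carrier R" "\<And>x. x \<in> K \<Longrightarrow> f x = c \<otimes> x"
proof -
  note Kc = right_idealD(1)[OF K(1)]
  have f': "\<And>x. x \<in> K \<Longrightarrow> f x \<in> carrier R" "\<And>x y. x \<in> K \<Longrightarrow> y \<in> K \<Longrightarrow> f (x \<oplus> y) = f x \<oplus> f y"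
    "\<And>x r. x \<in> K \<Longrightarrow> r \<in> carrier R \<Longrightarrow> f (x \<otimes> r) = f x \<otimes> r" using f by (auto simp: right_hom_def)
  obtain g where g: "idempotent_elem R g" "g \<in> K" "\<And>x. x \<in> K \<Longrightarrow> x \<ominus> g \<otimes> x \<in> J"
    using right_ideal_idempotent[OF K(1)] by blast
  note g' = idempotentD[OF g(1)]
  let ?N = "{x \<in> K. g \<otimes> x = \<zero>}"
  have N: "right_ideal R ?N"
  proof (rule right_idealI)
    fix x r assume "x \<in> ?N" "r \<in> carrier R"
    then show "x \<otimes> r \<in> ?N"
      using Kc[of x] right_idealD(4)[OF K(1)] g' by (simp add: m_assoc[symmetric])
  next
    fix x y assume "x \<in> ?N" "y \<in> ?N"
    then show "x \<oplus> y \<in> ?N"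
      using Kc[of x] Kc[of y] right_idealD(3)[OF K(1)] g' by (simp add: r_distr)
  qed (use Kc g' right_idealD(2)[OF K(1)] in auto)
  have "?N \<subseteq> J"
  proof
    fix x assume "x \<in> ?N"
    then show "x \<in> J" using g(3)[of x] Kc[of x] by (simp add: a_minus_def)
  qed
  moreover have "semisimple_right_ideal R ?N" using N K by (auto simp: semisimple_iff)
  ultimately have "homs_extend R ?N"
    using ss_injective small_if_subset_jacobson[OF N] unfolding right_ss_injective_def by blast
  moreover have "f \<in> right_hom R ?N" using f' by (auto simp: right_hom_def)
  ultimately obtain h where h: "h \<in> right_hom R (carrier R)" "\<And>x. x \<in> ?N \<Longrightarrow> h x = f x"
    unfolding homs_extend_def by blast
  define c where "c = h \<one>"
  have c: "c \<in> carrier R" "\<And>x. x \<in> carrier R \<Longrightarrow> h x = c \<otimes> x"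
    unfolding c_def by (fact right_hom_carrier[OF h(1)])+
  have fg: "f g \<in> carrier R" using f' g by blast
  have "f x = (f g \<oplus> c \<otimes> (\<one> \<ominus> g)) \<otimes> x" if x: "x \<in> K" for x
  proof -
    have xc: "x \<in> carrier R" using x Kc by blast
    have gx: "g \<otimes> x \<in> K" using right_idealD(4)[OF K(1) g(2) xc] .
    have d: "x \<ominus> g \<otimes> x \<in> K" using right_idealD(6)[OF K(1) x gx] .
    have "g \<otimes> (x \<ominus> g \<otimes> x) = g \<otimes> x \<ominus> g \<otimes> (g \<otimes> x)" using g'(1) xc by algebra
    then have "x \<ominus> g \<otimes> x \<in> ?N" using d g' xc by (simp add: minus_self)
    then have fd: "f (x \<ominus> g \<otimes> x) = c \<otimes> (x \<ominus> g \<otimes> x)" using h(2) c(2) Kc d by metis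
    have "x = g \<otimes> x \<oplus> (x \<ominus> g \<otimes> x)" using g'(1) xc by algebra
    then have "f x = f (g \<otimes> x) \<oplus> f (x \<ominus> g \<otimes> x)" using f'(2)[OF gx d] by simp
    also have "\<dots> = f g \<otimes> x \<oplus> c \<otimes> (x \<ominus> g \<otimes> x)" using f'(3)[OF g(2) xc] fd by simp
    also have "\<dots> = (f g \<oplus> c \<otimes> (\<one> \<ominus> g)) \<otimes> x"
      using fg c(1) g'(1) xc by (simp add: l_distr m_assoc mult_one_minus(1))
    finally show ?thesis .
  qed
  then show ?thesis using that[of "f g \<oplus> c \<otimes> (\<one> \<ominus> g)"] fg c(1) g'(1) by simp
qed

text \<open>The projection of \<open>A \<oplus> B\<close> onto \<open>A\<close> is a homomorphism into \<open>R\<close>.\<close>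

lemma semisimple_projection:
  assumes A: "right_ideal R A" "A \<subseteq> S" and B: "right_ideal R B" "B \<subseteq> S" and AB: "A \<inter> B = {\<zero>}"
  obtains c where "c \<in> carrier R" "\<And>a. a \<in> A \<Longrightarrow> c \<otimes> a = a" "\<And>b. b \<in> B \<Longrightarrow> c \<otimes> b = \<zero>"
proof -
  note Ac = right_idealD(1)[OF A(1)] and Bc = right_idealD(1)[OF B(1)]
  define G where "G u v \<longleftrightarrow> v \<in> A \<and> (\<exists>b\<in>B. u = v \<oplus> b)" for u v
  obtain f where f: "right_ideal R {u. \<exists>v. G u v}" "f \<in> right_hom R {u. \<exists>v. G u v}"
    "\<And>u v. G u v \<Longrightarrow> f u = v"
  proof (rule right_hom_of_relation[of G])
    fix u v u' v' assume "G u v" "G u' v'"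
    then obtain b b' where *: "v \<in> A" "v' \<in> A" "b \<in> B" "b' \<in> B" "u = v \<oplus> b" "u' = v' \<oplus> b'"
      by (auto simp: G_def)
    moreover have "(v \<oplus> b) \<oplus> (v' \<oplus> b') = (v \<oplus> v') \<oplus> (b \<oplus> b')" using * Ac Bc by (simp add: a_ac)
    ultimately show "G (u \<oplus> u') (v \<oplus> v')"
      unfolding G_def using right_idealD(3)[OF A(1)] right_idealD(3)[OF B(1)] by blast
  next
    fix u v r assume "G u v" and r: "r \<in> carrier R"
    then obtain b where *: "v \<in> A" "b \<in> B" "u = v \<oplus> b" by (auto simp: G_def)
    then have "u \<otimes> r = v \<otimes> r \<oplus> b \<otimes> r" using Ac Bc r by (simp add: l_distr)
    then show "G (u \<otimes> r) (v \<otimes> r)"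
      unfolding G_def using * r right_idealD(4)[OF A(1)] right_idealD(4)[OF B(1)] by blast
  next
    fix v
    have "v = \<zero>" if "v \<in> A" "b \<in> B" "\<zero> = v \<oplus> b" for b
    proof -
      have "v = (v \<oplus> b) \<oplus> (\<ominus> b)" using Ac[OF that(1)] Bc[OF that(2)] by algebra
      then have "v = \<ominus> b" using Bc[OF that(2)] unfolding that(3)[symmetric] by simp
      then show ?thesis using AB that(1) right_idealD(5)[OF B(1) that(2)] by blast
    qed
    moreover have "\<zero> \<in> A" "\<zero> \<in> B" "\<zero> = \<zero> \<oplus> \<zero>" using right_idealD(2) A B by auto
    ultimately show "G \<zero> v \<longleftrightarrow> v = \<zero>" unfolding G_def by blast
  qed (use Ac Bc in \<open>auto simp: G_def\<close>)
  have "{u. \<exists>v. G u v} = A <+> B" unfolding G_def by (auto simp: set_eq_iff mem_set_add)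
  then have "right_ideal R (A <+> B)" "f \<in> right_hom R (A <+> B)" "A <+> B \<subseteq> S"
    using f(1,2) set_add_least[OF right_ideal_S_r A(2) B(2)] by simp_all
  then obtain c where c: "c \<in> carrier R" "\<And>x. x \<in> A <+> B \<Longrightarrow> f x = c \<otimes> x"
    using semisimple_hom_left_mult by blast
  have cab: "c \<otimes> (a \<oplus> b) = a" if "a \<in> A" "b \<in> B" for a b
  proof -
    have "a \<oplus> b \<in> A <+> B" "G (a \<oplus> b) a" using that unfolding mem_set_add G_def by blast+
    then show ?thesis using c(2) f(3) by metis
  qed
  have "c \<otimes> a = a" if "a \<in> A" for a
    using cab[OF that right_idealD(2)[OF B(1)]] Ac[OF that] by simp
  moreover have "c \<otimes> b = \<zero>" if "b \<in> B" for b
    using cab[OF right_idealD(2)[OF A(1)] that] Bc[OF that] by simp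
  ultimately show ?thesis using that c(1) by blast
qed

lemma mininjective: "right_mininjective R" unfolding right_mininjective_def homs_extend_def
proof (intro allI impI ballI)
  fix I f assume I: "simple_right_ideal R I" and f: "f \<in> right_hom R I"
  obtain c where c: "c \<in> carrier R" "\<And>x. x \<in> I \<Longrightarrow> f x = c \<otimes> x"
    using semisimple_hom_left_mult[OF _ simple_subset_S_r[OF I] f] I
    by (auto simp: simple_right_ideal_def)
  then have "(\<lambda>x. c \<otimes> x) \<in> right_hom R (carrier R)" by (auto simp: right_hom_def r_distr m_assoc)
  then show "\<exists>g\<in>right_hom R (carrier R). \<forall>x\<in>I. g x = f x"
    using c by (intro bexI[of _ "\<lambda>x. c \<otimes> x"]) auto
qed

lemma jacobson_mult_S: "j \<in> J \<Longrightarrow> s \<in> S \<Longrightarrow> j \<otimes> s = \<zero>"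
  using jacobson_mult_S_l mininjective_S_r_subset_S_l[OF mininjective] by blast

lemma S_mult_jacobson: "s \<in> S \<Longrightarrow> j \<in> J \<Longrightarrow> s \<otimes> j = \<zero>" by (rule S_r_mult_jacobson)

text \<open>An element outside \<open>J\<close> that kills \<open>S\<close> would have a nonzero idempotent multiple \<open>e\<close> killing \<open>S\<close>,
  but \<open>e\<close> fixes the nonzero right ideal \<open>S \<inter> eR\<close>.\<close>

lemma l_ann_S: "l_ann R S = J"
proof
  show "J \<subseteq> l_ann R S" using jacobson_mult_S jacobson_carrier by (auto simp: l_ann_def)
  show "l_ann R S \<subseteq> J"
  proof
    fix x assume "x \<in> l_ann R S"
    then have x: "x \<in> carrier R" "\<And>s. s \<in> S \<Longrightarrow> x \<otimes> s = \<zero>" by (auto simp: l_ann_def)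
    show "x \<in> J"
    proof (rule ccontr)
      assume "x \<notin> J"
      then have "\<not> x <# carrier R \<subseteq> J" using principal_self[OF x(1)] by blast
      then obtain e where e: "local_idempotent R e" "e \<in> x <# carrier R"
        using right_ideal_contains_local_idempotent[OF right_ideal_principal[OF x(1)]] by blast
      note e' = local_idempotentD[OF e(1)]
      obtain r where r: "r \<in> carrier R" "e = x \<otimes> r" using e(2) by (auto simp: mem_principal)
      have "e <# carrier R \<noteq> {\<zero>}"
        using principal_self[OF e'(2)] local_idempotent_nonzero[OF e(1)] by blast
      then obtain y where y: "y \<in> e <# carrier R" "y \<in> S" "y \<noteq> \<zero>"
        using S_meets right_ideal_principal[OF e'(2)] by blast
      have "e \<otimes> y = y" using y(1) idempotentD(3)[OF e'(1)] by (auto simp: mem_principal)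
      moreover have "e \<otimes> y = x \<otimes> (r \<otimes> y)"
        unfolding r(2) using x r S_carrier[OF y(2)] by (simp add: m_assoc)
      moreover have "x \<otimes> (r \<otimes> y) = \<zero>" using x(2) S_r_mult_left[OF r(1) y(2)] by blast
      ultimately show False using y(3) by simp
    qed
  qed
qed

section \<open>Annihilators of semisimple right ideals\<close>

text \<open>Let \<open>c\<close> be the projection of \<open>S\<close> onto \<open>I\<close> along a complement. Since \<open>c\<^sup>2 - c\<close> kills \<open>S\<close>, it lies
  in \<open>J\<close>; an idempotent \<open>e\<close> lifting \<open>c\<close> acts on \<open>S\<close> like \<open>c\<close>, because \<open>J\<close> kills \<open>S\<close>.\<close>

lemma semisimple_idempotent:
  assumes I: "right_ideal R I" "I \<subseteq> S"
  obtains e where "idempotent_elem R e" "I = (e <# carrier R) \<inter> S" "\<And>x. x \<in> I \<Longrightarrow> e \<otimes> x = x"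
proof -
  obtain I' where I': "right_ideal R I'" "I' \<subseteq> S" "I \<inter> I' = {\<zero>}" "I <+> I' = S"
    using semisimple_complement[OF semisimple_S_r I] by blast
  note Ic = right_idealD(1)[OF I(1)] and I'c = right_idealD(1)[OF I'(1)]
  obtain c where c: "c \<in> carrier R" "\<And>x. x \<in> I \<Longrightarrow> c \<otimes> x = x" "\<And>x. x \<in> I' \<Longrightarrow> c \<otimes> x = \<zero>"
    using semisimple_projection[OF I I'(1,2,3)] by blast
  have cS: "c \<otimes> s \<in> I" "c \<otimes> (c \<otimes> s) = c \<otimes> s" if s: "s \<in> S" for s
  proof -
    obtain i i' where i: "i \<in> I" "i' \<in> I'" "s = i \<oplus> i'"
      using s unfolding I'(4)[symmetric] mem_set_add by blast
    then have "c \<otimes> s = i" using c Ic I'c by (simp add: r_distr)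
    then show "c \<otimes> s \<in> I" "c \<otimes> (c \<otimes> s) = c \<otimes> s" using i c by auto
  qed
  have "(c \<otimes> c \<ominus> c) \<otimes> s = \<zero>" if s: "s \<in> S" for s
  proof -
    have "(c \<otimes> c \<ominus> c) \<otimes> s = c \<otimes> (c \<otimes> s) \<ominus> c \<otimes> s" using c(1) S_carrier[OF s] by algebra
    then show ?thesis using cS[OF s] c(1) S_carrier[OF s] by (simp add: minus_self)
  qed
  then have "c \<otimes> c \<ominus> c \<in> l_ann R S" using c(1) by (simp add: l_ann_def)
  then have "c \<otimes> c \<ominus> c \<in> J" by (simp add: l_ann_S)
  then obtain e where e: "idempotent_elem R e" "e \<ominus> c \<in> J" using idempotent_lift[OF c(1)] by blast
  note e' = idempotentD[OF e(1)]
  have es: "e \<otimes> s = c \<otimes> s" if s: "s \<in> S" for s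
  proof -
    have sc: "s \<in> carrier R" using S_carrier[OF s] .
    have "e \<otimes> s = (e \<ominus> c) \<otimes> s \<oplus> c \<otimes> s" using e'(1) c(1) sc by algebra
    then show ?thesis using jacobson_mult_S[OF e(2) s] c(1) sc by simp
  qed
  have ei: "e \<otimes> x = x" if "x \<in> I" for x using es c(2) that I(2) by auto
  have "I = (e <# carrier R) \<inter> S"
  proof
    show "I \<subseteq> (e <# carrier R) \<inter> S"
    proof
      fix x assume x: "x \<in> I"
      then have "x = e \<otimes> x" "x \<in> carrier R" using ei Ic by auto
      then show "x \<in> (e <# carrier R) \<inter> S" using x I(2) unfolding Int_iff mem_principal by blast
    qed
    show "(e <# carrier R) \<inter> S \<subseteq> I"
    proof
      fix x assume x: "x \<in> (e <# carrier R) \<inter> S"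
      then have "e \<otimes> x = x" using e' by (auto simp: mem_principal)
      then show "x \<in> I" using es[of x] cS(1)[of x] x by simp
    qed
  qed
  then show ?thesis using that e(1) ei by blast
qed

lemma essential_Int_S:
  assumes "right_ideal R N"
  shows "essential_in R (N \<inter> S) N" unfolding essential_in_def
proof (intro conjI allI impI)
  fix C assume C: "right_ideal R C \<and> C \<subseteq> N \<and> C \<noteq> {\<zero>}"
  then obtain x where "x \<in> C" "x \<in> S" "x \<noteq> \<zero>" using S_meets by blast
  then show "N \<inter> S \<inter> C \<noteq> {\<zero>}" using C by blast
qed (use assms right_ideal_S_r right_ideal_Int in auto)

lemma semisimple_essential_in_rl:
  assumes I: "right_ideal R I" "I \<subseteq> S"
  obtains e where "idempotent_elem R e" "essential_in R I (rl_ann R I)"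
    "essential_in R (rl_ann R I) (e <# carrier R)" "essential_in R I (e <# carrier R)"
proof -
  obtain e where e: "idempotent_elem R e" "I = (e <# carrier R) \<inter> S" "\<And>x. x \<in> I \<Longrightarrow> e \<otimes> x = x"
    using semisimple_idempotent[OF I] by blast
  note e' = idempotentD[OF e(1)]
  have Ic: "I \<subseteq> carrier R" using right_ideal_subset[OF I(1)] .
  have eR: "right_ideal R (e <# carrier R)" using right_ideal_principal[OF e'(1)] .
  have rl: "right_ideal R (rl_ann R I)" "I \<subseteq> rl_ann R I"
    using right_ideal_rl_ann rl_ann_superset[OF Ic] by auto
  have rl_sub: "rl_ann R I \<subseteq> e <# carrier R"
  proof
    fix x assume x: "x \<in> rl_ann R I"
    have "(\<one> \<ominus> e) \<otimes> y = \<zero>" if "y \<in> I" for y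
      using e(3)[OF that] e'(1) that Ic by (auto simp: mult_one_minus minus_self)
    then have "\<one> \<ominus> e \<in> l_ann R I" using e'(1) by (simp add: l_ann_def)
    then have "(\<one> \<ominus> e) \<otimes> x = \<zero>" and xc: "x \<in> carrier R" using x by (auto simp: r_ann_def)
    then have "x = e \<otimes> x" using e'(1) by (simp add: mult_one_minus minus_eq_zero_iff)
    then show "x \<in> e <# carrier R" using xc unfolding mem_principal by blast
  qed
  have ess: "essential_in R I (e <# carrier R)" using essential_Int_S[OF eR] e(2) by simp
  moreover have "essential_in R I (rl_ann R I)" "essential_in R (rl_ann R I) (e <# carrier R)"
  proof -
    have I_meets: "I \<inter> C \<noteq> {\<zero>}" if "right_ideal R C" "C \<subseteq> e <# carrier R" "C \<noteq> {\<zero>}" for C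
      using ess that unfolding essential_in_def by blast
    then show "essential_in R I (rl_ann R I)"
      unfolding essential_in_def using I rl rl_sub by (meson order_trans)
    have "rl_ann R I \<inter> C \<noteq> {\<zero>}" if "right_ideal R C" "C \<subseteq> e <# carrier R" "C \<noteq> {\<zero>}" for C
    proof -
      have "\<zero> \<in> I \<inter> C" using right_idealD(2)[OF I(1)] right_idealD(2)[OF that(1)] by blast
      then show ?thesis using I_meets[OF that] rl(2) by blast
    qed
    then show "essential_in R (rl_ann R I) (e <# carrier R)"
      unfolding essential_in_def using rl rl_sub eR by blast
  qed
  ultimately show ?thesis using that e(1) by blast
qed

lemma idempotent_direct_summand:
  assumes e: "idempotent_elem R e"
  shows "right_direct_summand R (e <# carrier R)"
proof -
  note e' = idempotentD[OF e]
  let ?f = "\<one> \<ominus> e"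
  have fc: "?f \<in> carrier R" using e' by simp
  have "x = \<zero>" if x: "x \<in> e <# carrier R" "x \<in> ?f <# carrier R" for x
  proof -
    obtain r s where rs: "r \<in> carrier R" "x = e \<otimes> r" "s \<in> carrier R" "x = ?f \<otimes> s"
      using x by (auto simp: mem_principal)
    have "e \<otimes> x = x" using rs(1,2) e' by simp
    moreover have "e \<otimes> x = e \<otimes> s \<ominus> e \<otimes> (e \<otimes> s)"
      unfolding rs(4) using rs(3) e'(1) by (simp add: mult_one_minus) algebra
    ultimately show ?thesis using rs(3) e' by (simp add: minus_self)
  qed
  then have "(e <# carrier R) \<inter> (?f <# carrier R) = {\<zero>}"
    using right_idealD(2)[OF right_ideal_principal[OF e'(1)]]
      right_idealD(2)[OF right_ideal_principal[OF fc]] by blast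
  moreover have "carrier R = (e <# carrier R) <+> (?f <# carrier R)"
  proof
    show "carrier R \<subseteq> (e <# carrier R) <+> (?f <# carrier R)"
    proof
      fix x assume x: "x \<in> carrier R"
      then have "x = e \<otimes> x \<oplus> ?f \<otimes> x" using e'(1) by (simp add: mult_one_minus) algebra
      moreover have "e \<otimes> x \<in> e <# carrier R" "?f \<otimes> x \<in> ?f <# carrier R"
        using x unfolding mem_principal by blast+
      ultimately show "x \<in> (e <# carrier R) <+> (?f <# carrier R)" unfolding mem_set_add by blast
    qed
    show "(e <# carrier R) <+> (?f <# carrier R) \<subseteq> carrier R"
      using right_ideal_set_add[OF right_ideal_principal[OF e'(1)] right_ideal_principal[OF fc]]
        right_ideal_subset by blast
  qed
  ultimately show ?thesis using right_ideal_principal[OF e'(1)] right_ideal_principal[OF fc]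
    unfolding right_direct_summand_def direct_sum2_def by blast
qed

lemma rl_ann_mult:
  assumes x: "x \<in> rl_ann R K" and c: "c \<in> carrier R"
    and lc: "\<And>y. y \<in> l_ann R K' \<Longrightarrow> y \<otimes> c \<in> l_ann R K"
  shows "c \<otimes> x \<in> rl_ann R K'"
proof -
  have xc: "x \<in> carrier R" using x by (simp add: r_ann_def)
  have "y \<otimes> (c \<otimes> x) = \<zero>" if y: "y \<in> l_ann R K'" for y
  proof -
    have "(y \<otimes> c) \<otimes> x = \<zero>" "y \<in> carrier R" using x lc[OF y] y by (auto simp: r_ann_def l_ann_def)
    then show ?thesis using c xc by (simp add: m_assoc)
  qed
  then show ?thesis using c xc by (simp add: r_ann_def)
qed

text \<open>With a projection \<open>c\<close> that is the identity on \<open>I\<close> and zero on \<open>A\<close>, every element of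
  \<open>rl(I + A)\<close> splits as \<open>x = c x + (\<one> - c) x\<close>.\<close>

lemma rl_ann_direct_sum2:
  assumes I: "right_ideal R I" "I \<subseteq> S" and A: "right_ideal R A" "A \<subseteq> S" and IA: "I \<inter> A = {\<zero>}"
  shows "direct_sum2 R (rl_ann R I) (rl_ann R A) (rl_ann R (I <+> A))"
proof -
  obtain c where c: "c \<in> carrier R" "\<And>x. x \<in> I \<Longrightarrow> c \<otimes> x = x" "\<And>x. x \<in> A \<Longrightarrow> c \<otimes> x = \<zero>"
    using semisimple_projection[OF I A IA] by blast
  note Ic = right_idealD(1)[OF I(1)] and Ac = right_idealD(1)[OF A(1)]
  have cI: "\<one> \<ominus> c \<in> l_ann R I" using c Ic by (auto simp: l_ann_def mult_one_minus minus_self)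
  have cA: "c \<in> l_ann R A" using c by (auto simp: l_ann_def)
  have rl: "right_ideal R (rl_ann R I)" "right_ideal R (rl_ann R A)" "right_ideal R (rl_ann R (I <+> A))"
    by (auto simp: right_ideal_rl_ann)
  have "x = \<zero>" if "x \<in> rl_ann R I" "x \<in> rl_ann R A" for x
  proof -
    have "x \<in> carrier R" "(\<one> \<ominus> c) \<otimes> x = \<zero>" "c \<otimes> x = \<zero>" using that cI cA by (auto simp: r_ann_def)
    then show ?thesis using c(1) by (simp add: mult_one_minus minus_eq_zero_iff)
  qed
  then have "rl_ann R I \<inter> rl_ann R A = {\<zero>}"
    using right_idealD(2)[OF rl(1)] right_idealD(2)[OF rl(2)] by blast
  moreover have "rl_ann R (I <+> A) = rl_ann R I <+> rl_ann R A"
  proof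
    show "rl_ann R I <+> rl_ann R A \<subseteq> rl_ann R (I <+> A)"
      using set_add_least[OF rl(3)] rl_ann_mono set_add_mono[OF I(1) A(1)] by blast
    show "rl_ann R (I <+> A) \<subseteq> rl_ann R I <+> rl_ann R A"
    proof
      fix x assume x: "x \<in> rl_ann R (I <+> A)"
      then have xc: "x \<in> carrier R" by (simp add: r_ann_def)
      have kill: "y \<in> l_ann R (I <+> A)"
        if y: "y \<in> carrier R" "\<And>i. i \<in> I \<Longrightarrow> y \<otimes> i = \<zero>" "\<And>a. a \<in> A \<Longrightarrow> y \<otimes> a = \<zero>" for y
      proof -
        have "y \<otimes> z = \<zero>" if z: "z \<in> I <+> A" for z
        proof -
          obtain i a where "i \<in> I" "a \<in> A" "z = i \<oplus> a" using z unfolding mem_set_add by blast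
          then show ?thesis using y Ic Ac by (simp add: r_distr)
        qed
        then show ?thesis using y(1) by (simp add: l_ann_def)
      qed
      have "c \<otimes> x \<in> rl_ann R I" by (rule rl_ann_mult[OF x c(1)], rule kill)
           (use c Ic Ac in \<open>auto simp: l_ann_def m_assoc\<close>)
      moreover have "(\<one> \<ominus> c) \<otimes> i = \<zero>" if "i \<in> I" for i
        using c that Ic by (simp add: mult_one_minus minus_self)
      moreover have "(\<one> \<ominus> c) \<otimes> a = a" if "a \<in> A" for a
        using c(1) c(3)[OF that] Ac[OF that] by (simp add: mult_one_minus) (simp add: a_minus_def)
      ultimately have "c \<otimes> x \<in> rl_ann R I" "(\<one> \<ominus> c) \<otimes> x \<in> rl_ann R A"
        by (simp, intro rl_ann_mult[OF x] kill)
           (use c(1) Ic Ac in \<open>auto simp: l_ann_def m_assoc\<close>)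
      moreover have "x = c \<otimes> x \<oplus> (\<one> \<ominus> c) \<otimes> x" using c(1) xc by (simp add: mult_one_minus) algebra
      ultimately show "x \<in> rl_ann R I <+> rl_ann R A" unfolding mem_set_add by blast
    qed
  qed
  ultimately show ?thesis by (simp add: direct_sum2_def)
qed

lemma finsum_single:
  assumes "finite F" "j \<in> F" "f j \<in> carrier R" "\<And>i. i \<in> F \<Longrightarrow> i \<noteq> j \<Longrightarrow> f i = \<zero>"
  shows "finsum R f F = f j"
proof -
  have "f i \<in> carrier R" if "i \<in> F" for i using assms(3) assms(4)[OF that] by (cases "i = j") auto
  then have f: "f \<in> F \<rightarrow> carrier R" by blast
  have "finsum R f F = (\<Oplus>i\<in>F. if j = i then f i else \<zero>)"
    by (rule finsum_cong') (use assms in auto)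
  also have "\<dots> = f j" by (rule finsum_singleton[OF assms(2,1) f])
  finally show ?thesis .
qed

text \<open>The coordinates of a direct sum of semisimple right ideals are homomorphisms, so they are
  multiplications by elements \<open>c\<^sub>i\<close>. The sum of the \<open>c\<^sub>i\<close> fixes \<open>T\<close>, hence also \<open>rl(T)\<close>, and
  \<open>x = \<Sum> c\<^sub>i x\<close> decomposes an element of \<open>rl(T)\<close>.\<close>

lemma rl_ann_direct_sum:
  assumes F: "finite F" and A: "\<And>i. i \<in> F \<Longrightarrow> right_ideal R (A i)" "\<And>i. i \<in> F \<Longrightarrow> A i \<subseteq> S"
    and T: "direct_sum R F A T"
  shows "direct_sum R F (\<lambda>i. rl_ann R (A i)) (rl_ann R T)"
proof -
  have Ac: "x \<in> carrier R" if "i \<in> F" "x \<in> A i" for i x using that A(2) S_carrier by blast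
  have T': "T = (\<lambda>f. finsum R f F) ` Pi F A"
    and indep: "\<And>f. f \<in> Pi F A \<Longrightarrow> finsum R f F = \<zero> \<Longrightarrow> \<forall>i\<in>F. f i = \<zero>"
    using T by (auto simp: direct_sum_def)
  have PiA: "f \<in> F \<rightarrow> carrier R" if "f \<in> Pi F A" for f using that Ac by blast
  have single: "(\<lambda>i. if i = j then x else \<zero>) \<in> Pi F A"
    "finsum R (\<lambda>i. if i = j then x else \<zero>) F = x" if "j \<in> F" "x \<in> A j" for j x
    using finsum_single[OF F that(1), of "\<lambda>i. if i = j then x else \<zero>"] that Ac A(1) right_idealD(2)
    by auto
  have "\<exists>c\<in>carrier R. \<forall>f\<in>Pi F A. c \<otimes> finsum R f F = f i" if i: "i \<in> F" for i
  proof -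
    define G where "G u v \<longleftrightarrow> (\<exists>f\<in>Pi F A. u = finsum R f F \<and> v = f i)" for u v
    obtain h where h: "right_ideal R {u. \<exists>v. G u v}" "h \<in> right_hom R {u. \<exists>v. G u v}"
      "\<And>u v. G u v \<Longrightarrow> h u = v"
    proof (rule right_hom_of_relation[of G])
      show "x \<in> carrier R \<and> y \<in> carrier R" if "G x y" for x y
        using that PiA i by (auto simp: G_def)
    next
      fix x y x' y' assume "G x y" "G x' y'"
      then obtain f f' where f: "f \<in> Pi F A" "f' \<in> Pi F A" "x = finsum R f F" "y = f i"
        "x' = finsum R f' F" "y' = f' i" by (auto simp: G_def)
      then have "(\<lambda>j. f j \<oplus> f' j) \<in> Pi F A" "x \<oplus> x' = finsum R (\<lambda>j. f j \<oplus> f' j) F"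
        using A(1) right_idealD(3) finsum_addf[OF PiA PiA, of f f'] by (auto simp: Pi_iff)
      then show "G (x \<oplus> x') (y \<oplus> y')"
        unfolding G_def f(4,6) by (intro bexI[of _ "\<lambda>j. f j \<oplus> f' j"]) auto
    next
      fix x y r assume "G x y" and r: "r \<in> carrier R"
      then obtain f where f: "f \<in> Pi F A" "x = finsum R f F" "y = f i" by (auto simp: G_def)
      then have "(\<lambda>j. f j \<otimes> r) \<in> Pi F A" "x \<otimes> r = finsum R (\<lambda>j. f j \<otimes> r) F"
        using A(1) right_idealD(4) r finsum_ldistr[OF F r PiA, of f] by (auto simp: Pi_iff)
      then show "G (x \<otimes> r) (y \<otimes> r)" unfolding G_def f(3) by (intro bexI[of _ "\<lambda>j. f j \<otimes> r"]) auto
    next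
      have "(\<lambda>j. \<zero>) \<in> Pi F A" using A(1) right_idealD(2) by auto
      then have "G \<zero> \<zero>" unfolding G_def by (intro bexI[of _ "\<lambda>j. \<zero>"]) auto
      then show "G \<zero> v \<longleftrightarrow> v = \<zero>" for v using indep i by (auto simp: G_def)
    qed blast
    have sub: "{u. \<exists>v. G u v} \<subseteq> S"
      using right_ideal_finsum_closed[OF right_ideal_S_r F] A(2) unfolding G_def by blast
    obtain c where c: "c \<in> carrier R" "\<And>u. u \<in> {u. \<exists>v. G u v} \<Longrightarrow> h u = c \<otimes> u"
      by (rule semisimple_hom_left_mult[OF h(1) sub h(2)]) blast
    have "c \<otimes> finsum R f F = f i" if "f \<in> Pi F A" for f
    proof -
      have "G (finsum R f F) (f i)" using that by (auto simp: G_def)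
      then show ?thesis using h(3) c(2) by (metis (mono_tags) mem_Collect_eq)
    qed
    then show ?thesis using c(1) by blast
  qed
  then obtain c where c: "\<And>i. i \<in> F \<Longrightarrow> c i \<in> carrier R"
    and c': "\<And>i f. i \<in> F \<Longrightarrow> f \<in> Pi F A \<Longrightarrow> c i \<otimes> finsum R f F = f i" by metis
  have AT: "A j \<subseteq> T" if "j \<in> F" for j
  proof
    fix x assume x: "x \<in> A j"
    show "x \<in> T" unfolding T'
      by (rule image_eqI[where x = "\<lambda>i. if i = j then x else \<zero>"]) (use single[OF that x] in auto)
  qed
  have cA: "c i \<otimes> x = (if i = j then x else \<zero>)" if "i \<in> F" "j \<in> F" "x \<in> A j" for i j x
    using c'[OF that(1) single(1)[OF that(2,3)]] single(2)[OF that(2,3)] by simp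
  have l_annT: "y \<in> l_ann R T \<longleftrightarrow> y \<in> carrier R \<and> (\<forall>i\<in>F. \<forall>x\<in>A i. y \<otimes> x = \<zero>)" for y
  proof
    assume "y \<in> l_ann R T"
    then show "y \<in> carrier R \<and> (\<forall>i\<in>F. \<forall>x\<in>A i. y \<otimes> x = \<zero>)" using AT by (auto simp: l_ann_def)
  next
    assume y: "y \<in> carrier R \<and> (\<forall>i\<in>F. \<forall>x\<in>A i. y \<otimes> x = \<zero>)"
    have "y \<otimes> finsum R f F = \<zero>" if f: "f \<in> Pi F A" for f
    proof -
      have "y \<otimes> finsum R f F = (\<Oplus>i\<in>F. y \<otimes> f i)" using y F PiA[OF f] by (intro finsum_rdistr) auto
      also have "\<dots> = (\<Oplus>i\<in>F. \<zero>)" using y f by (intro finsum_cong') auto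
      finally show ?thesis by simp
    qed
    then show "y \<in> l_ann R T" using y unfolding T' l_ann_def by blast
  qed
  have c_rl: "c i \<otimes> x = (if i = j then x else \<zero>)" if ij: "i \<in> F" "j \<in> F" and x: "x \<in> rl_ann R (A j)"
    for i j x
  proof (cases "i = j")
    case True
    then have "\<one> \<ominus> c i \<in> l_ann R (A j)"
      using c[OF ij(1)] cA[OF ij] Ac[OF ij(2)] by (simp add: l_ann_def mult_one_minus minus_self)
    then have "(\<one> \<ominus> c i) \<otimes> x = \<zero>" "x \<in> carrier R" using x by (auto simp: r_ann_def)
    then show ?thesis using True c[OF ij(1)] by (simp add: mult_one_minus minus_eq_zero_iff)
  next
    case False
    then have "c i \<in> l_ann R (A j)" using c[OF ij(1)] cA[OF ij] by (simp add: l_ann_def)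
    then show ?thesis using False x by (simp add: r_ann_def)
  qed
  show ?thesis unfolding direct_sum_def
  proof (intro conjI ballI impI)
    fix f j
    assume f: "f \<in> Pi F (\<lambda>i. rl_ann R (A i))" and sum: "finsum R f F = \<zero>" and j: "j \<in> F"
    have fc: "f \<in> F \<rightarrow> carrier R" using f by (auto simp: r_ann_def)
    have other: "c j \<otimes> f i = \<zero>" if "i \<in> F" "i \<noteq> j" for i
      using c_rl[OF j that(1), of "f i"] f that by auto
    have "\<zero> = c j \<otimes> finsum R f F" using sum c j by simp
    also have "\<dots> = (\<Oplus>i\<in>F. c j \<otimes> f i)" using c j fc F by (intro finsum_rdistr) auto
    also have "\<dots> = c j \<otimes> f j" using other c[OF j] j fc by (intro finsum_single F) auto
    also have "\<dots> = f j" using c_rl[OF j j, of "f j"] f j by auto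
    finally show "f j = \<zero>" by simp
  next
    show "rl_ann R T = (\<lambda>f. finsum R f F) ` Pi F (\<lambda>i. rl_ann R (A i))"
    proof (intro equalityI subsetI)
      fix x assume x: "x \<in> rl_ann R T"
      then have xc: "x \<in> carrier R" and kill: "\<And>y. y \<in> l_ann R T \<Longrightarrow> y \<otimes> x = \<zero>"
        by (auto simp: r_ann_def)
      let ?f = "\<lambda>i. c i \<otimes> x"
      have "?f i \<in> rl_ann R (A i)" if i: "i \<in> F" for i
      proof (rule rl_ann_mult[OF x])
        fix y assume y: "y \<in> l_ann R (A i)"
        then have "(y \<otimes> c i) \<otimes> z = \<zero>" if "j \<in> F" "z \<in> A j" for j z
          using c[OF i] cA[OF i that] Ac[OF that] that by (auto simp: m_assoc l_ann_def)
        then show "y \<otimes> c i \<in> l_ann R T" using l_annT y c[OF i] by (auto simp: l_ann_def)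
      qed (use c i in blast)
      then have "?f \<in> Pi F (\<lambda>i. rl_ann R (A i))" by blast
      moreover have "finsum R ?f F = x"
      proof -
        let ?s = "finsum R c F"
        have cF: "c \<in> F \<rightarrow> carrier R" and sc: "?s \<in> carrier R" using c by auto
        have "?s \<otimes> z = z" if z: "j \<in> F" "z \<in> A j" for j z
        proof -
          have "?s \<otimes> z = (\<Oplus>i\<in>F. c i \<otimes> z)" using F Ac[OF z] cF by (intro finsum_ldistr)
          also have "\<dots> = c j \<otimes> z" using c cA[OF _ z] Ac[OF z] z(1) by (intro finsum_single F) auto
          finally show ?thesis using cA[OF z(1) z] by simp
        qed
        then have "\<one> \<ominus> ?s \<in> l_ann R T" using l_annT sc Ac by (simp add: mult_one_minus minus_self)
        then have "(\<one> \<ominus> ?s) \<otimes> x = \<zero>" by (rule kill)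
        then have "x = ?s \<otimes> x" using sc xc by (simp add: mult_one_minus minus_eq_zero_iff)
        also have "\<dots> = finsum R ?f F" using F xc cF by (intro finsum_ldistr)
        finally show ?thesis by simp
      qed
      ultimately show "x \<in> (\<lambda>f. finsum R f F) ` Pi F (\<lambda>i. rl_ann R (A i))"
        by (metis (no_types, lifting) image_eqI)
    next
      fix x assume "x \<in> (\<lambda>f. finsum R f F) ` Pi F (\<lambda>i. rl_ann R (A i))"
      then obtain f where f: "f \<in> Pi F (\<lambda>i. rl_ann R (A i))" "x = finsum R f F" by blast
      have "f i \<in> rl_ann R T" if i: "i \<in> F" for i using rl_ann_mono[OF AT[OF i]] f i by blast
      then show "x \<in> rl_ann R T"
        unfolding f(2) by (intro right_ideal_finsum_closed[OF right_ideal_rl_ann F])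
    qed
  qed
qed

end

context ss_injective_setting
begin

section \<open>Local idempotents and the two socles\<close>

text \<open>If \<open>eR \<inter> S\<close> were \<open>T \<oplus> D\<close> with \<open>T\<close> simple and \<open>D \<noteq> 0\<close>, let \<open>c\<close> be the identity on \<open>T\<close> and
  zero on \<open>D\<close>. Then \<open>e c e\<close> is neither in \<open>J\<close>, as it fixes \<open>T\<close>, nor left invertible in \<open>eRe\<close>, as it
  kills \<open>D\<close>.\<close>

lemma local_socle_simple:
  assumes e: "local_idempotent R e"
  shows "simple_right_ideal R ((e <# carrier R) \<inter> S)"
proof -
  note e' = local_idempotentD[OF e]
  let ?N = "(e <# carrier R) \<inter> S"
  have eR: "right_ideal R (e <# carrier R)" using right_ideal_principal[OF e'(2)] .
  have N: "right_ideal R ?N" using eR right_ideal_S_r right_ideal_Int by blast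
  have eN: "e \<otimes> x = x" "x \<in> carrier R" if "x \<in> ?N" for x
    using that idempotentD(3)[OF e'(1)] S_carrier by (auto simp: mem_principal)
  have "e <# carrier R \<noteq> {\<zero>}"
    using principal_self[OF e'(2)] local_idempotent_nonzero[OF e] by blast
  then obtain x where "x \<in> ?N" "x \<noteq> \<zero>" using S_meets[OF eR] by blast
  then have N0: "?N \<noteq> {\<zero>}" by blast
  obtain T where T: "simple_right_ideal R T" "T \<subseteq> ?N"
    by (rule S_r_contains_simple[OF N _ N0]) auto
  have T': "right_ideal R T" "T \<noteq> {\<zero>}" using T(1) by (auto simp: simple_right_ideal_def)
  have NS: "semisimple_right_ideal R ?N" using N by (simp add: semisimple_iff)
  obtain D where D: "right_ideal R D" "D \<subseteq> ?N" "T \<inter> D = {\<zero>}" "T <+> D = ?N"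
    using semisimple_complement[OF NS T'(1) T(2)] by blast
  obtain c where c: "c \<in> carrier R" "\<And>x. x \<in> T \<Longrightarrow> c \<otimes> x = x" "\<And>x. x \<in> D \<Longrightarrow> c \<otimes> x = \<zero>"
    using semisimple_projection[OF T'(1) _ D(1) _ D(3)] T(2) D(2) by blast
  obtain t where t: "t \<in> T" "t \<noteq> \<zero>" using T' right_idealD(2)[OF T'(1)] by blast
  have tN: "e \<otimes> t = t" "t \<in> carrier R" using eN t T(2) by blast+
  have "e \<otimes> c \<otimes> e \<otimes> t = t" using c(1) c(2)[OF t(1)] tN e'(2) by (simp add: m_assoc)
  then have "e \<otimes> c \<otimes> e \<notin> J" using jacobson_fixes_zero[of "e \<otimes> c \<otimes> e" t] tN t by auto
  then obtain q where q: "q \<in> carrier R" "q \<otimes> (e \<otimes> c \<otimes> e) = e"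
    using local_left_inverse[OF e, of "e \<otimes> c"] c(1) e'(2) by auto
  have "d = \<zero>" if d: "d \<in> D" for d
  proof -
    have dN: "e \<otimes> d = d" "d \<in> carrier R" using eN d D(2) by blast+
    have "q \<otimes> (e \<otimes> c \<otimes> e) \<otimes> d = q \<otimes> (e \<otimes> (c \<otimes> (e \<otimes> d)))"
      using q(1) c(1) e'(2) dN(2) by (simp add: m_assoc)
    then show ?thesis unfolding q(2) dN(1) c(3)[OF d] using q(1) e'(2) by simp
  qed
  then have "D = {\<zero>}" using right_idealD(2)[OF D(1)] by blast
  then have "?N \<subseteq> T"
    using set_add_least[OF T'(1), of T "{\<zero>}"] D(4) right_idealD(2)[OF T'(1)] by simp
  then have "?N = T" using T(2) by blast
  then show ?thesis using T(1) by simp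
qed

text \<open>As \<open>\<one>\<close> is a finite sum of elements \<open>e r\<close> with \<open>e\<close> local, \<open>S\<close> is contained in a finite sum of
  simple right ideals \<open>eR \<inter> S\<close>.\<close>

lemma S_finitely_generated: "\<exists>A. finite A \<and> A \<subseteq> S \<and> S \<subseteq> right_span R A"
proof -
  have span: "right_ideal R (right_span R A)" if "A \<subseteq> S" for A
    using that S_carrier right_ideal_span by blast
  have "\<exists>A. finite A \<and> A \<subseteq> S \<and> (\<forall>s\<in>S. \<one> \<otimes> s \<in> right_span R A)"
  proof (rule one_local_induct)
    show "\<exists>A. finite A \<and> A \<subseteq> S \<and> (\<forall>s\<in>S. \<zero> \<otimes> s \<in> right_span R A)"
      using right_idealD(2)[OF span[of "{}"]] S_carrier by (auto intro!: exI[of _ "{}"])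
  next
    fix y e r assume "\<exists>A. finite A \<and> A \<subseteq> S \<and> (\<forall>s\<in>S. y \<otimes> s \<in> right_span R A)"
    then obtain A where A: "finite A" "A \<subseteq> S" "\<forall>s\<in>S. y \<otimes> s \<in> right_span R A" by blast
    assume yr: "y \<in> carrier R" "r \<in> carrier R" and e: "local_idempotent R e"
    let ?T = "(e <# carrier R) \<inter> S"
    have T: "simple_right_ideal R ?T" using local_socle_simple[OF e] .
    then obtain t where t: "t \<in> ?T" "t \<noteq> \<zero>"
      using right_idealD(2)[of ?T] unfolding simple_right_ideal_def by blast
    have ins: "insert t A \<subseteq> S" using A(2) t by blast
    have "(y \<oplus> e \<otimes> r) \<otimes> s \<in> right_span R (insert t A)" if s: "s \<in> S" for s
    proof -
      have rs: "r \<otimes> s \<in> S" using S_r_mult_left[OF yr(2) s] .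
      have ec: "e \<in> carrier R" using local_idempotentD(2)[OF e] .
      have "e \<otimes> (r \<otimes> s) \<in> ?T"
        using S_r_mult_left[OF ec rs] S_carrier[OF rs] unfolding Int_iff mem_principal by blast
      then have "e \<otimes> (r \<otimes> s) \<in> t <# carrier R" using simple_principal[OF T t] by simp
      moreover have "t <# carrier R \<subseteq> right_span R (insert t A)"
        using principal_subset[OF span[OF ins]] span_superset[of "insert t A"] by blast
      moreover have "y \<otimes> s \<in> right_span R (insert t A)"
        using A(3) s span_mono[of A "insert t A"] by blast
      ultimately show ?thesis
        using right_idealD(3)[OF span[OF ins]] yr ec S_carrier[OF s] by (auto simp: l_distr m_assoc)
    qed
    then show "\<exists>A. finite A \<and> A \<subseteq> S \<and> (\<forall>s\<in>S. (y \<oplus> e \<otimes> r) \<otimes> s \<in> right_span R A)"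
      using A(1) ins by (intro exI[of _ "insert t A"]) simp
  qed
  then show ?thesis using S_carrier by (auto simp: subset_iff)
qed

text \<open>Let \<open>e\<close> be local and \<open>s \<in> S\<close> with \<open>s e \<noteq> \<zero>\<close>. As \<open>S J = 0\<close> and every \<open>e x \<notin> J\<close> has
  \<open>e x z = e\<close> for some \<open>z\<close>, the right ideal \<open>seR\<close> is simple and \<open>r(s e) = {x. e x \<in> J}\<close> depends
  on \<open>e\<close> only.\<close>

lemma local_transitive:
  assumes e: "local_idempotent R e" and s: "s \<in> S" "s \<otimes> e \<noteq> \<zero>" and t: "t \<in> S"
  obtains c where "c \<in> carrier R" "t \<otimes> e = c \<otimes> (s \<otimes> e)"
proof -
  note e' = local_idempotentD[OF e]
  have sc: "s \<in> carrier R" "t \<in> carrier R" using s t S_carrier by auto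
  have returns: "\<exists>z\<in>carrier R. s \<otimes> e \<otimes> x \<otimes> z = s \<otimes> e" if x: "x \<in> carrier R" "e \<otimes> x \<notin> J" for x
  proof -
    obtain z where z: "z \<in> carrier R" "e \<otimes> x \<otimes> z = e" using local_right_inverse[OF e x] by blast
    have "s \<otimes> e \<otimes> x \<otimes> z = s \<otimes> (e \<otimes> x \<otimes> z)" using sc e'(2) x(1) z(1) by (simp add: m_assoc)
    then show ?thesis using z by auto
  qed
  have kill: "u \<otimes> e \<otimes> x = \<zero>" if "u \<in> S" "x \<in> carrier R" "e \<otimes> x \<in> J" for u x
    using S_mult_jacobson[OF that(1,3)] that S_carrier e'(2) by (simp add: m_assoc)
  have simple: "simple_right_ideal R ((s \<otimes> e) <# carrier R)"
    using returns kill[OF s(1)] sc e'(2) s(2) by (intro simple_principalI) auto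
  have ann: "t \<otimes> e \<otimes> x = \<zero>" if x: "x \<in> carrier R" "s \<otimes> e \<otimes> x = \<zero>" for x
  proof (cases "e \<otimes> x \<in> J")
    case False
    then obtain z where "z \<in> carrier R" "s \<otimes> e \<otimes> x \<otimes> z = s \<otimes> e" using returns x(1) by blast
    then show ?thesis using x s(2) by simp
  qed (use kill[OF t] x in blast)
  have "s \<otimes> e \<in> carrier R" "t \<otimes> e \<in> carrier R" using sc e' by auto
  then show ?thesis
    using mininjective_factor[OF mininjective simple, of "t \<otimes> e"] ann that by blast
qed

text \<open>For local \<open>e\<close> and \<open>x \<in> r(J)\<close>, the left ideal \<open>Rex\<close> is a quotient of the simple left module
  \<open>Re/Je\<close>. Hence \<open>e r(J) \<subseteq> S\<^sub>l\<close>.\<close>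

lemma r_ann_jacobson: "r_ann R J = S_l R"
proof
  show "S_l R \<subseteq> r_ann R J"
    using jacobson_mult_S_l opp.right_idealD(1)[OF opp.right_ideal_S_r] by (auto simp: r_ann_def)
  have rc: "x \<in> carrier R" "\<And>j. j \<in> J \<Longrightarrow> j \<otimes> x = \<zero>" if "x \<in> r_ann R J" for x
    using that by (auto simp: r_ann_def)
  show "r_ann R J \<subseteq> S_l R"
  proof (rule subset_if_local)
    show "right_ideal (opp R) (r_ann R J)"
    proof (rule opp.right_idealI)
      fix x r assume x: "x \<in> r_ann R J" and r: "r \<in> carrier R"
      have "j \<otimes> (r \<otimes> x) = \<zero>" if j: "j \<in> J" for j
        using rc(2)[OF x jacobson_right_mult[OF j r]] rc(1)[OF x] r jacobson_carrier[OF j]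
        by (simp add: m_assoc)
      then show "r \<otimes> x \<in> r_ann R J" using rc(1)[OF x] r by (simp add: r_ann_def)
    qed (auto simp: r_ann_def r_distr jacobson_carrier)
    show "right_ideal R (S_l R) \<or> right_ideal (opp R) (S_l R)" using opp.right_ideal_S_r by blast
    fix e x assume e: "local_idempotent R e" and x: "x \<in> r_ann R J"
    note e' = local_idempotentD[OF e]
    show "e \<otimes> x \<in> S_l R"
    proof (cases "e \<otimes> x = \<zero>")
      case True
      then show ?thesis using opp.right_idealD(2)[OF opp.right_ideal_S_r] by simp
    next
      case False
      have xc: "x \<in> carrier R" using rc(1)[OF x] .
      have "\<exists>t\<in>carrier R. t \<otimes> (r \<otimes> (e \<otimes> x)) = e \<otimes> x"
        if r: "r \<in> carrier R" "r \<otimes> (e \<otimes> x) \<noteq> \<zero>" for r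
      proof -
        have "r \<otimes> e \<notin> J" using rc(2)[OF x, of "r \<otimes> e"] r e'(2) xc by (auto simp: m_assoc)
        then obtain t where t: "t \<in> carrier R" "t \<otimes> (r \<otimes> e) = e"
          using local_left_inverse[OF e r(1)] by blast
        then have "t \<otimes> (r \<otimes> (e \<otimes> x)) = e \<otimes> x" using r(1) e'(2) xc by (metis m_assoc m_closed)
        then show ?thesis using t by blast
      qed
      then have "simple_right_ideal (opp R) (carrier R #> (e \<otimes> x))"
        using False e'(2) xc by (intro opp.simple_principalI) auto
      then show ?thesis
        using opp.simple_subset_S_r opp.principal_self[of "e \<otimes> x"] e'(2) xc by auto
    qed
  qed
qed

lemma rl_ann_S: "rl_ann R S = S_l R" by (simp add: l_ann_S r_ann_jacobson)

section \<open>Every simple right module embeds in \<open>R\<close>\<close>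

text \<open>The identity \<open>r(S) = J\<close> says that every local idempotent \<open>e\<close> has \<open>S e \<noteq> 0\<close>. Since \<open>l(S) = J\<close>, the
  ring \<open>R/J\<close> acts faithfully on \<open>S\<close> from the left, with one homogeneous component for each simple
  block of \<open>R/J\<close>; the claim is that the right action sees all the blocks as well. Instead of
  counting blocks, consider \<open>\<Phi>(X) = r(S \<inter> r(X))\<close> on the two-sided ideals \<open>X \<supseteq> J\<close>. It is monotone,
  it is injective since \<open>X\<close> is recovered from \<open>S \<inter> r(X)\<close> by left annihilators and \<open>S \<inter> r(X)\<close> from
  \<open>\<Phi>(X)\<close> by left annihilators in \<open>S\<close>, and \<open>\<Phi>(J) = r(S)\<close>. If \<open>J \<noteq> \<Phi>(J)\<close>, then the powers
  \<open>\<Phi>\<^sup>n(J)\<close> would increase strictly, against the ascending chain condition in \<open>R/J\<close>.\<close>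

definition ideal_above_J :: "'a set \<Rightarrow> bool" where
  "ideal_above_J X \<longleftrightarrow> right_ideal R X \<and> right_ideal (opp R) X \<and> J \<subseteq> X"

definition \<Phi> :: "'a set \<Rightarrow> 'a set" where
  "\<Phi> X = r_ann R (S \<inter> r_ann R X)"

text \<open>If \<open>g \<in> X\<close> generates \<open>X\<close> modulo \<open>J\<close> as a right ideal, then semiprimeness of \<open>R/J\<close> gives
  \<open>x - x g \<in> J\<close> for \<open>x \<in> X\<close> as well. So \<open>(\<one> - g) S\<close> is killed by \<open>X\<close>, and \<open>y\<close> killing it satisfies
  \<open>y (\<one> - g) \<in> l(S) = J\<close>.\<close>

lemma l_ann_r_ann_in_S:
  assumes X: "ideal_above_J X"
  shows "l_ann R (S \<inter> r_ann R X) = X"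
proof
  have X': "right_ideal R X" "right_ideal (opp R) X" "J \<subseteq> X"
    using X by (auto simp: ideal_above_J_def)
  note Xc = right_idealD(1)[OF X'(1)]
  show "X \<subseteq> l_ann R (S \<inter> r_ann R X)" using Xc by (auto simp: l_ann_def r_ann_def)
  show "l_ann R (S \<inter> r_ann R X) \<subseteq> X"
  proof
    fix y assume y: "y \<in> l_ann R (S \<inter> r_ann R X)"
    then have yc: "y \<in> carrier R" by (simp add: l_ann_def)
    obtain g where g: "idempotent_elem R g" "g \<in> X" "\<And>x. x \<in> X \<Longrightarrow> x \<ominus> g \<otimes> x \<in> J"
      using right_ideal_idempotent[OF X'(1)] by blast
    note g' = idempotentD[OF g(1)]
    have zJ: "x \<otimes> (\<one> \<ominus> g) \<in> J" if x: "x \<in> X" for x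
    proof (rule jacobson_semiprime)
      let ?z = "x \<otimes> (\<one> \<ominus> g)"
      show zc: "?z \<in> carrier R" using Xc[OF x] g' by simp
      fix r assume r: "r \<in> carrier R"
      have "?z \<in> X" using right_idealD(4)[OF X'(1) x] g' by simp
      then have rz: "r \<otimes> ?z \<in> X" using opp.right_idealD(4)[OF X'(2)] r by blast
      have "?z \<otimes> g = x \<otimes> (g \<ominus> g \<otimes> g)"
        using Xc[OF x] g'(1) by (simp add: m_assoc mult_one_minus(1))
      then have zg: "?z \<otimes> g = \<zero>" using Xc[OF x] g' by (simp add: minus_self)
      have "?z \<otimes> r \<otimes> ?z = ?z \<otimes> (r \<otimes> ?z \<ominus> g \<otimes> (r \<otimes> ?z)) \<oplus> (?z \<otimes> g) \<otimes> (r \<otimes> ?z)"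
      proof -
        have gen: "a \<otimes> r \<otimes> a = a \<otimes> (r \<otimes> a \<ominus> g \<otimes> (r \<otimes> a)) \<oplus> (a \<otimes> g) \<otimes> (r \<otimes> a)"
          if "a \<in> carrier R" for a using that r g'(1) by algebra
        show ?thesis by (rule gen[OF zc])
      qed
      also have "\<dots> = ?z \<otimes> (r \<otimes> ?z \<ominus> g \<otimes> (r \<otimes> ?z))" unfolding zg using zc r g'(1) by simp
      finally show "?z \<otimes> r \<otimes> ?z \<in> J" using jacobson_left_mult[OF zc g(3)[OF rz]] by simp
    qed
    have "(\<one> \<ominus> g) \<otimes> s \<in> S \<inter> r_ann R X" if s: "s \<in> S" for s
    proof -
      have "x \<otimes> ((\<one> \<ominus> g) \<otimes> s) = \<zero>" if x: "x \<in> X" for x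
        using jacobson_mult_S[OF zJ[OF x] s] Xc[OF x] g'(1) S_carrier[OF s] by (simp add: m_assoc)
      then show ?thesis
        using S_r_mult_left[OF _ s, of "\<one> \<ominus> g"] g'(1) S_carrier[OF s] by (simp add: r_ann_def)
    qed
    then have "y \<otimes> ((\<one> \<ominus> g) \<otimes> s) = \<zero>" if "s \<in> S" for s using y that by (simp add: l_ann_def)
    then have "(y \<otimes> (\<one> \<ominus> g)) \<otimes> s = \<zero>" if "s \<in> S" for s
      using yc g'(1) S_carrier that by (simp add: m_assoc)
    then have "y \<otimes> (\<one> \<ominus> g) \<in> l_ann R S" using yc g'(1) by (simp add: l_ann_def)
    then have "y \<otimes> (\<one> \<ominus> g) \<in> X" using l_ann_S X'(3) by blast
    moreover have "y \<otimes> g \<in> X" using opp.right_idealD(4)[OF X'(2) g(2) yc] .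
    ultimately have "y \<otimes> (\<one> \<ominus> g) \<oplus> y \<otimes> g \<in> X" using right_idealD(3)[OF X'(1)] by blast
    moreover have "y \<otimes> (\<one> \<ominus> g) \<oplus> y \<otimes> g = y" using yc g'(1) by (simp add: mult_one_minus) algebra
    ultimately show "y \<in> X" by simp
  qed
qed

text \<open>Let \<open>s r(T) = 0\<close>. For each local \<open>e\<close> with \<open>s e \<noteq> \<zero>\<close> some \<open>t \<in> T\<close> has \<open>t e \<noteq> \<zero>\<close>, and then
  \<open>s e \<in> R t e \<subseteq> T\<close>.\<close>

lemma l_ann_in_S_r_ann:
  assumes T: "right_ideal R T" "right_ideal (opp R) T" "T \<subseteq> S"
  shows "S \<inter> l_ann R (r_ann R T) = T"
proof
  note Tc = right_idealD(1)[OF T(1)]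
  show "T \<subseteq> S \<inter> l_ann R (r_ann R T)" using T(3) Tc by (auto simp: l_ann_def r_ann_def)
  show "S \<inter> l_ann R (r_ann R T) \<subseteq> T"
  proof
    fix s assume s: "s \<in> S \<inter> l_ann R (r_ann R T)"
    then have sc: "s \<in> carrier R" and kill: "\<And>x. x \<in> r_ann R T \<Longrightarrow> s \<otimes> x = \<zero>"
      by (auto simp: l_ann_def)
    show "s \<in> T"
    proof (rule mem_if_local[OF T(1) sc])
      fix e assume e: "local_idempotent R e"
      show "s \<otimes> e \<in> T"
      proof (cases "s \<otimes> e = \<zero>")
        case True
        then show ?thesis using right_idealD(2)[OF T(1)] by simp
      next
        case False
        then have "e \<notin> r_ann R T" using kill by blast
        then obtain t where t: "t \<in> T" "t \<otimes> e \<noteq> \<zero>"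
          using local_idempotentD(2)[OF e] by (auto simp: r_ann_def)
        then obtain c where c: "c \<in> carrier R" "s \<otimes> e = c \<otimes> (t \<otimes> e)"
          using local_transitive[OF e _ t(2), of s] T(3) s by blast
        have "t \<otimes> e \<in> T" using right_idealD(4)[OF T(1) t(1) local_idempotentD(2)[OF e]] .
        then show ?thesis using c opp.right_idealD(4)[OF T(2)] by simp
      qed
    qed
  qed
qed

lemma S_Int_r_ann_bimodule:
  assumes X: "ideal_above_J X"
  shows "right_ideal R (S \<inter> r_ann R X)" "right_ideal (opp R) (S \<inter> r_ann R X)"
proof -
  have X': "right_ideal R X" "right_ideal (opp R) X" using X by (auto simp: ideal_above_J_def)
  note Xc = right_idealD(1)[OF X'(1)]
  show "right_ideal R (S \<inter> r_ann R X)"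
    using right_ideal_Int[OF right_ideal_S_r right_ideal_r_ann] right_ideal_subset[OF X'(1)] by blast
  have left: "r \<otimes> s \<in> r_ann R X" if "r \<in> carrier R" "s \<in> r_ann R X" for r s
  proof -
    have sc: "s \<in> carrier R" using that by (simp add: r_ann_def)
    have "x \<otimes> (r \<otimes> s) = \<zero>" if x: "x \<in> X" for x
    proof -
      have "(x \<otimes> r) \<otimes> s = \<zero>"
        using right_idealD(4)[OF X'(1) x] that \<open>r \<in> carrier R\<close> \<open>s \<in> r_ann R X\<close> by (simp add: r_ann_def)
      then show ?thesis using Xc[OF x] \<open>r \<in> carrier R\<close> sc by (simp add: m_assoc)
    qed
    then show ?thesis using that sc by (simp add: r_ann_def)
  qed
  show "right_ideal (opp R) (S \<inter> r_ann R X)"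
  proof (rule opp.right_idealI)
    fix x r assume "x \<in> S \<inter> r_ann R X" "r \<in> carrier R"
    then show "r \<otimes> x \<in> S \<inter> r_ann R X" using left S_r_mult_left by blast
  next
    fix x y assume "x \<in> S \<inter> r_ann R X" "y \<in> S \<inter> r_ann R X"
    then show "x \<oplus> y \<in> S \<inter> r_ann R X"
      using right_idealD(3)[OF right_ideal_S_r] Xc by (auto simp: r_ann_def r_distr)
  qed (use S_carrier right_idealD(2)[OF right_ideal_S_r] Xc in \<open>auto simp: r_ann_def\<close>)
qed

lemma \<Phi>_ideal:
  assumes X: "ideal_above_J X"
  shows "ideal_above_J (\<Phi> X)"
proof -
  let ?T = "S \<inter> r_ann R X"
  note T = S_Int_r_ann_bimodule[OF X]
  have Tc: "?T \<subseteq> carrier R" using right_ideal_subset[OF T(1)] .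
  have "right_ideal (opp R) (\<Phi> X)"
  proof (rule opp.right_idealI)
    fix x r assume x: "x \<in> \<Phi> X" and r: "r \<in> carrier R"
    have xc: "x \<in> carrier R" using x by (simp add: \<Phi>_def r_ann_def)
    have "t \<otimes> (r \<otimes> x) = \<zero>" if t: "t \<in> ?T" for t
    proof -
      have "t \<otimes> r \<in> ?T" using right_idealD(4)[OF T(1) t r] .
      then have "(t \<otimes> r) \<otimes> x = \<zero>" using x unfolding \<Phi>_def r_ann_def[of R "?T"] by blast
      then show ?thesis using xc r t Tc by (auto simp: m_assoc)
    qed
    then show "r \<otimes> x \<in> \<Phi> X" using xc r unfolding \<Phi>_def r_ann_def[of R "?T"] by simp
  qed (use right_ideal_r_ann[OF Tc] right_ideal_subset right_idealD(2,3) in \<open>auto simp: \<Phi>_def\<close>)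
  moreover have "J \<subseteq> \<Phi> X"
    using S_mult_jacobson jacobson_carrier unfolding \<Phi>_def r_ann_def[of R "?T"] by blast
  moreover have "right_ideal R (\<Phi> X)" using right_ideal_r_ann[OF Tc] by (simp add: \<Phi>_def)
  ultimately show ?thesis by (simp add: ideal_above_J_def)
qed

lemma \<Phi>_inj:
  assumes X: "ideal_above_J X" and Y: "ideal_above_J Y" and eq: "\<Phi> X = \<Phi> Y"
  shows "X = Y"
proof -
  have "S \<inter> r_ann R X = S \<inter> l_ann R (\<Phi> X)"
    using l_ann_in_S_r_ann[OF S_Int_r_ann_bimodule[OF X]] by (simp add: \<Phi>_def)
  also have "\<dots> = S \<inter> l_ann R (\<Phi> Y)" using eq by simp
  also have "\<dots> = S \<inter> r_ann R Y"
    using l_ann_in_S_r_ann[OF S_Int_r_ann_bimodule[OF Y]] by (simp add: \<Phi>_def)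
  finally have "l_ann R (S \<inter> r_ann R X) = l_ann R (S \<inter> r_ann R Y)" by (rule arg_cong)
  then show ?thesis unfolding l_ann_r_ann_in_S[OF X] l_ann_r_ann_in_S[OF Y] .
qed

lemma \<Phi>_mono: "X \<subseteq> Y \<Longrightarrow> \<Phi> X \<subseteq> \<Phi> Y" unfolding \<Phi>_def r_ann_def by blast

lemma r_ann_S: "r_ann R S = J"
proof -
  define X where "X n = (\<Phi> ^^ n) J" for n
  have X0: "X 0 = J" and XSuc: "\<And>n. X (Suc n) = \<Phi> (X n)" by (simp_all add: X_def)
  have J: "ideal_above_J J" unfolding ideal_above_J_def
    by (auto intro!: right_ideal_jacobson opp.right_idealI
        simp: jacobson_carrier jacobson_zero jacobson_add jacobson_left_mult)
  have Xi: "ideal_above_J (X n)" for n by (induction n) (use J \<Phi>_ideal in \<open>auto simp: X0 XSuc\<close>)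
  then have Xr: "\<And>n. right_ideal R (X n)" "\<And>n. J \<subseteq> X n" by (auto simp: ideal_above_J_def)
  have step: "X n \<subseteq> X (Suc n)" for n
  proof (induction n)
    case 0
    then show ?case using Xr(2)[of 1] by (simp add: X0)
  next
    case (Suc n)
    then show ?case using \<Phi>_mono by (simp add: XSuc)
  qed
  then have mono: "m \<le> n \<Longrightarrow> X m \<subseteq> X n" for m n using lift_Suc_mono_le[of X] by blast
  have U: "right_ideal R (\<Union>(range X))"
  proof (rule right_ideal_Union_chain)
    fix I K assume "I \<in> range X" "K \<in> range X"
    then show "I \<subseteq> K \<or> K \<subseteq> I" using mono by (metis imageE linear)
  qed (use Xr in auto)
  obtain g where "idempotent_elem R g"
    and g: "g \<in> \<Union>(range X)" "\<And>x. x \<in> \<Union>(range X) \<Longrightarrow> x \<ominus> g \<otimes> x \<in> J"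
    by (rule right_ideal_idempotent[OF U]) blast
  then obtain n where n: "g \<in> X n" by blast
  have "X (Suc n) \<subseteq> X n"
  proof
    fix x assume x: "x \<in> X (Suc n)"
    then have xc: "x \<in> carrier R" using Xr right_idealD(1) by blast
    have gc: "g \<in> carrier R" using n Xr right_idealD(1) by blast
    have "x \<ominus> g \<otimes> x \<in> X n" using g(2)[of x] x Xr(2)[of n] by blast
    moreover have "g \<otimes> x \<in> X n" using right_idealD(4)[OF Xr(1) n xc] .
    ultimately have "(x \<ominus> g \<otimes> x) \<oplus> g \<otimes> x \<in> X n" using right_idealD(3)[OF Xr(1)] by blast
    moreover have "(x \<ominus> g \<otimes> x) \<oplus> g \<otimes> x = x" using xc gc by algebra
    ultimately show "x \<in> X n" by simp
  qed
  then have "X (Suc n) = X n" using step by blast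
  (* Injectivity of \<Phi> carries the equality down to the start of the chain. *)
  then have "X (Suc 0) = X 0"
  proof (induction n)
    case (Suc n)
    then show ?case using \<Phi>_inj[OF Xi Xi] XSuc by metis
  qed simp
  moreover have "S \<inter> r_ann R J = S" using jacobson_mult_S S_carrier by (auto simp: r_ann_def)
  ultimately show ?thesis by (simp add: X0 XSuc \<Phi>_def)
qed

lemma local_S_nonzero:
  assumes e: "local_idempotent R e"
  obtains s where "s \<in> S" "s \<otimes> e \<noteq> \<zero>"
proof -
  have "e \<notin> r_ann R S" using local_idempotentD(4)[OF e] by (simp add: r_ann_S)
  then show ?thesis using that local_idempotentD(2)[OF e] by (auto simp: r_ann_def)
qed

lemma local_Se_simple:
  assumes e: "local_idempotent R e"
  shows "simple_right_ideal (opp R) (S #> e)"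
proof -
  note e' = local_idempotentD[OF e]
  obtain s where s: "s \<in> S" "s \<otimes> e \<noteq> \<zero>" using local_S_nonzero[OF e] by blast
  have "right_ideal (opp R) (S #> e)"
  proof (rule opp.right_idealI)
    show "S #> e \<subseteq> carrier R" using S_carrier e'(2) by (auto simp: mem_principal_left)
    show "\<zero> \<in> S #> e"
      using right_idealD(2)[OF right_ideal_S_r] e'(2) by (auto simp: mem_principal_left intro!: bexI[of _ \<zero>])
  next
    fix x y assume "x \<in> S #> e" "y \<in> S #> e"
    then obtain a b where ab: "a \<in> S" "b \<in> S" "x = a \<otimes> e" "y = b \<otimes> e"
      unfolding mem_principal_left by blast
    then have "x \<oplus> y = (a \<oplus> b) \<otimes> e" "a \<oplus> b \<in> S"
      using S_carrier e'(2) right_idealD(3)[OF right_ideal_S_r] by (auto simp: l_distr)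
    then show "x \<oplus> y \<in> S #> e" unfolding mem_principal_left by blast
  next
    fix x r assume "x \<in> S #> e" and r: "r \<in> carrier R"
    then obtain a where a: "a \<in> S" "x = a \<otimes> e" unfolding mem_principal_left by blast
    then have "r \<otimes> x = (r \<otimes> a) \<otimes> e" "r \<otimes> a \<in> S"
      using S_carrier e'(2) S_r_mult_left r by (auto simp: m_assoc)
    then show "r \<otimes> x \<in> S #> e" unfolding mem_principal_left by blast
  qed
  then show ?thesis
  proof (rule opp.simpleI)
    show "s \<otimes> e \<in> S #> e" using s(1) unfolding mem_principal_left by blast
    show "s \<otimes> e \<noteq> \<zero>" by (rule s(2))
  next
    fix y assume "y \<in> S #> e" and "y \<noteq> \<zero>"
    then obtain t where t: "t \<in> S" "y = t \<otimes> e" "t \<otimes> e \<noteq> \<zero>" unfolding mem_principal_left by blast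
    then show "\<exists>r\<in>carrier R. s \<otimes> e = r \<otimes> y" using local_transitive[OF e t(1,3) s(1)] by blast
  next
    fix y assume "y \<in> S #> e"
    then obtain t where t: "t \<in> S" "y = t \<otimes> e" unfolding mem_principal_left by blast
    then show "\<exists>r\<in>carrier R. y = r \<otimes> (s \<otimes> e)" using local_transitive[OF e s t(1)] by blast
  qed
qed

end

context ss_injective_setting
begin

section \<open>The equivalent conditions\<close>

lemma simple_generator:
  assumes "simple_right_ideal R T" "x \<in> T" "x \<noteq> \<zero>"
  shows "x \<in> carrier R" "T = x <# carrier R"
  using assms simple_principal[OF assms] right_idealD(1)[of T x] by (auto simp: simple_right_ideal_def)

lemma left_simple_generator:
  assumes "simple_right_ideal (opp R) T" "x \<in> T" "x \<noteq> \<zero>"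
  shows "x \<in> carrier R" "T = carrier R #> x"
  using assms opp.simple_principal[OF assms] opp.right_idealD(1)[of T x]
  by (auto simp: simple_right_ideal_def)

lemma S_subset_S_l: "S \<subseteq> S_l R" using mininjective_S_r_subset_S_l[OF mininjective] .

lemma S_l_carrier: "x \<in> S_l R \<Longrightarrow> x \<in> carrier R" using opp.right_idealD(1)[OF opp.right_ideal_S_r] .

text \<open>If \<open>rl(S) = S\<close>, then \<open>rl(K)\<close> is semisimple with \<open>K\<close> as an essential submodule, so a
  complement of \<open>K\<close> in it vanishes.\<close>

lemma semisimple_eq_rl_ann:
  assumes D: "S = S_l R" and K: "right_ideal R K" "K \<subseteq> S"
  shows "K = rl_ann R K"
proof -
  obtain e where ess: "essential_in R K (rl_ann R K)"
    using semisimple_essential_in_rl[OF K] by blast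
  have rl: "right_ideal R (rl_ann R K)" "rl_ann R K \<subseteq> S"
    using right_ideal_rl_ann rl_ann_mono[OF K(2)] rl_ann_S D by auto
  have sub: "K \<subseteq> rl_ann R K" using ess by (simp add: essential_in_def)
  have "semisimple_right_ideal R (rl_ann R K)" using rl by (simp add: semisimple_iff)
  then obtain B where B: "right_ideal R B" "B \<subseteq> rl_ann R K" "K \<inter> B = {\<zero>}" "K <+> B = rl_ann R K"
    using semisimple_complement[OF _ K(1) sub] by blast
  have "B = {\<zero>}" using ess B(1-3) unfolding essential_in_def by blast
  then have "rl_ann R K \<subseteq> K"
    using set_add_least[OF K(1), of K "{\<zero>}"] B(4) right_idealD(2)[OF K(1)] by simp
  then show ?thesis using sub by blast
qed

text \<open>For local \<open>e\<close>, if \<open>y\<close> kills the simple right ideal \<open>eS\<close>, then \<open>y e \<in> l(S) = J\<close> kills \<open>S\<^sub>l\<close>.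
  Hence \<open>e S\<^sub>l \<subseteq> rl(eS) = eS \<subseteq> S\<close>.\<close>

lemma S_eq_S_l_if_simple:
  assumes "\<And>k. k \<in> carrier R \<Longrightarrow> simple_right_ideal R (k <# carrier R) \<Longrightarrow>
    k <# carrier R = rl_ann R (k <# carrier R)"
  shows "S = S_l R"
proof
  show "S \<subseteq> S_l R" by (rule S_subset_S_l)
  show "S_l R \<subseteq> S"
  proof (rule subset_if_local[OF opp.right_ideal_S_r])
    show "right_ideal R S \<or> right_ideal (opp R) S" using right_ideal_S_r by blast
    fix e x assume e: "local_idempotent R e" and x: "x \<in> S_l R"
    note e' = local_idempotentD[OF e]
    let ?T = "(e <# carrier R) \<inter> S"
    have T: "simple_right_ideal R ?T" using local_socle_simple[OF e] .
    then have T': "right_ideal R ?T" "?T \<noteq> {\<zero>}" by (auto simp: simple_right_ideal_def)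
    then obtain k where k: "k \<in> ?T" "k \<noteq> \<zero>" using right_idealD(2)[OF T'(1)] by blast
    have rlT: "?T = rl_ann R ?T" using assms[OF simple_generator(1)[OF T k]] T
      unfolding simple_generator(2)[OF T k, symmetric] .
    have "y \<otimes> (e \<otimes> x) = \<zero>" if y: "y \<in> l_ann R ?T" for y
    proof -
      have yc: "y \<in> carrier R" using y by (simp add: l_ann_def)
      have "(y \<otimes> e) \<otimes> s = \<zero>" if s: "s \<in> S" for s
      proof -
        have "e \<otimes> s \<in> ?T"
          using S_r_mult_left[OF e'(2) s] S_carrier[OF s] unfolding Int_iff mem_principal by blast
        then show ?thesis using y yc e'(2) S_carrier[OF s] by (simp add: l_ann_def m_assoc)
      qed
      then have "y \<otimes> e \<in> l_ann R S" using yc e'(2) by (simp add: l_ann_def)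
      then have "(y \<otimes> e) \<otimes> x = \<zero>" using jacobson_mult_S_l[OF _ x] by (simp add: l_ann_S)
      then show ?thesis using yc e'(2) S_l_carrier[OF x] by (simp add: m_assoc)
    qed
    then have "e \<otimes> x \<in> rl_ann R ?T" using e'(2) S_l_carrier[OF x] by (simp add: r_ann_def)
    then show "e \<otimes> x \<in> S" using rlT by blast
  qed
qed

text \<open>A homomorphism of left modules \<open>Rk \<rightarrow> R\<close>, \<open>k \<mapsto> m\<close>, forces \<open>m \<in> rl(kR) = kR\<close>.\<close>

lemma left_mininjective_if:
  assumes D: "S = S_l R"
  shows "left_mininjective R" unfolding right_mininjective_def homs_extend_def
proof (intro allI impI ballI)
  fix I f assume I: "simple_right_ideal (opp R) I" and f: "f \<in> right_hom (opp R) I"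
  have I': "right_ideal (opp R) I" "I \<noteq> {\<zero>}" using I by (auto simp: simple_right_ideal_def)
  then obtain k where k: "k \<in> I" "k \<noteq> \<zero>" using opp.right_idealD(2)[OF I'(1)] by blast
  note gen = left_simple_generator[OF I k]
  have fm: "f (r \<otimes> k) = r \<otimes> f k" if "r \<in> carrier R" for r
    using f k(1) that by (auto simp: right_hom_def)
  have m: "f k \<in> carrier R" using f k(1) by (auto simp: right_hom_def)
  have f0: "f \<zero> = \<zero>" using fm[of \<zero>] gen(1) m by simp
  have kS: "k \<in> S" using opp.simple_subset_S_r[OF I] k(1) D by blast
  have "y \<otimes> f k = \<zero>" if "y \<in> l_ann R {k}" for y using that fm[of y] f0 by (simp add: l_ann_def)
  then have "f k \<in> rl_ann R (k <# carrier R)"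
    unfolding l_ann_principal[OF gen(1)] using m by (simp add: r_ann_def)
  also have "rl_ann R (k <# carrier R) = k <# carrier R"
    by (rule semisimple_eq_rl_ann[OF D right_ideal_principal[OF gen(1)]
          principal_subset[OF right_ideal_S_r kS], symmetric])
  finally obtain c where c: "c \<in> carrier R" "f k = k \<otimes> c" unfolding mem_principal by blast
  have "(\<lambda>x. x \<otimes> c) \<in> right_hom (opp R) (carrier (opp R))"
    using c by (auto simp: right_hom_def l_distr m_assoc)
  moreover have "x \<otimes> c = f x" if x: "x \<in> I" for x
  proof -
    obtain r where r: "r \<in> carrier R" "x = r \<otimes> k"
      using x unfolding gen(2) mem_principal_left by blast
    have "f x = r \<otimes> (k \<otimes> c)" unfolding r(2) fm[OF r(1)] c(2) ..
    then show ?thesis unfolding r(2) using m_assoc[OF r(1) gen(1) c(1)] by simp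
  qed
  ultimately show "\<exists>g\<in>right_hom (opp R) (carrier (opp R)). \<forall>x\<in>I. g x = f x"
    by (intro bexI[of _ "\<lambda>x. x \<otimes> c"]) auto
qed

lemma left_mininjective_imp:
  assumes "left_mininjective R"
  shows "S = S_l R" using opp.mininjective_S_r_subset_S_l[OF assms] S_subset_S_l by simp

lemma left_socle_principal:
  assumes e: "idempotent_elem R e"
  shows "left_socle R (carrier R #> e) = S_l R #> e"
proof -
  note e' = idempotentD[OF e]
  have Re: "right_ideal (opp R) (carrier R #> e)" using opp.right_ideal_principal[OF e'(1)] .
  have "(carrier R #> e) \<inter> S_l R = S_l R #> e"
  proof (intro equalityI subsetI)
    fix x assume x: "x \<in> (carrier R #> e) \<inter> S_l R"
    then have "x = x \<otimes> e" using e' by (auto simp: mem_principal_left)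
    then show "x \<in> S_l R #> e" using x unfolding mem_principal_left by blast
  next
    fix x assume "x \<in> S_l R #> e"
    then obtain s where s: "s \<in> S_l R" "x = s \<otimes> e" unfolding mem_principal_left by blast
    then show "x \<in> (carrier R #> e) \<inter> S_l R"
      using opp.S_r_mult_left[OF e'(1) s(1)] S_l_carrier[OF s(1)] unfolding Int_iff mem_principal_left
      by blast
  qed
  then show ?thesis using opp.socle_eq[OF Re] by simp
qed

lemma left_minfull_if:
  assumes D: "S = S_l R"
  shows "left_minfull R" unfolding left_minfull_def
proof (intro conjI allI impI)
  fix e assume e: "local_idempotent R e"
  have "simple_right_ideal (opp R) (left_socle R (carrier R #> e))"
    using local_Se_simple[OF e] left_socle_principal[OF local_idempotentD(1)[OF e]] D by simp
  then show "left_socle R (carrier R #> e) \<noteq> {\<zero>}" by (simp add: simple_right_ideal_def)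
qed (use semiperfect left_mininjective_if[OF D] in auto)

lemma left_socle_simple_imp:
  assumes e: "local_idempotent R e"
    and simple: "simple_right_ideal (opp R) (left_socle R (carrier R #> e))"
  shows "left_socle R (carrier R #> e) = S #> e"
proof -
  have soc: "left_socle R (carrier R #> e) = S_l R #> e"
    using left_socle_principal[OF local_idempotentD(1)[OF e]] .
  have "S #> e \<subseteq> S_l R #> e" using S_subset_S_l unfolding subset_iff mem_principal_left by blast
  moreover have "right_ideal (opp R) (S #> e)" "S #> e \<noteq> {\<zero>}"
    using local_Se_simple[OF e] by (auto simp: simple_right_ideal_def)
  ultimately show ?thesis using simple unfolding soc simple_right_ideal_def by auto
qed

lemma S_eq_S_l_if_left_socles:
  assumes "\<And>e. local_idempotent R e \<Longrightarrow> left_socle R (carrier R #> e) = S #> e"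
  shows "S = S_l R"
proof
  show "S \<subseteq> S_l R" by (rule S_subset_S_l)
  show "S_l R \<subseteq> S"
  proof
    fix x assume x: "x \<in> S_l R"
    have xc: "x \<in> carrier R" using S_l_carrier[OF x] .
    show "x \<in> S"
    proof (rule mem_if_local[OF right_ideal_S_r xc])
      fix e assume e: "local_idempotent R e"
      have "x \<otimes> e \<in> S_l R #> e" using x unfolding mem_principal_left by blast
      then have "x \<otimes> e \<in> S #> e"
        using left_socle_principal[OF local_idempotentD(1)[OF e]] assms[OF e] by simp
      then obtain s where "s \<in> S" "x \<otimes> e = s \<otimes> e" unfolding mem_principal_left by blast
      then show "x \<otimes> e \<in> S"
        using right_idealD(4)[OF right_ideal_S_r] local_idempotentD(2)[OF e] by simp
    qed
  qed
qed

text \<open>Similarly, \<open>S\<close> is contained in a finite sum of left ideals \<open>Ser\<close>, each generated by one element.\<close>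

lemma S_left_finitely_generated: "\<exists>A. finite A \<and> A \<subseteq> S \<and> S \<subseteq> right_span (opp R) A"
proof -
  have span: "right_ideal (opp R) (right_span (opp R) A)" if "A \<subseteq> S" for A
    using that S_carrier opp.right_ideal_span by blast
  have "\<exists>A. finite A \<and> A \<subseteq> S \<and> (\<forall>s\<in>S. s \<otimes> \<one> \<in> right_span (opp R) A)"
  proof (rule one_local_induct)
    show "\<exists>A. finite A \<and> A \<subseteq> S \<and> (\<forall>s\<in>S. s \<otimes> \<zero> \<in> right_span (opp R) A)"
      using opp.right_idealD(2)[OF span[of "{}"]] S_carrier by (auto intro!: exI[of _ "{}"])
  next
    fix y e r assume "\<exists>A. finite A \<and> A \<subseteq> S \<and> (\<forall>s\<in>S. s \<otimes> y \<in> right_span (opp R) A)"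
    then obtain A where A: "finite A" "A \<subseteq> S" "\<forall>s\<in>S. s \<otimes> y \<in> right_span (opp R) A" by blast
    assume yr: "y \<in> carrier R" "r \<in> carrier R" and e: "local_idempotent R e"
    have ec: "e \<in> carrier R" using local_idempotentD(2)[OF e] .
    obtain s where s: "s \<in> S" "s \<otimes> e \<noteq> \<zero>" using local_S_nonzero[OF e] by blast
    let ?A = "insert (s \<otimes> e \<otimes> r) A"
    have ins: "?A \<subseteq> S" using A(2) right_idealD(4)[OF right_ideal_S_r] s(1) ec yr(2) by auto
    have "t \<otimes> (y \<oplus> e \<otimes> r) \<in> right_span (opp R) ?A" if t: "t \<in> S" for t
    proof -
      obtain c where c: "c \<in> carrier R" "t \<otimes> e = c \<otimes> (s \<otimes> e)"
        using local_transitive[OF e s t] by blast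
      have "t \<otimes> (y \<oplus> e \<otimes> r) = t \<otimes> y \<oplus> (t \<otimes> e) \<otimes> r"
        using S_carrier[OF t] yr ec by (simp add: r_distr m_assoc)
      also have "\<dots> = t \<otimes> y \<oplus> c \<otimes> (s \<otimes> e \<otimes> r)"
        unfolding c(2) using c(1) S_carrier[OF s(1)] ec yr(2) by (simp add: m_assoc)
      finally have eq: "t \<otimes> (y \<oplus> e \<otimes> r) = t \<otimes> y \<oplus> c \<otimes> (s \<otimes> e \<otimes> r)" .
      have "s \<otimes> e \<otimes> r \<in> right_span (opp R) ?A" "t \<otimes> y \<in> right_span (opp R) ?A"
        using A(3) t opp.span_superset[of ?A] opp.span_mono[of A ?A] by blast+
      then show ?thesis unfolding eq using opp.right_idealD(3,4)[OF span[OF ins]] c(1) by blast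
    qed
    then show "\<exists>A. finite A \<and> A \<subseteq> S \<and> (\<forall>s\<in>S. s \<otimes> (y \<oplus> e \<otimes> r) \<in> right_span (opp R) A)"
      using A(1) ins by (intro exI[of _ ?A]) simp
  qed
  then show ?thesis using S_carrier by (auto simp: subset_iff)
qed

text \<open>When \<open>S = S\<^sub>l\<close>, a left ideal \<open>L \<subseteq> S\<close> is a finite sum of simple left ideals \<open>Rk\<close>, each with \<open>kR\<close>
  simple by left mininjectivity, and right mininjectivity adds them one at a time.\<close>

lemma left_semisimple_eq_lr_ann:
  assumes D: "S = S_l R" and L: "right_ideal (opp R) L" "L \<subseteq> S_l R"
  shows "L = lr_ann R L"
proof -
  have lmin: "right_mininjective (opp R)" using left_mininjective_if[OF D] .
  obtain A where A: "finite A" "A \<subseteq> S_l R" "S_l R \<subseteq> right_span (opp R) A"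
    using S_left_finitely_generated D by auto
  show ?thesis
  proof (rule opp.fg_semisimple_induct[OF opp.semisimple_S_r A L])
    have "r_ann R {\<zero>} = carrier R" by (auto simp: r_ann_def)
    moreover have "l_ann R (carrier R) = {\<zero>}" by (auto simp: l_ann_def) (metis r_one one_closed)
    ultimately show "{\<zero>} = lr_ann R {\<zero>}" by simp
  next
    fix M T assume M: "right_ideal (opp R) M" "M \<subseteq> L" "M = lr_ann R M"
      and T: "simple_right_ideal (opp R) T" "T \<subseteq> L" "\<not> T \<subseteq> M"
    obtain k where k: "k \<in> T" "k \<notin> M" using T(3) by blast
    then have "k \<noteq> \<zero>" using opp.right_idealD(2)[OF M(1)] by blast
    note gen = left_simple_generator[OF T(1) k(1) this]
    have "simple_right_ideal R (k <# carrier R)"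
      using opp.mininjective_simple_left[OF lmin _ gen(1)] T(1) gen(2) by simp
    then have "lr_ann R (M <+> T) \<subseteq> M <+> T"
      unfolding gen(2) using mininjective_lr_ann_add[OF mininjective _ gen(1) M(1) M(3) k(2)] by blast
    moreover have "right_ideal (opp R) T" using T(1) by (simp add: simple_right_ideal_def)
    then have "M <+> T \<subseteq> lr_ann R (M <+> T)"
      using opp.rl_ann_superset[of "M <+> T"] opp.right_ideal_subset[OF opp.right_ideal_set_add[OF M(1)]]
      by blast
    ultimately show "M <+> T = lr_ann R (M <+> T)" by blast
  qed
qed

text \<open>To prove \<open>S\<^sub>l \<subseteq> S\<close>, it suffices to look at simple left ideals inside \<open>J\<close>: if \<open>k \<notin> J = r(S)\<close>, then
  \<open>s k \<noteq> \<zero>\<close> for some \<open>s \<in> S\<close>, and \<open>k \<in> Rsk \<subseteq> S\<close>.\<close>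

lemma S_eq_S_l_if_small:
  assumes small: "\<And>k. k \<in> J \<Longrightarrow> k \<in> S_l R \<Longrightarrow> simple_right_ideal (opp R) (carrier R #> k) \<Longrightarrow> k \<in> S"
  shows "S = S_l R"
proof
  show "S \<subseteq> S_l R" by (rule S_subset_S_l)
  show "S_l R \<subseteq> S"
  proof
    fix x assume "x \<in> S_l R"
    then show "x \<in> S"
    proof (induction rule: opp.socle_induct)
      case zero
      then show ?case using right_idealD(2)[OF right_ideal_S_r] .
    next
      case (add y k T)
      have "k \<in> S"
      proof (cases "k = \<zero>")
        case True
        then show ?thesis using right_idealD(2)[OF right_ideal_S_r] by simp
      next
        case k0: False
        note gen = left_simple_generator[OF add(1,3) k0]
        show ?thesis
        proof (cases "k \<in> J")
          case True
          then show ?thesis using small add(1,3) gen(2) opp.simple_subset_S_r[OF add(1)] by auto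
        next
          case False
          then have "k \<notin> r_ann R S" by (simp add: r_ann_S)
          then obtain s where s: "s \<in> S" "s \<otimes> k \<noteq> \<zero>" using gen(1) by (auto simp: r_ann_def)
          have "s \<otimes> k \<in> T" using s(1) S_carrier unfolding gen(2) mem_principal_left by blast
          then have T: "T = carrier R #> (s \<otimes> k)"
            by (rule left_simple_generator(2)[OF add(1) _ s(2)])
          have "k \<in> carrier R #> (s \<otimes> k)" using add(3) unfolding T .
          then obtain r where r: "r \<in> carrier R" "k = r \<otimes> (s \<otimes> k)"
            unfolding mem_principal_left by blast
          have "s \<otimes> k \<in> S" using right_idealD(4)[OF right_ideal_S_r s(1) gen(1)] .
          then show ?thesis using S_r_mult_left[OF r(1)] r(2) by metis
        qed
      qed
      then show ?case using add right_idealD(3)[OF right_ideal_S_r] by blast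
    qed
  qed
qed

text \<open>Suppose \<open>k \<in> J\<close> generates a simple left ideal but \<open>k f \<notin> S\<close> for some local \<open>f\<close>. Every \<open>x\<close>
  with \<open>k f x = \<zero>\<close> has \<open>f x \<in> J\<close>, so it is killed by \<open>S f \<noteq> 0\<close>. Hence \<open>S f \<subseteq> lr(Rkf) = Rkf\<close>, which
  is simple, and \<open>k f \<in> Sf \<subseteq> S\<close>.\<close>

lemma S_eq_S_l_if_left_small_lr_ann:
  assumes lr: "\<And>L. semisimple_left_ideal R L \<Longrightarrow> small_left_ideal R L \<Longrightarrow> L = lr_ann R L"
  shows "S = S_l R"
proof (rule S_eq_S_l_if_small)
  fix k assume k: "k \<in> J" "simple_right_ideal (opp R) (carrier R #> k)"
  have kc: "k \<in> carrier R" using k jacobson_carrier by blast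
  show "k \<in> S"
  proof (rule mem_if_local[OF right_ideal_S_r kc], rule ccontr)
    fix f assume f: "local_idempotent R f" and kf: "k \<otimes> f \<notin> S"
    note f' = local_idempotentD[OF f]
    have kfc: "k \<otimes> f \<in> carrier R" "k \<otimes> f \<in> J" using kc f'(2) jacobson_right_mult[OF k(1)] by auto
    have kf0: "k \<otimes> f \<noteq> \<zero>" using kf right_idealD(2)[OF right_ideal_S_r] by metis
    let ?L = "carrier R #> (k \<otimes> f)"
    have L: "simple_right_ideal (opp R) ?L" using opp.simple_mult_left[OF k(2) kc f'(2) kf0] .
    then have L': "right_ideal (opp R) ?L" by (simp add: simple_right_ideal_def)
    have "?L \<subseteq> J" using jacobson_left_mult kfc(2) by (auto simp: mem_principal_left)
    then have "small_left_ideal R ?L" using small_left_if_subset_jacobson[OF L'] by blast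
    moreover have "semisimple_left_ideal R ?L"
      using L' opp.simple_subset_S_r[OF L] by (simp add: opp.semisimple_iff)
    ultimately have lrL: "?L = lr_ann R ?L" using lr by blast
    obtain s where s: "s \<in> S" "s \<otimes> f \<noteq> \<zero>" using local_S_nonzero[OF f] by blast
    have sfS: "s \<otimes> f \<in> S" using right_idealD(4)[OF right_ideal_S_r s(1) f'(2)] .
    have "s \<otimes> f \<otimes> x = \<zero>" if x: "x \<in> r_ann R ?L" for x
    proof -
      have xc: "x \<in> carrier R" using x by (simp add: r_ann_def)
      have kfx: "k \<otimes> f \<otimes> x = \<zero>" using x opp.principal_self[OF kfc(1)] by (auto simp: r_ann_def)
      have "f \<otimes> x \<in> J"
      proof (rule ccontr)
        assume "f \<otimes> x \<notin> J"
        then obtain z where z: "z \<in> carrier R" "f \<otimes> x \<otimes> z = f"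
          using local_right_inverse[OF f xc] by blast
        have "k \<otimes> (f \<otimes> x \<otimes> z) = k \<otimes> f \<otimes> x \<otimes> z" using kc f'(2) xc z(1) by (simp add: m_assoc)
        then show False using z kfx kf0 by simp
      qed
      then show ?thesis
        using S_mult_jacobson[OF s(1)] S_carrier[OF s(1)] f'(2) xc by (simp add: m_assoc)
    qed
    then have "s \<otimes> f \<in> lr_ann R ?L" using S_carrier[OF sfS] by (simp add: l_ann_def)
    then have "s \<otimes> f \<in> ?L" using lrL by (rule ssubst[rotated])
    then have "?L = carrier R #> (s \<otimes> f)" by (rule left_simple_generator(2)[OF L _ s(2)])
    then have "k \<otimes> f \<in> carrier R #> (s \<otimes> f)" using opp.principal_self[OF kfc(1)] by (rule subst)
    then obtain r where "r \<in> carrier R" "k \<otimes> f = r \<otimes> (s \<otimes> f)"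
      unfolding mem_principal_left by blast
    then show False using S_r_mult_left[OF _ sfS] kf by simp
  qed
qed

text \<open>Let \<open>y\<close> kill \<open>S \<inter> J\<close> and let \<open>g \<in> S\<close> be an idempotent generating \<open>S\<close> modulo \<open>J\<close>. Then
  \<open>y (\<one> - g)\<close> kills \<open>S\<close>, so it lies in \<open>J\<close> and kills \<open>S\<^sub>l\<close>, while \<open>g k \<in> S \<inter> J\<close> for \<open>k \<in> J\<close>.
  Therefore \<open>S\<^sub>l \<inter> J \<subseteq> rl(S \<inter> J)\<close>.\<close>

lemma S_eq_S_l_if_S_Int_J:
  assumes j: "S \<inter> J = rl_ann R (S \<inter> J)"
  shows "S = S_l R"
proof (rule S_eq_S_l_if_small)
  fix k assume k: "k \<in> J" "k \<in> S_l R"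
  have kc: "k \<in> carrier R" using k jacobson_carrier by blast
  obtain g where g: "idempotent_elem R g" "g \<in> S" "\<And>x. x \<in> S \<Longrightarrow> x \<ominus> g \<otimes> x \<in> J"
    using right_ideal_idempotent[OF right_ideal_S_r] by blast
  note g' = idempotentD[OF g(1)]
  have "y \<otimes> k = \<zero>" if y: "y \<in> l_ann R (S \<inter> J)" for y
  proof -
    have yc: "y \<in> carrier R" and kill: "\<And>x. x \<in> S \<Longrightarrow> x \<in> J \<Longrightarrow> y \<otimes> x = \<zero>"
      using y by (auto simp: l_ann_def)
    have "y \<otimes> (\<one> \<ominus> g) \<otimes> s = \<zero>" if s: "s \<in> S" for s
    proof -
      have "s \<ominus> g \<otimes> s \<in> S" using right_idealD(6)[OF right_ideal_S_r s S_r_mult_left[OF g'(1) s]] .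
      then have "y \<otimes> (s \<ominus> g \<otimes> s) = \<zero>" using kill g(3)[OF s] by blast
      then show ?thesis using yc g'(1) S_carrier[OF s] by (simp add: m_assoc mult_one_minus(1))
    qed
    then have "y \<otimes> (\<one> \<ominus> g) \<in> l_ann R S" using yc g'(1) by (simp add: l_ann_def)
    then have "y \<otimes> (\<one> \<ominus> g) \<in> J" by (simp add: l_ann_S)
    then have "y \<otimes> (\<one> \<ominus> g) \<otimes> k = \<zero>" using jacobson_mult_S_l k(2) by blast
    moreover have "y \<otimes> (g \<otimes> k) = \<zero>"
      using kill right_idealD(4)[OF right_ideal_S_r g(2) kc] jacobson_left_mult[OF g'(1) k(1)] by blast
    moreover have "y \<otimes> k = y \<otimes> (\<one> \<ominus> g) \<otimes> k \<oplus> y \<otimes> (g \<otimes> k)"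
      using yc kc g'(1) by (simp add: mult_one_minus(2)) algebra
    ultimately show ?thesis by simp
  qed
  then have "k \<in> rl_ann R (S \<inter> J)" using kc by (simp add: r_ann_def)
  then show "k \<in> S" using j by blast
qed

lemma r_ann_S_l_Int_J_essential: "essential_in R (r_ann R (S_l R \<inter> J)) (carrier R)"
proof -
  have ri: "right_ideal R (r_ann R (S_l R \<inter> J))"
    using jacobson_carrier by (intro right_ideal_r_ann) blast
  have sub: "S \<subseteq> r_ann R (S_l R \<inter> J)" using S_carrier jacobson_mult_S by (auto simp: r_ann_def)
  show ?thesis unfolding essential_in_def
  proof (intro conjI allI impI)
    fix C assume "right_ideal R C \<and> C \<subseteq> carrier R \<and> C \<noteq> {\<zero>}"
    then obtain x where "x \<in> C" "x \<in> S" "x \<noteq> \<zero>" using S_meets by blast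
    then show "r_ann R (S_l R \<inter> J) \<inter> C \<noteq> {\<zero>}" using sub by blast
  qed (use ri right_ideal_subset[OF ri] in auto)
qed

lemma right_minfull: "right_minfull R" unfolding right_minfull_def
proof (intro conjI allI impI)
  fix e assume e: "local_idempotent R e"
  then show "right_socle R (e <# carrier R) \<noteq> {\<zero>}"
    using local_socle_simple[OF e] socle_eq[OF right_ideal_principal[OF local_idempotentD(2)[OF e]]]
    by (simp add: simple_right_ideal_def)
qed (use semiperfect mininjective in auto)

lemma right_fin_cogenerated: "right_finitely_cogenerated R"
proof -
  obtain A where A: "finite A" "A \<subseteq> S" "S \<subseteq> right_span R A" using S_finitely_generated by blast
  then have "right_span R A = S" using span_least[OF right_ideal_S_r] by blast
  then show ?thesis
    unfolding right_finitely_cogenerated_def using A S_carrier S_r_essential by blast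
qed

lemma equivalences:
  shows "(S = rl_ann R S) = (S = S_l R)"
    and "(\<forall>K. semisimple_right_ideal R K \<longrightarrow> K = rl_ann R K) = (S = S_l R)"
    and "(\<forall>k\<in>carrier R. simple_right_ideal R (k <# carrier R) \<longrightarrow>
      k <# carrier R = rl_ann R (k <# carrier R)) = (S = S_l R)"
    and "(\<forall>e. local_idempotent R e \<longrightarrow>
      simple_right_ideal (opp R) (left_socle R (carrier R #> e))) = (S = S_l R)"
    and "(\<forall>e. local_idempotent R e \<longrightarrow> left_socle R (carrier R #> e) = S #> e) = (S = S_l R)"
    and "left_mininjective R = (S = S_l R)"
    and "(\<forall>L. semisimple_left_ideal R L \<longrightarrow> L = lr_ann R L) = (S = S_l R)"
    and "left_minfull R = (S = S_l R)"
    and "(S \<inter> J = rl_ann R (S \<inter> J)) = (S = S_l R)"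
    and "(\<forall>K. semisimple_right_ideal R K \<and> small_right_ideal R K \<longrightarrow> K = rl_ann R K) = (S = S_l R)"
    and "(\<forall>L. semisimple_left_ideal R L \<and> small_left_ideal R L \<longrightarrow> L = lr_ann R L) = (S = S_l R)"
proof -
  have semi_imp: "K = rl_ann R K" if "S = S_l R" "semisimple_right_ideal R K" for K
    using semisimple_eq_rl_ann[OF that(1)] that(2) by (simp add: semisimple_iff)
  have left_semi_imp: "L = lr_ann R L" if "S = S_l R" "semisimple_left_ideal R L" for L
    using left_semisimple_eq_lr_ann[OF that(1)] that(2) opp.semisimple_iff by blast
  have SJ: "right_ideal R (S \<inter> J)"
    using right_ideal_Int right_ideal_S_r right_ideal_jacobson by blast
  have SJ': "semisimple_right_ideal R (S \<inter> J)" "small_right_ideal R (S \<inter> J)"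
    using SJ small_if_subset_jacobson[OF SJ] by (auto simp: semisimple_iff)
  show a: "(S = rl_ann R S) = (S = S_l R)" by (simp add: rl_ann_S)
  show "(\<forall>K. semisimple_right_ideal R K \<longrightarrow> K = rl_ann R K) = (S = S_l R)"
    using semi_imp semisimple_S_r a by metis
  show "(\<forall>k\<in>carrier R. simple_right_ideal R (k <# carrier R) \<longrightarrow>
      k <# carrier R = rl_ann R (k <# carrier R)) = (S = S_l R)"
  proof
    assume "S = S_l R"
    then show "\<forall>k\<in>carrier R. simple_right_ideal R (k <# carrier R) \<longrightarrow>
      k <# carrier R = rl_ann R (k <# carrier R)"
      using semi_imp simple_subset_S_r right_ideal_principal semisimple_iff by metis
  qed (use S_eq_S_l_if_simple in blast)
  show f: "(\<forall>e. local_idempotent R e \<longrightarrow> left_socle R (carrier R #> e) = S #> e) = (S = S_l R)"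
    using S_eq_S_l_if_left_socles left_socle_principal local_idempotentD(1) by metis
  show "(\<forall>e. local_idempotent R e \<longrightarrow>
      simple_right_ideal (opp R) (left_socle R (carrier R #> e))) = (S = S_l R)"
    unfolding f[symmetric] using left_socle_simple_imp local_Se_simple by metis
  show g: "left_mininjective R = (S = S_l R)"
    using left_mininjective_if left_mininjective_imp by blast
  show "left_minfull R = (S = S_l R)" using left_minfull_if g unfolding left_minfull_def by blast
  show "(S \<inter> J = rl_ann R (S \<inter> J)) = (S = S_l R)"
    using S_eq_S_l_if_S_Int_J semi_imp SJ'(1) by blast
  then show "(\<forall>K. semisimple_right_ideal R K \<and> small_right_ideal R K \<longrightarrow> K = rl_ann R K) = (S = S_l R)"
    using semi_imp SJ' by blast
  show l: "(\<forall>L. semisimple_left_ideal R L \<and> small_left_ideal R L \<longrightarrow> L = lr_ann R L) = (S = S_l R)"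
    using S_eq_S_l_if_left_small_lr_ann left_semi_imp by blast
  show "(\<forall>L. semisimple_left_ideal R L \<longrightarrow> L = lr_ann R L) = (S = S_l R)"
    using l left_semi_imp by blast
qed

end

theorem corollary4p15:
  fixes R :: "('a, 'm) ring_scheme" (structure)
  assumes "ring R"
    and "semiperfect R"
    and "right_ss_injective R"
    and "essential_in R (S_r R) (carrier R)"
  shows "right_minfull R \<and>
    (\<forall>K. simple_right_ideal R K \<longrightarrow>
       (\<exists>D. right_direct_summand R D \<and> essential_in R K D)) \<and>
    ((\<forall>e. local_idempotent R e \<longrightarrow>
        simple_right_ideal R (right_socle R (e <# carrier R)) \<and>
        essential_in R (right_socle R (e <# carrier R)) (e <# carrier R)) \<and>
     right_finitely_cogenerated R) \<and>
    (\<forall>I. semisimple_right_ideal R I \<longrightarrow>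
       (\<exists>e. idempotent_elem R e \<and> essential_in R I (rl_ann R I) \<and>
            essential_in R (rl_ann R I) (e <# carrier R))) \<and>
    (S_r R \<subseteq> S_l R \<and> S_l R \<subseteq> rl_ann R (S_r R)) \<and>
    (\<forall>I. \<forall>a\<in>carrier R.
       semisimple_right_ideal R I \<and> simple_right_ideal R (a <# carrier R) \<and>
       I \<inter> (a <# carrier R) = {\<zero>} \<longrightarrow>
       direct_sum2 R (rl_ann R I) (rl_ann R (a <# carrier R))
         (rl_ann R (I <+> (a <# carrier R)))) \<and>
    (\<forall>(n::nat) a T.
       (\<forall>i\<in>{1..n}. a i \<in> carrier R \<and> simple_right_ideal R (a i <# carrier R)) \<and>
       direct_sum R {1..n} (\<lambda>i. a i <# carrier R) T \<longrightarrow>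
       direct_sum R {1..n} (\<lambda>i. rl_ann R (a i <# carrier R)) (rl_ann R T)) \<and>
    (let conds =
       {S_r R = rl_ann R (S_r R),
        (\<forall>K. semisimple_right_ideal R K \<longrightarrow> K = rl_ann R K),
        (\<forall>k\<in>carrier R. simple_right_ideal R (k <# carrier R) \<longrightarrow>
           k <# carrier R = rl_ann R (k <# carrier R)),
        S_r R = S_l R,
        (\<forall>e. local_idempotent R e \<longrightarrow>
           simple_right_ideal (opp R) (left_socle R (carrier R #> e))),
        (\<forall>e. local_idempotent R e \<longrightarrow>
           left_socle R (carrier R #> e) = S_r R #> e),
        left_mininjective R,
        (\<forall>L. semisimple_left_ideal R L \<longrightarrow> L = lr_ann R L),
        left_minfull R,
        S_r R \<inter> jacobson R = rl_ann R (S_r R \<inter> jacobson R),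
        (\<forall>K. semisimple_right_ideal R K \<and> small_right_ideal R K \<longrightarrow> K = rl_ann R K),
        (\<forall>L. semisimple_left_ideal R L \<and> small_left_ideal R L \<longrightarrow> L = lr_ann R L)}
     in (\<forall>P\<in>conds. \<forall>Q\<in>conds. P \<longleftrightarrow> Q) \<and>
        ((\<exists>P\<in>conds. P) \<longrightarrow>
           essential_in R (r_ann R (S_l R \<inter> jacobson R)) (carrier R)))"
proof -
  interpret ss_injective_setting R
    using assms by (simp add: ss_injective_setting_def semiperfect_ring_def
        semiperfect_ring_axioms_def ss_injective_setting_axioms_def)
  have soc: "right_socle R (e <# carrier R) = (e <# carrier R) \<inter> S_r R" if "local_idempotent R e" for e
    using socle_eq right_ideal_principal local_idempotentD(2)[OF that] by blast
  have 1: "\<exists>D. right_direct_summand R D \<and> essential_in R K D" if K: "simple_right_ideal R K" for K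
  proof -
    have "right_ideal R K" using K by (simp add: simple_right_ideal_def)
    then obtain e where "idempotent_elem R e" "essential_in R K (e <# carrier R)"
      using semisimple_essential_in_rl simple_subset_S_r[OF K] by metis
    then show ?thesis using idempotent_direct_summand by blast
  qed
  have 2: "simple_right_ideal R (right_socle R (e <# carrier R)) \<and>
      essential_in R (right_socle R (e <# carrier R)) (e <# carrier R)" if e: "local_idempotent R e" for e
    unfolding soc[OF e] using local_socle_simple[OF e] essential_Int_S
      right_ideal_principal[OF local_idempotentD(2)[OF e]] by blast
  have 3: "\<exists>e. idempotent_elem R e \<and> essential_in R I (rl_ann R I) \<and>
      essential_in R (rl_ann R I) (e <# carrier R)" if "semisimple_right_ideal R I" for I
    using that semisimple_essential_in_rl unfolding semisimple_iff by metis
  have 4: "S_r R \<subseteq> S_l R \<and> S_l R \<subseteq> rl_ann R (S_r R)" using S_subset_S_l rl_ann_S by simp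
  have 5: "direct_sum2 R (rl_ann R I) (rl_ann R (a <# carrier R)) (rl_ann R (I <+> (a <# carrier R)))"
    if "a \<in> carrier R" "semisimple_right_ideal R I \<and> simple_right_ideal R (a <# carrier R) \<and>
       I \<inter> (a <# carrier R) = {\<zero>}" for I a
    using that rl_ann_direct_sum2 simple_subset_S_r right_ideal_principal unfolding semisimple_iff by blast
  have 6: "direct_sum R {1..n} (\<lambda>i. rl_ann R (a i <# carrier R)) (rl_ann R T)"
    if "(\<forall>i\<in>{1..n}. a i \<in> carrier R \<and> simple_right_ideal R (a i <# carrier R)) \<and>
       direct_sum R {1..n} (\<lambda>i. a i <# carrier R) T" for n :: nat and a T
    using that simple_subset_S_r right_ideal_principal by (intro rl_ann_direct_sum) auto
  note eqs = equivalences refl[of "S_r R = S_l R"]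
  have equiv: "\<forall>P\<in>X. \<forall>Q\<in>X. P \<longleftrightarrow> Q" if "\<forall>P\<in>X. P = D" for X :: "bool set" and D using that by blast
  show ?thesis unfolding Let_def
    by (intro conjI impI right_minfull right_fin_cogenerated allI[OF impI[OF 1]] allI[OF impI[OF 2]]
        allI[OF impI[OF 3]] conjunct1[OF 4] conjunct2[OF 4] allI[OF ballI[OF impI[OF 5]]]
        allI[OF allI[OF allI[OF impI[OF 6]]]] r_ann_S_l_Int_J_essential
        equiv[where D = "S_r R = S_l R"])
      ((unfold ball_simps, intro conjI TrueI eqs) | simp)+
qed

end
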